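(* Let $D=(0,1)$, $\alpha\in(3/2,2)$, $\mu\ge\alpha$, $q\in H^1(D)$, $c_0=\Gamma(\mu+1)/\Gamma(1+\mu-\alpha)$, $p(x)=c_0x^{\mu-\alpha}-q(x)x^\mu$, assume $p\in H^1(D)$, and let $A(\psi,\varphi)=(\psi',\varphi')+({}_0^RD_x^{2-\alpha}\psi,q\varphi)+({}_0^RD_x^{2-\alpha}\psi)(1)(p,\varphi)$ on $V=H^1_0(D)$ satisfy: $A(w,v)=0\ \forall v\in V\Rightarrow w=0$, and $A(w,v)=0\ \forall w\in V\Rightarrow v=0$. Fix $k\in\{0,1\}$ and the spaces $V_h$ below. Define $T:L^2(D)\to V$ by $A(Tf,\varphi)=(f,\varphi)$ for all $\varphi\in V$, $T_h:L^2(D)\to V_h$ by $A(T_hf,\varphi)=(f,\varphi)$ for all $\varphi\in V_h$ (for $h$ sufficiently small), and $S:V\to L^2(D)$ by $Sw={}_0^RD_x^{2-\alpha}w-({}_0^RD_x^{2-\alpha}w)(1)x^\mu$. Let $\lambda^{-1}$ be an eigenvalue of the compact operator $ST:L^2(D)\to L^2(D)$ with algebraic multiplicity $m$ and ascent $\delta$ (the smallest integer $n$ with $N((\lambda^{-1}-ST)^n)=N((\lambda^{-1}-ST)^{n+1})$), and let $(\lambda_h^j)^{-1}$, $j=1,\dots,m$, be the eigenvalues of $ST_h$ (counted with algebraic multiplicity) converging to $\lambda^{-1}$ as $h\to0$. Then, for all sufficiently small $h$: (i) for any $\gamma<\alpha+k-1/2$, $|\lambda-\lambda_h^j|\le Ch^{\gamma/\delta}$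 for $j=1,\dots,m$; (ii) if $\lambda_h^{-1}$ is an eigenvalue of $ST_h$ with $\lambda_h\to\lambda$, and for each $h$, $u_h$ is a unit vector in $L^2(D)$ with $(\lambda_h^{-1}-ST_h)^{n}u_h=0$ for some positive integer $n\le\delta$, then for any integer $l$ with $n\le l\le\delta$ there is a vector $u$ with $(\lambda^{-1}-ST)^lu=0$ and, for any $\gamma<\alpha+k-1/2$, $\|u-u_h\|_{L^2(D)}\le Ch^{\gamma/\delta}$.
   Context: $(\cdot,\cdot)$ is the $L^2(D)$ inner product; $N(\cdot)$ denotes the null space. For $w\in H^1_0(D)$, ${}_0^RD_x^{2-\alpha}w(x)=\frac{1}{\Gamma(\alpha-1)}\int_0^x(x-t)^{\alpha-2}w'(t)dt$ and $({}_0^RD_x^{2-\alpha}w)(1)=\frac{1}{\Gamma(\alpha-1)}\int_0^1(1-t)^{\alpha-2}w'(t)dt$. $V_h$: for a quasi-uniform partition of $D$ with maximal subinterval length $h$, the space of continuous piecewise polynomials of degree at most $k+1$ vanishing at $0$ and $1$. The eigenpairs $(\lambda^{-1},u)$ of $ST$ correspond to the fractional Sturm–Liouville problem $-{}_0^RD_x^\alpha u+qu=\lambda u$, $u(0)=u(1)=0$, and $(\lambda_h^{-1},u_h)$ of $ST_h$ to its finite element approximation. *)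

theory Defs
  imports "HOL-Analysis.Analysis" "HOL-Library.Multiset"
begin

text \<open>Elements of L2(D), D = (0,1), are represented by complex-valued functions on the
reals; only their values on [0,1] matter, and equality is understood almost everywhere.\<close>

definition L2 :: "(real \<Rightarrow> complex) \<Rightarrow> bool" where
  "L2 f \<longleftrightarrow> set_borel_measurable lborel {0..1} f \<and>
              set_integrable lborel {0..1} (\<lambda>x. (norm (f x))^2)"

definition aeq :: "(real \<Rightarrow> complex) \<Rightarrow> (real \<Rightarrow> complex) \<Rightarrow> bool" where
  "aeq f g \<longleftrightarrow> (AE x in lborel. x \<in> {0..1} \<longrightarrow> f x = g x)"

definition ip :: "(real \<Rightarrow> complex) \<Rightarrow> (real \<Rightarrow> complex) \<Rightarrow> complex" where
  "ip f g = (LINT x:{0..1}|lborel. f x * cnj (g x))"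

definition l2norm :: "(real \<Rightarrow> complex) \<Rightarrow> real" where
  "l2norm f = sqrt (LINT x:{0..1}|lborel. (norm (f x))^2)"

definition has_wderiv :: "(real \<Rightarrow> complex) \<Rightarrow> (real \<Rightarrow> complex) \<Rightarrow> bool" where
  "has_wderiv f g \<longleftrightarrow> L2 g \<and>
     (\<exists>c. AE x in lborel. x \<in> {0..1} \<longrightarrow> f x = c + (LINT t:{0..x}|lborel. g t))"

definition H1 :: "(real \<Rightarrow> complex) \<Rightarrow> bool" where
  "H1 f \<longleftrightarrow> L2 f \<and> (\<exists>g. has_wderiv f g)"

text \<open>H^1_0(D): the absolutely continuous representative vanishes at 0 and 1.\<close>
definition H01 :: "(real \<Rightarrow> complex) \<Rightarrow> bool" where
  "H01 f \<longleftrightarrow> L2 f \<and> (\<exists>g. L2 g \<and>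
     (AE x in lborel. x \<in> {0..1} \<longrightarrow> f x = (LINT t:{0..x}|lborel. g t)) \<and>
     (LINT t:{0..1}|lborel. g t) = 0)"

definition wd :: "(real \<Rightarrow> complex) \<Rightarrow> (real \<Rightarrow> complex)" where
  "wd f = (SOME g. has_wderiv f g)"

definition RL :: "real \<Rightarrow> (real \<Rightarrow> complex) \<Rightarrow> real \<Rightarrow> complex" where
  "RL \<alpha> w x = of_real (1 / Gamma (\<alpha> - 1)) *
      (LINT t:{0..x}|lborel. of_real ((x - t) powr (\<alpha> - 2)) * wd w t)"

definition Aform :: "real \<Rightarrow> (real \<Rightarrow> real) \<Rightarrow> (real \<Rightarrow> real) \<Rightarrow>
    (real \<Rightarrow> complex) \<Rightarrow> (real \<Rightarrow> complex) \<Rightarrow> complex" where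
  "Aform \<alpha> q p \<psi> \<phi> = ip (wd \<psi>) (wd \<phi>) + ip (RL \<alpha> \<psi>) (\<lambda>x. of_real (q x) * \<phi> x)
       + RL \<alpha> \<psi> 1 * ip (\<lambda>x. of_real (p x)) \<phi>"

definition Vspace :: "(real \<Rightarrow> complex) set" where
  "Vspace = {f. H01 f}"

definition Tsol :: "real \<Rightarrow> (real \<Rightarrow> real) \<Rightarrow> (real \<Rightarrow> real) \<Rightarrow> (real \<Rightarrow> complex) set \<Rightarrow>
    (real \<Rightarrow> complex) \<Rightarrow> (real \<Rightarrow> complex)" where
  "Tsol \<alpha> q p W f = (SOME w. w \<in> W \<and> (\<forall>\<phi>\<in>W. Aform \<alpha> q p w \<phi> = ip f \<phi>))"

definition Sop :: "real \<Rightarrow> real \<Rightarrow> (real \<Rightarrow> complex) \<Rightarrow> (real \<Rightarrow> complex)" where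
  "Sop \<alpha> \<mu> w = (\<lambda>x. RL \<alpha> w x - RL \<alpha> w 1 * of_real (x powr \<mu>))"

definition is_mesh :: "real list \<Rightarrow> bool" where
  "is_mesh xs \<longleftrightarrow> length xs \<ge> 2 \<and> hd xs = 0 \<and> last xs = 1 \<and> sorted_wrt (<) xs"

definition meshsize :: "real list \<Rightarrow> real" where
  "meshsize xs = Max {xs ! Suc i - xs ! i | i. Suc i < length xs}"

definition meshmin :: "real list \<Rightarrow> real" where
  "meshmin xs = Min {xs ! Suc i - xs ! i | i. Suc i < length xs}"

definition Vh :: "nat \<Rightarrow> real list \<Rightarrow> (real \<Rightarrow> complex) set" where
  "Vh k xs = {v. continuous_on {0..1} v \<and> v 0 = 0 \<and> v 1 = 0 \<and>
     (\<forall>i. Suc i < length xs \<longrightarrow> (\<exists>P :: complex poly. degree P \<le> k + 1 \<and>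
        (\<forall>x\<in>{xs ! i .. xs ! Suc i}. v x = poly P (of_real x))))}"

definition shifted :: "((real \<Rightarrow> complex) \<Rightarrow> (real \<Rightarrow> complex)) \<Rightarrow> complex \<Rightarrow>
    (real \<Rightarrow> complex) \<Rightarrow> (real \<Rightarrow> complex)" where
  "shifted K z u = (\<lambda>x. z * u x - K u x)"

definition nullsp :: "((real \<Rightarrow> complex) \<Rightarrow> (real \<Rightarrow> complex)) \<Rightarrow> complex \<Rightarrow> nat \<Rightarrow>
    (real \<Rightarrow> complex) set" where
  "nullsp K z n = {u. L2 u \<and> aeq ((shifted K z ^^ n) u) (\<lambda>_. 0)}"

definition is_eigenvalue :: "((real \<Rightarrow> complex) \<Rightarrow> (real \<Rightarrow> complex)) \<Rightarrow> complex \<Rightarrow> bool" where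
  "is_eigenvalue K z \<longleftrightarrow> (\<exists>u. L2 u \<and> \<not> aeq u (\<lambda>_. 0) \<and> aeq (K u) (\<lambda>x. z * u x))"

definition ae_dim :: "(real \<Rightarrow> complex) set \<Rightarrow> nat \<Rightarrow> bool" where
  "ae_dim E m \<longleftrightarrow> (\<exists>us :: nat \<Rightarrow> real \<Rightarrow> complex. (\<forall>i<m. us i \<in> E) \<and>
     (\<forall>c. aeq (\<lambda>x. \<Sum>i<m. c i * us i x) (\<lambda>_. 0) \<longrightarrow> (\<forall>i<m. c i = 0)) \<and>
     (\<forall>u\<in>E. \<exists>c. aeq u (\<lambda>x. \<Sum>i<m. c i * us i x)))"

definition alg_mult :: "((real \<Rightarrow> complex) \<Rightarrow> (real \<Rightarrow> complex)) \<Rightarrow> complex \<Rightarrow> nat \<Rightarrow> bool" where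
  "alg_mult K z m \<longleftrightarrow> ae_dim (\<Union>n. nullsp K z n) m"

definition ascent :: "((real \<Rightarrow> complex) \<Rightarrow> (real \<Rightarrow> complex)) \<Rightarrow> complex \<Rightarrow> nat \<Rightarrow> bool" where
  "ascent K z d \<longleftrightarrow> nullsp K z d = nullsp K z (Suc d) \<and>
     (\<forall>n<d. nullsp K z n \<noteq> nullsp K z (Suc n))"

end

theory Submission
  imports Defs "HOL-Complex_Analysis.Great_Picard"
begin

text \<open>
  For a solution \<open>w\<close> put \<open>r = RL \<alpha> w\<close>.  Integrating by parts, \<open>A(w, \<phi>) = (f, \<phi>)\<close> for all test
  functions says that \<open>w'\<close> is the \<open>L\<^sup>2\<close> projection, onto the mean-zero derivatives of test functions,
  of the primitive of \<open>q r + r(1) p - f\<close>.  Hence \<open>r = B r - P f\<close> with a compact operator \<open>B\<close> on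
  \<open>C[0,1]\<close>, and replacing the projection by its piecewise polynomial counterpart gives the same
  equation for the finite element solution.  All of the analysis can therefore be carried out in
  \<open>C[0,1]\<close> with the supremum norm, where the generalized eigenvectors live.

  The projection error \<open>d\<close> has mean zero on every mesh element, so its primitive is of size
  \<open>h \<bar>d\<bar>\<close> and the fractional integral of \<open>d\<close> gains a factor \<open>h powr (\<alpha> - 1)\<close>.  Primitives of
  \<open>L\<^sup>2\<close> functions are Hoelder continuous of order one half, which gives \<open>\<bar>d\<bar> = O(h powr (1/2))\<close> in
  general, and \<open>O(h powr (3/2))\<close> for \<open>k = 1\<close> on the generalized eigenspace, whose elements are
  Hoelder continuous themselves.

  The spectral part splits the space into the generalized eigenspace and a complementary range.
  In block form a perturbed eigenvector is, up to the perturbation \<open>\<eta>\<close> of the operator on the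
  generalized eigenspace, annihilated by \<open>\<sigma> + L\<close> with \<open>L\<close> nilpotent of order \<open>\<delta>\<close>; so
  \<open>\<bar>\<sigma>\<bar> ^ \<delta> = O(\<eta>)\<close>.
\<close>

subsection \<open>Compact perturbations of the identity\<close>

text \<open>Eigenvalues and null spaces are stated in L2, up to null sets. For z \<noteq> 0 this
  agrees with C[0,1]: ST has continuous values, so a function killed almost everywhere by a power of
  z - ST coincides almost everywhere with a continuous function killed exactly, and the same is true
  of the discrete operators. On the way back the supremum norm dominates the L2 norm. Conversely the
  unit L2 norm of a discrete vector bounds the supremum norm of its representative uniformly in the
  mesh, because data enter only through the growth of their primitives.

  The exact and the finite element problem are instances of one locale and differ in the projection.
  Discrete stability is inherited from the exact equation once the perturbation is small, and the
  consistency error is evaluated at the exact solution, so the regularity of exact solutions decides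
  the rate. This is why the perturbation is measured twice: small on the whole space, of full rate
  on the generalized eigenspace. The condition \<alpha> > 3/2 makes the kernel square integrable and
  gives \<alpha> - 1 > 1/2.\<close>

definition compact_operator :: "('a::real_normed_vector \<Rightarrow> 'b::real_normed_vector) \<Rightarrow> bool" where
  "compact_operator H \<longleftrightarrow> bounded_linear H \<and>
     (\<forall>x::nat \<Rightarrow> 'a. bounded (range x) \<longrightarrow>
        (\<exists>l r. strict_mono r \<and> (\<lambda>n. H (x (r n))) \<longlonglongrightarrow> l))"

lemma compact_operatorE:
  assumes "compact_operator H" "\<And>n::nat. norm (x n) \<le> B"
  obtains l r where "strict_mono r" "(\<lambda>n. H (x (r n))) \<longlonglongrightarrow> l"
proof -
  have "bounded (range x)"
    using assms(2) by (auto simp: bounded_iff)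
  then show ?thesis
    using assms(1) that unfolding compact_operator_def by blast
qed

lemma compact_operator_zero: "compact_operator (\<lambda>x. 0)"
  unfolding compact_operator_def
proof (intro conjI allI impI exI)
  show "strict_mono (\<lambda>n::nat. n)" by (simp add: strict_mono_def)
qed (auto simp: bounded_linear_zero)

lemma compact_operator_add:
  fixes G H :: "'a::real_normed_vector \<Rightarrow> 'b::real_normed_vector"
  assumes G: "compact_operator G" and H: "compact_operator H"
  shows "compact_operator (\<lambda>x. G x + H x)"
  unfolding compact_operator_def
proof (intro conjI allI impI)
  show "bounded_linear (\<lambda>x. G x + H x)"
    using assms by (auto simp: compact_operator_def intro: bounded_linear_add)
  fix x :: "nat \<Rightarrow> 'a" assume "bounded (range x)"
  then obtain B where B: "\<And>n. norm (x n) \<le> B" by (auto simp: bounded_iff)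
  obtain l r where r: "strict_mono r" "(\<lambda>n. G (x (r n))) \<longlonglongrightarrow> l"
    by (rule compact_operatorE[OF G B])
  obtain l' r' where r': "strict_mono r'" "(\<lambda>n. H (x (r (r' n)))) \<longlonglongrightarrow> l'"
    by (rule compact_operatorE[OF H B])
  have "(\<lambda>n. G (x (r (r' n)))) \<longlonglongrightarrow> l"
    using LIMSEQ_subseq_LIMSEQ[OF r(2) r'(1)] by (simp add: o_def)
  with r'(2) have "(\<lambda>n. G (x ((r \<circ> r') n)) + H (x ((r \<circ> r') n))) \<longlonglongrightarrow> l + l'"
    by (auto intro: tendsto_add)
  then show "\<exists>l r. strict_mono r \<and> (\<lambda>n. G (x (r n)) + H (x (r n))) \<longlonglongrightarrow> l"
    using strict_mono_o[OF r(1) r'(1)] by blast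
qed

lemma compact_operator_left:
  fixes H :: "'a::real_normed_vector \<Rightarrow> 'b::real_normed_vector"
    and G :: "'b \<Rightarrow> 'c::real_normed_vector"
  assumes G: "bounded_linear G" and H: "compact_operator H"
  shows "compact_operator (\<lambda>x. G (H x))"
  unfolding compact_operator_def
proof (intro conjI allI impI)
  show "bounded_linear (\<lambda>x. G (H x))"
    using assms by (auto simp: compact_operator_def intro: bounded_linear_compose)
  fix x :: "nat \<Rightarrow> 'a" assume "bounded (range x)"
  then obtain l r where "strict_mono r" "(\<lambda>n. H (x (r n))) \<longlonglongrightarrow> l"
    using H by (auto simp: compact_operator_def)
  then show "\<exists>l r. strict_mono r \<and> (\<lambda>n. G (H (x (r n)))) \<longlonglongrightarrow> l"
    using bounded_linear.tendsto[OF G] by blast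
qed

text \<open>Expanding (1 - H)(1 - G) = 1 - (H + (G - H G)) leaves a compact remainder. Whatever is
  shown for the identity minus a compact operator therefore also applies to its powers.\<close>

lemma compact_operator_power:
  assumes H: "compact_operator H"
  shows "\<exists>G. compact_operator G \<and> ((\<lambda>x. x - H x) ^^ n) = (\<lambda>x. x - G x)"
proof (induction n)
  case 0
  then show ?case
    by (intro exI[of _ "\<lambda>x. 0"]) (auto simp: compact_operator_zero)
next
  case (Suc n)
  then obtain G where G: "compact_operator G" "((\<lambda>x. x - H x) ^^ n) = (\<lambda>x. x - G x)" by blast
  have bl: "bounded_linear H" using H by (simp add: compact_operator_def)
  interpret H: bounded_linear H by fact
  have bl': "bounded_linear (\<lambda>x. x - H x)"
    by (intro bounded_linear_sub bounded_linear_ident bl)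
  have "compact_operator (\<lambda>x. H x + (G x - H (G x)))"
    using compact_operator_left[OF bl' G(1)] H by (intro compact_operator_add) auto
  then show ?case
    by (intro exI[of _ "\<lambda>x. H x + (G x - H (G x))"]) (auto simp: G(2) H.diff fun_eq_iff)
qed

text \<open>Riesz's lemma before normalization: dividing y - u by d gives a vector of norm at most 2
  at distance at least 1 from \<open>S\<close>. The distance is positive since \<open>S\<close> is
  closed but need not be attained, whence the factor 2.\<close>

lemma riesz_almost_nearest:
  fixes S :: "'a::real_normed_vector set"
  assumes S: "closed S" "subspace S" "y \<notin> S"
  obtains d u where "d > 0" "u \<in> S" "norm (y - u) \<le> 2 * d" "\<And>v. v \<in> S \<Longrightarrow> d \<le> norm (y - v)"
proof -
  have ne: "S \<noteq> {}" using S(2) subspace_0 by blast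
  have pos: "infdist y S > 0"
    using S ne infdist_pos_not_in_closed by blast
  have "\<exists>u\<in>S. dist y u < 2 * infdist y S"
  proof (rule ccontr)
    assume "\<not> ?thesis"
    then have "2 * infdist y S \<le> infdist y S"
      unfolding infdist_notempty[OF ne] by (intro cINF_greatest ne) (auto simp: not_less)
    then show False using pos by simp
  qed
  then obtain u where "u \<in> S" "norm (y - u) \<le> 2 * infdist y S"
    by (auto simp: dist_norm)
  moreover have "infdist y S \<le> norm (y - v)" if "v \<in> S" for v
    using infdist_le[OF that, of y] by (simp add: dist_norm)
  ultimately show ?thesis using that pos by blast
qed

locale compact_perturbation =
  fixes H :: "'a::real_normed_vector \<Rightarrow> 'a"
  assumes compact: "compact_operator H"
begin

definition L :: "'a \<Rightarrow> 'a" where "L x = x - H x"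

lemma bl_H: "bounded_linear H"
  using compact by (simp add: compact_operator_def)

sublocale H: bounded_linear H by (rule bl_H)

lemma bl_L: "bounded_linear L"
  unfolding L_def by (intro bounded_linear_sub bounded_linear_ident bl_H)

sublocale L: bounded_linear L by (rule bl_L)

text \<open>If no constant worked, Riesz's lemma would give bounded vectors y at distance at least 1
  from the kernel in \<open>R\<close> with L y \<rightarrow> 0. As y = L y + H y, compactness makes
  a subsequence converge, and its limit lies in the kernel. The lemma yields lower bounds when the
  kernel is trivial, closed ranges, and exact kernel vectors near approximate ones.\<close>

lemma near_kernel:
  assumes R: "closed R" "subspace R"
  shows "\<exists>C>0. \<forall>x\<in>R. \<exists>u\<in>R. L u = 0 \<and> norm (x - u) \<le> C * norm (L x)"
proof (rule ccontr)
  define N where "N = {u\<in>R. L u = 0}"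
  have "N = R \<inter> L -` {0}" by (auto simp: N_def)
  then have clN: "closed N"
    using R(1) by (auto intro!: closed_Int closed_vimage L.continuous_on)
  have subN: "subspace N"
    using R(2) unfolding N_def subspace_def by (auto simp: L.add L.scaleR)
  assume contra: "\<not> ?thesis"
  have "\<exists>y. y \<in> R \<and> norm y \<le> 2 \<and> norm (L y) \<le> 2 / real (Suc n) \<and> (\<forall>v\<in>N. 1 \<le> norm (y - v))" for n
  proof -
    obtain x where x: "x \<in> R" "\<And>u. u \<in> R \<Longrightarrow> L u = 0 \<Longrightarrow> norm (x - u) > real (Suc n) * norm (L x)"
      using contra by (metis of_nat_0_less_iff zero_less_Suc not_le)
    have "x \<notin> N"
      using x(2)[of x] unfolding N_def by auto
    then obtain d u where d: "d > 0" "u \<in> N" "norm (x - u) \<le> 2 * d" "\<And>v. v \<in> N \<Longrightarrow> d \<le> norm (x - v)"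
      using riesz_almost_nearest[OF clN subN] by blast
    define y where "y = (1/d) *\<^sub>R (x - u)"
    have uN: "u \<in> R" "L u = 0" using d(2) by (auto simp: N_def)
    have "y \<in> R" using R(2) x(1) uN by (auto simp: y_def intro: subspace_scale subspace_diff)
    moreover have "norm y \<le> 2" using d(1,3) by (simp add: y_def divide_simps)
    moreover have "norm (L y) \<le> 2 / real (Suc n)"
    proof -
      have "L y = (1/d) *\<^sub>R L x" by (simp add: y_def L.scaleR L.diff uN)
      then have "norm (L y) = norm (L x) / d" using d(1) by simp
      moreover have "real (Suc n) * norm (L x) \<le> 2 * d"
        using x(2)[OF uN] d by auto
      ultimately have "d * (real (Suc n) * norm (L y)) \<le> d * 2"
        by (simp only: mult.left_commute[of d] times_divide_eq_right) (use d(1) in \<open>simp add: mult.commute\<close>)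
      then have "real (Suc n) * norm (L y) \<le> 2"
        using d(1) by (simp only: mult_le_cancel_left_pos)
      then show ?thesis
        by (simp add: field_simps)
    qed
    moreover have "1 \<le> norm (y - v)" if "v \<in> N" for v
    proof -
      have "u + d *\<^sub>R v \<in> N"
        using subN d(2) that by (auto intro: subspace_add subspace_scale)
      then have "d \<le> norm (x - (u + d *\<^sub>R v))" using d(4) by blast
      also have "x - (u + d *\<^sub>R v) = d *\<^sub>R (y - v)"
        using d(1) by (simp add: y_def algebra_simps)
      finally show ?thesis using d(1) by simp
    qed
    ultimately show ?thesis by blast
  qed
  then obtain y where y: "\<And>n. y n \<in> R" "\<And>n. norm (y n) \<le> 2"
      "\<And>n. norm (L (y n)) \<le> 2 / real (Suc n)" "\<And>n v. v \<in> N \<Longrightarrow> 1 \<le> norm (y n - v)"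
    by metis
  obtain l r where r: "strict_mono r" "(\<lambda>n. H (y (r n))) \<longlonglongrightarrow> l"
    by (rule compact_operatorE[OF compact y(2)])
  have "(\<lambda>n. L (y n)) \<longlonglongrightarrow> 0"
    using y(3) by (intro Lim_null_comparison[OF _ LIMSEQ_Suc[OF lim_const_over_n[of 2]]]) auto
  then have L0: "(\<lambda>n. L (y (r n))) \<longlonglongrightarrow> 0"
    using LIMSEQ_subseq_LIMSEQ[OF _ r(1)] by (fastforce simp: o_def)
  have lim: "(\<lambda>n. y (r n)) \<longlonglongrightarrow> l"
    using tendsto_add[OF L0 r(2)] by (simp add: L_def)
  have "l \<in> R"
    by (rule closed_sequentially[OF R(1) y(1) lim])
  moreover have "L l = 0"
    using LIMSEQ_unique[OF L.tendsto[OF lim] L0] by simp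
  ultimately have "l \<in> N" by (simp add: N_def)
  then have "1 \<le> norm (y (r n) - l)" for n using y(4) by blast
  moreover have "(\<lambda>n. norm (y (r n) - l)) \<longlonglongrightarrow> 0"
    using lim by (simp add: LIM_zero tendsto_norm_zero)
  ultimately show False
    by (meson LIMSEQ_le_const not_one_le_zero)
qed

lemma bounded_below:
  assumes R: "closed R" "subspace R" and inj: "\<And>x. x \<in> R \<Longrightarrow> L x = 0 \<Longrightarrow> x = 0"
  shows "\<exists>c>0. \<forall>x\<in>R. c * norm x \<le> norm (L x)"
proof -
  obtain C where C: "C > 0" "\<forall>x\<in>R. \<exists>u\<in>R. L u = 0 \<and> norm (x - u) \<le> C * norm (L x)"
    using near_kernel[OF R] by blast
  have "norm x \<le> C * norm (L x)" if "x \<in> R" for x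
    using C(2) that inj by fastforce
  then show ?thesis
    using C(1) by (intro exI[of _ "1/C"]) (auto simp: field_simps)
qed

text \<open>Subtracting a nearby kernel element makes the norm of a preimage comparable to that of
  its image. The preimages of a convergent sequence are then bounded, and compactness of
  \<open>H\<close> extracts a convergent subsequence of them.\<close>

lemma closed_image:
  assumes R: "closed R" "subspace R"
  shows "closed (L ` R)"
  unfolding closed_sequential_limits
proof (intro allI impI, elim conjE)
  fix w y assume w: "\<forall>n. w n \<in> L ` R" and lim: "w \<longlonglongrightarrow> y"
  obtain C where C: "C > 0" "\<forall>x\<in>R. \<exists>u\<in>R. L u = 0 \<and> norm (x - u) \<le> C * norm (L x)"
    using near_kernel[OF R] by blast
  have "\<exists>x\<in>R. w n = L x \<and> norm x \<le> C * norm (w n)" for n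
  proof -
    obtain x where x: "x \<in> R" "w n = L x" using w by blast
    then obtain u where u: "u \<in> R" "L u = 0" "norm (x - u) \<le> C * norm (L x)" using C(2) by blast
    then show ?thesis
      using x R(2) by (intro bexI[of _ "x - u"]) (auto simp: L.diff subspace_diff)
  qed
  then obtain x where x: "\<And>n. x n \<in> R" "\<And>n. w n = L (x n)" "\<And>n. norm (x n) \<le> C * norm (w n)"
    by metis
  obtain B where B: "\<And>n. norm (w n) \<le> B"
    using lim convergent_imp_bounded by (metis bounded_iff rangeI)
  have "norm (x n) \<le> C * B" for n
    using x(3)[of n] B[of n] C(1) by (meson mult_left_mono less_imp_le order_trans)
  then obtain l r where r: "strict_mono r" "(\<lambda>n. H (x (r n))) \<longlonglongrightarrow> l"
    using compact_operatorE[OF compact] by blast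
  have w': "(\<lambda>n. L (x (r n))) \<longlonglongrightarrow> y"
    using LIMSEQ_subseq_LIMSEQ[OF lim r(1)] by (simp add: o_def x(2))
  have lim': "(\<lambda>n. x (r n)) \<longlonglongrightarrow> y + l"
    using tendsto_add[OF w' r(2)] by (simp add: L_def)
  have "y + l \<in> R"
    by (rule closed_sequentially[OF R(1) x(1) lim'])
  moreover have "L (y + l) = y"
    using LIMSEQ_unique[OF L.tendsto[OF lim'] w'] .
  ultimately show "y \<in> L ` R" by (metis imageI)
qed

lemma subspace_image_L: "subspace R \<Longrightarrow> subspace (L ` R)"
  by (rule linear_subspace_image[OF bounded_linear.linear[OF bl_L]])

text \<open>Riesz: otherwise the powers of \<open>L\<close> would give a strictly decreasing sequence of closed
  subspaces, and almost orthogonal unit vectors in them contradict compactness.\<close>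

lemma injective_imp_surjective:
  assumes R: "closed R" "subspace R" and inv: "L ` R \<subseteq> R"
    and inj: "\<And>x. x \<in> R \<Longrightarrow> L x = 0 \<Longrightarrow> x = 0"
  shows "L ` R = R"
proof (rule ccontr)
  assume "L ` R \<noteq> R"
  then obtain y where y: "y \<in> R" "y \<notin> L ` R" using inv by blast
  define S where "S n = (L ^^ n) ` R" for n
  have SSuc: "S (Suc n) = L ` S n" for n by (auto simp: S_def)
  have S: "closed (S n) \<and> subspace (S n) \<and> S n \<subseteq> R" for n
  proof (induction n)
    case 0 then show ?case using R by (simp add: S_def)
  next
    case (Suc n) then show ?case
      using inv closed_image[of "S n"] subspace_image_L[of "S n"] by (auto simp: SSuc)
  qed
  have dec: "S (Suc n) \<subseteq> S n" for n
  proof (induction n)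
    case 0 then show ?case using inv by (simp add: S_def)
  next
    case (Suc n) then show ?case by (auto simp: SSuc)
  qed
  have anti: "S m \<subseteq> S n" if "n \<le> m" for m n
    using lift_Suc_antimono_le[of S, OF dec that] .
  have strict: "(L ^^ n) y \<in> S n \<and> (L ^^ n) y \<notin> S (Suc n)" for n
  proof (induction n)
    case 0 then show ?case using y by (simp add: S_def)
  next
    case (Suc n)
    \<comment> \<open>Injectivity on \<open>R\<close> cancels one factor \<open>L\<close> and
      reduces the claim to the previous index.\<close>
    have "(L ^^ Suc n) y \<notin> S (Suc (Suc n))"
    proof
      assume "(L ^^ Suc n) y \<in> S (Suc (Suc n))"
      then obtain x where x: "x \<in> S (Suc n)" "L ((L ^^ n) y) = L x" by (auto simp: SSuc[of "Suc n"])
      have "(L ^^ n) y - x \<in> R"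
        using x(1) Suc S R(2) by (meson subsetD subspace_diff)
      moreover have "L ((L ^^ n) y - x) = 0" using x(2) by (simp add: L.diff)
      ultimately have "(L ^^ n) y - x = 0" by (rule inj)
      with x Suc show False by simp
    qed
    with Suc show ?case by (simp add: SSuc)
  qed
  have "\<exists>x. x \<in> S n \<and> norm x \<le> 2 \<and> (\<forall>v\<in>S (Suc n). 1 \<le> norm (x - v))" for n
  proof -
    obtain d u where d: "d > 0" "u \<in> S (Suc n)" "norm ((L ^^ n) y - u) \<le> 2 * d"
        "\<And>v. v \<in> S (Suc n) \<Longrightarrow> d \<le> norm ((L ^^ n) y - v)"
      using riesz_almost_nearest[of "S (Suc n)" "(L ^^ n) y"] S strict by blast
    define x where "x = (1/d) *\<^sub>R ((L ^^ n) y - u)"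
    have "x \<in> S n"
      using strict[of n] d(2) dec[of n] S[of n] by (auto simp: x_def intro!: subspace_scale subspace_diff)
    moreover have "norm x \<le> 2" using d(1,3) by (simp add: x_def divide_simps)
    moreover have "1 \<le> norm (x - v)" if "v \<in> S (Suc n)" for v
    proof -
      have "u + d *\<^sub>R v \<in> S (Suc n)"
        using S d(2) that by (auto intro: subspace_add subspace_scale)
      then have "d \<le> norm ((L ^^ n) y - (u + d *\<^sub>R v))" using d(4) by blast
      also have "(L ^^ n) y - (u + d *\<^sub>R v) = d *\<^sub>R (x - v)"
        using d(1) by (simp add: x_def algebra_simps)
      finally show ?thesis using d(1) by simp
    qed
    ultimately show ?thesis by blast
  qed
  then obtain x where x: "\<And>n. x n \<in> S n" "\<And>n. norm (x n) \<le> 2"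
      "\<And>n v. v \<in> S (Suc n) \<Longrightarrow> 1 \<le> norm (x n - v)" by metis
  \<comment> \<open>Up to an element of \<open>S (Suc n)\<close>, the difference of the two images
    is \<open>x n\<close> itself, which stays at distance 1 from that subspace. Hence no subsequence
    of the images is Cauchy.\<close>
  have sep: "1 \<le> norm (H (x n) - H (x m))" if "n < m" for n m
  proof -
    have "L (x n) \<in> S (Suc n)" using x(1)[of n] by (simp add: SSuc)
    moreover have "x m \<in> S (Suc n)"
      using x(1)[of m] anti[of "Suc n" m] that by auto
    moreover have "L (x m) \<in> S (Suc n)"
      using x(1)[of m] anti[of "Suc n" "Suc m"] that by (auto simp: SSuc[of m])
    ultimately have "L (x n) + x m - L (x m) \<in> S (Suc n)"
      using S[of "Suc n"] by (intro subspace_diff subspace_add) auto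
    then have "1 \<le> norm (x n - (L (x n) + x m - L (x m)))" by (rule x(3))
    also have "x n - (L (x n) + x m - L (x m)) = H (x n) - H (x m)"
      by (simp add: L_def)
    finally show ?thesis .
  qed
  obtain l r where r: "strict_mono r" "(\<lambda>n. H (x (r n))) \<longlonglongrightarrow> l"
    by (rule compact_operatorE[OF compact x(2)])
  from r(2) have "Cauchy (\<lambda>n. H (x (r n)))" by (rule LIMSEQ_imp_Cauchy)
  from CauchyD[OF this zero_less_one]
  obtain M where M: "\<forall>m\<ge>M. \<forall>n\<ge>M. norm (H (x (r m)) - H (x (r n))) < 1" by blast
  from M[rule_format, of M "Suc M"] have "norm (H (x (r M)) - H (x (r (Suc M)))) < 1" by simp
  then show False
    using sep[of "r M" "r (Suc M)"] strict_monoD[OF r(1), of M "Suc M"] by simp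
qed

end

subsection \<open>Riesz decomposition and perturbation of a generalized eigenspace\<close>

context compact_perturbation
begin

lemma power_eq: "\<exists>G. compact_operator G \<and> (L ^^ n) = (\<lambda>x. x - G x)"
proof -
  have "L = (\<lambda>x. x - H x)" by (auto simp: L_def)
  then show ?thesis using compact_operator_power[OF compact, of n] by simp
qed

lemma bl_power: "bounded_linear (L ^^ n)"
proof -
  obtain G where G: "compact_operator G" "(L ^^ n) = (\<lambda>x. x - G x)" using power_eq by blast
  then show ?thesis
    by (auto simp: compact_operator_def intro!: bounded_linear_sub bounded_linear_ident)
qed

lemma power_near_kernel:
  "\<exists>C>0. \<forall>x. \<exists>u. (L ^^ n) u = 0 \<and> norm (x - u) \<le> C * norm ((L ^^ n) x)"
proof -
  obtain G where G: "compact_operator G" "(L ^^ n) = (\<lambda>x. x - G x)" using power_eq by blast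
  interpret G: compact_perturbation G by unfold_locales fact
  have "L ^^ n = G.L" by (auto simp: G G.L_def)
  then show ?thesis using G.near_kernel[of UNIV] by simp
qed

end

text \<open>The assumption says that the ascent of \<open>L\<close> is at most \<delta>.
  Stabilization of the ranges follows from it through the Riesz theorem, in
  \<open>decomposition\<close>.\<close>

locale compact_ascent = compact_perturbation H for H :: "'a::real_normed_vector \<Rightarrow> 'a" +
  fixes \<delta> :: nat
  assumes ascent: "\<And>x. (L ^^ Suc \<delta>) x = 0 \<Longrightarrow> (L ^^ \<delta>) x = 0"
begin

definition E :: "'a set" where "E = {x. (L ^^ \<delta>) x = 0}"
definition R :: "'a set" where "R = range (L ^^ \<delta>)"

lemma L_power_commute: "(L ^^ n) (L x) = L ((L ^^ n) x)"
  by (simp add: funpow_swap1)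

lemma kernel_stable: "(L ^^ (\<delta> + n)) x = 0 \<Longrightarrow> x \<in> E"
proof (induction n)
  case 0 then show ?case by (simp add: E_def)
next
  case (Suc n)
  have "(L ^^ Suc \<delta>) ((L ^^ n) x) = (L ^^ (Suc \<delta> + n)) x"
    by (simp only: funpow_add o_apply)
  also have "\<dots> = 0" using Suc.prems by simp
  finally have "(L ^^ Suc \<delta>) ((L ^^ n) x) = 0" .
  then have "(L ^^ \<delta>) ((L ^^ n) x) = 0" by (rule ascent)
  then have "(L ^^ (\<delta> + n)) x = 0" by (simp only: funpow_add o_apply)
  then show ?case by (rule Suc.IH)
qed

lemma R_closed: "closed R" and R_subspace: "subspace R" and E_subspace: "subspace E"
proof -
  obtain G where G: "compact_operator G" "(L ^^ \<delta>) = (\<lambda>x. x - G x)" using power_eq by blast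
  interpret G: compact_perturbation G by unfold_locales fact
  have eq: "L ^^ \<delta> = G.L" by (auto simp: G G.L_def)
  show "closed R" unfolding R_def eq by (rule G.closed_image) auto
  show "subspace R" unfolding R_def eq by (rule G.subspace_image_L) auto
  show "subspace E" unfolding E_def eq subspace_def by (auto simp: G.L.add G.L.scaleR)
qed

text \<open>If \<open>(L ^^ \<delta>) y\<close> is killed by \<open>L ^^ \<delta>\<close>, then y
  lies in the kernel of the power 2 \<delta>, which is already that of the power \<delta>.\<close>

lemma E_inter_R: "x \<in> E \<Longrightarrow> x \<in> R \<Longrightarrow> x = 0"
proof -
  assume x: "x \<in> E" "x \<in> R"
  then obtain y where y: "x = (L ^^ \<delta>) y" by (auto simp: R_def)
  have "(L ^^ (\<delta> + \<delta>)) y = 0" using x(1) by (simp add: E_def y funpow_add)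
  then have "y \<in> E" by (rule kernel_stable)
  then show ?thesis by (simp add: E_def y)
qed

lemma L_E: "x \<in> E \<Longrightarrow> L x \<in> E"
  by (simp add: E_def L_power_commute)

lemma L_R: "x \<in> R \<Longrightarrow> L x \<in> R"
  by (auto simp: R_def L_power_commute[symmetric])

lemma L_inj_R: "x \<in> R \<Longrightarrow> L x = 0 \<Longrightarrow> x = 0"
proof -
  assume x: "x \<in> R" "L x = 0"
  have "(L ^^ (\<delta> + 1)) x = 0"
    using x(2) by (simp add: L_power_commute[symmetric]) (simp add: bl_power linear_simps)
  then have "x \<in> E" by (rule kernel_stable)
  with x(1) E_inter_R show ?thesis by blast
qed

text \<open>\<open>L ^^ \<delta>\<close> maps \<open>R\<close> injectively into itself, hence onto
  itself. So \<open>L ^^ \<delta>\<close> takes the same value at x and at some r in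
  \<open>R\<close>, and x - r lies in \<open>E\<close>. Being bounded below on \<open>R\<close>, the
  power also controls r by x, which bounds both projections directly.\<close>

lemma decomposition:
  "\<exists>C\<ge>1. \<forall>x. \<exists>e r. x = e + r \<and> e \<in> E \<and> r \<in> R \<and> norm e \<le> C * norm x \<and> norm r \<le> C * norm x"
proof -
  obtain G where G: "compact_operator G" "(L ^^ \<delta>) = (\<lambda>x. x - G x)" using power_eq by blast
  interpret G: compact_perturbation G by unfold_locales fact
  have eq: "L ^^ \<delta> = G.L" by (auto simp: G G.L_def)
  have inv: "G.L ` R \<subseteq> R" by (auto simp: R_def eq[symmetric])
  have inj: "x = 0" if "x \<in> R" "G.L x = 0" for x
    using that E_inter_R[of x] by (simp add: E_def eq)
  have surj: "G.L ` R = R"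
    by (rule G.injective_imp_surjective[OF R_closed R_subspace inv inj])
  obtain c where c: "c > 0" "\<forall>x\<in>R. c * norm x \<le> norm (G.L x)"
    using G.bounded_below[OF R_closed R_subspace inj] by blast
  obtain B where B: "B > 0" "\<And>x. norm (G.L x) \<le> norm x * B"
    using G.L.pos_bounded by blast
  have "\<exists>e r. x = e + r \<and> e \<in> E \<and> r \<in> R \<and> norm e \<le> (1 + B / c) * norm x \<and> norm r \<le> (1 + B / c) * norm x" for x
  proof -
    have "G.L x \<in> R" by (auto simp: R_def eq)
    then obtain r where r: "r \<in> R" "G.L x = G.L r" using surj by (metis imageE)
    have "c * norm r \<le> norm x * B" using c r B(2)[of x] by fastforce
    then have nr: "norm r \<le> B / c * norm x" using c(1) by (simp add: field_simps)
    have "x - r \<in> E" using r(2) by (simp add: E_def eq G.L.diff)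
    moreover have "norm (x - r) \<le> (1 + B / c) * norm x"
      using nr norm_triangle_ineq4[of x r] by (simp add: algebra_simps)
    moreover have "norm r \<le> (1 + B / c) * norm x" using nr by (simp add: algebra_simps add_increasing)
    ultimately show ?thesis using r(1) by (intro exI[of _ "x - r"] exI[of _ r]) auto
  qed
  moreover have "1 + B / c \<ge> 1" using B(1) c(1) by simp
  ultimately show ?thesis by blast
qed

lemma decomposition_unique:
  assumes "e + r = e' + r'" "e \<in> E" "e' \<in> E" "r \<in> R" "r' \<in> R"
  shows "e = e'" "r = r'"
proof -
  have eq: "e - e' = r' - r" using assms(1) by (simp add: algebra_simps)
  have "e - e' \<in> E" "r' - r \<in> R"
    using assms E_subspace R_subspace by (auto intro: subspace_diff)
  then have "r' - r = 0" using E_inter_R[of "r' - r"] unfolding eq by blast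
  then have "e - e' = 0" "r' - r = 0" using eq by auto
  then show "e = e'" "r = r'" by auto
qed

end

text \<open>\<open>cs\<close> is multiplication by complex scalars on a space whose type only knows real ones.\<close>

locale complex_scaling =
  fixes cs :: "complex \<Rightarrow> 'a::real_normed_vector \<Rightarrow> 'a"
  assumes cs_add: "cs z (x + y) = cs z x + cs z y"
    and cs_add_left: "cs (z + w) x = cs z x + cs w x"
    and cs_mult: "cs z (cs w x) = cs (z * w) x"
    and cs_of_real: "cs (of_real t) x = t *\<^sub>R x"
    and norm_cs: "norm (cs z x) = cmod z * norm x"
begin

lemma cs_one: "cs 1 x = x"
  using cs_of_real[of 1] by simp

lemma cs_zero_left: "cs 0 x = 0"
  using cs_of_real[of 0] by simp

lemma bl_cs: "bounded_linear (cs z)"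
proof (rule bounded_linear_intro)
  show "cs z (t *\<^sub>R x) = t *\<^sub>R cs z x" for t x
    by (simp add: cs_of_real[symmetric] cs_mult mult.commute)
  show "norm (cs z x) \<le> norm x * cmod z" for x by (simp add: norm_cs mult.commute)
qed (rule cs_add)

end

locale perturbed_eigenvalue = compact_ascent H \<delta> + complex_scaling cs
  for H :: "'a::real_normed_vector \<Rightarrow> 'a" and \<delta> cs +
  assumes H_cs: "H (cs z x) = cs z (H x)"
begin

lemma L_cs: "L (cs z x) = cs z (L x)"
  by (simp add: L_def H_cs linear_simps(2)[OF bl_cs])

lemma Lpow_cs: "(L ^^ n) (cs z x) = cs z ((L ^^ n) x)"
  by (induction n) (simp_all add: L_cs)

lemma cs_E: "x \<in> E \<Longrightarrow> cs z x \<in> E"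
  by (simp add: E_def Lpow_cs linear_simps(3)[OF bl_cs])

lemma cs_R: "x \<in> R \<Longrightarrow> cs z x \<in> R"
  by (auto simp: R_def Lpow_cs[symmetric])

text \<open>Two scales: \<epsilon> only has to be small and keeps the block on \<open>R\<close>
  invertible, while \<eta> is the size on \<open>E\<close> that carries the convergence rate. In the
  application \<sigma> is the relative deviation z / \<zeta> - 1 of a discrete eigenvalue.\<close>

definition admissible :: "real \<Rightarrow> real \<Rightarrow> complex \<Rightarrow> ('a \<Rightarrow> 'a) \<Rightarrow> bool" where
  "admissible \<epsilon> \<eta> \<sigma> H' \<longleftrightarrow> linear H' \<and> (\<forall>x. norm (H' x - H x) \<le> \<epsilon> * norm x) \<and>
     (\<forall>x\<in>E. norm (H' x - H x) \<le> \<eta> * norm x) \<and> 0 \<le> \<eta> \<and> \<eta> \<le> 1 \<and> cmod \<sigma> \<le> \<epsilon>"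

text \<open>The eigenvalue is normalized to 1: with \<sigma> = z / \<zeta> - 1 this is the perturbed
  z - K' divided by \<zeta>.\<close>

definition L' :: "complex \<Rightarrow> ('a \<Rightarrow> 'a) \<Rightarrow> 'a \<Rightarrow> 'a" where
  "L' \<sigma> H' u = cs (1 + \<sigma>) u - H' u"

text \<open>The \<open>2 \<times> 2\<close> block form of the perturbed operator relative to \<open>E \<oplus> R\<close>: on \<open>R\<close> it stays
  bounded below, and the entries coming from \<open>E\<close> are of the size \<open>\<eta>\<close> of the perturbation on \<open>E\<close>.\<close>

lemma block_estimate:
  "\<exists>C>0. \<exists>\<epsilon>>0. \<epsilon> \<le> 1 \<and> (\<forall>H' \<eta> \<sigma> e r e' r'. admissible \<epsilon> \<eta> \<sigma> H' \<longrightarrow>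
      e \<in> E \<longrightarrow> r \<in> R \<longrightarrow> e' \<in> E \<longrightarrow> r' \<in> R \<longrightarrow> L' \<sigma> H' (e + r) = e' + r' \<longrightarrow>
      norm r \<le> C * (\<eta> * norm e + norm r') \<and>
      norm (L e + cs \<sigma> e - e') \<le> C * (\<eta> * norm e + norm r))"
proof -
  obtain C where C: "C \<ge> 1" "\<And>x. \<exists>e r. x = e + r \<and> e \<in> E \<and> r \<in> R \<and>
      norm e \<le> C * norm x \<and> norm r \<le> C * norm x"
    using decomposition by blast
  obtain c where c: "c > 0" "\<And>x. x \<in> R \<Longrightarrow> c * norm x \<le> norm (L x)"
    using bounded_below[OF R_closed R_subspace L_inj_R] by blast
  \<comment> \<open>On \<open>R\<close> the shift contributes at most \<epsilon> times the norm of r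
    and the perturbation at most C \<epsilon> times it. Together they use up at most half of the
    lower bound c.\<close>
  define \<epsilon> where "\<epsilon> = min 1 (c / 2 / (1 + C))"
  have "\<epsilon> \<le> c / 2 / (1 + C)" by (simp add: \<epsilon>_def)
  then have "\<epsilon> * (1 + C) \<le> c / 2"
    using C(1) by (subst (asm) pos_le_divide_eq) auto
  then have \<epsilon>: "\<epsilon> > 0" "\<epsilon> \<le> 1" "\<epsilon> * (1 + C) \<le> c / 2"
    using c(1) C(1) by (auto simp: \<epsilon>_def)
  define B where "B = C + 2 * C / c + 2 / c"
  have B: "B \<ge> C" "B \<ge> 2 * C / c" "B \<ge> 2 / c" "B > 0"
    using C(1) c(1) by (auto simp: B_def add_pos_nonneg)
  have "norm r \<le> B * (\<eta> * norm e + norm r') \<and> norm (L e + cs \<sigma> e - e') \<le> B * (\<eta> * norm e + norm r)"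
    if adm: "admissible \<epsilon> \<eta> \<sigma> H'" and mem: "e \<in> E" "r \<in> R" "e' \<in> E" "r' \<in> R"
      and eq: "L' \<sigma> H' (e + r) = e' + r'" for H' \<eta> \<sigma> e r e' r'
  proof -
    from adm have lin: "linear H'" and eps: "\<And>x. norm (H' x - H x) \<le> \<epsilon> * norm x"
      and eta: "norm (H' e - H e) \<le> \<eta> * norm e" "0 \<le> \<eta>" and sig: "cmod \<sigma> \<le> \<epsilon>"
      using mem by (auto simp: admissible_def)
    \<comment> \<open>Both columns of the perturbation are split along \<open>E\<close> and
      \<open>R\<close>; uniqueness of the decomposition then allows a comparison of
      components.\<close>
    obtain e1 r1 where 1: "H' e - H e = e1 + r1" "e1 \<in> E" "r1 \<in> R"
        "norm e1 \<le> C * norm (H' e - H e)" "norm r1 \<le> C * norm (H' e - H e)"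
      using C(2) by blast
    obtain e2 r2 where 2: "H' r - H r = e2 + r2" "e2 \<in> E" "r2 \<in> R"
        "norm e2 \<le> C * norm (H' r - H r)" "norm r2 \<le> C * norm (H' r - H r)"
      using C(2) by blast
    have "norm e1 \<le> C * (\<eta> * norm e)" "norm r1 \<le> C * (\<eta> * norm e)"
      using 1 eta(1) C(1) by (meson order_trans mult_left_mono zero_le_one)+
    moreover have "norm e2 \<le> C * (\<epsilon> * norm r)" "norm r2 \<le> C * (\<epsilon> * norm r)"
      using 2 eps C(1) by (meson order_trans mult_left_mono zero_le_one)+
    ultimately have n: "norm e1 \<le> C * (\<eta> * norm e)" "norm r1 \<le> C * (\<eta> * norm e)"
      "norm e2 \<le> C * (\<epsilon> * norm r)" "norm r2 \<le> C * (\<epsilon> * norm r)" by auto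
    have "L' \<sigma> H' (e + r) = (L e + cs \<sigma> e - e1 - e2) + (L r + cs \<sigma> r - r1 - r2)"
      using 1(1) 2(1) by (simp add: L'_def L_def linear_add[OF lin] H.add cs_add cs_add_left cs_one algebra_simps)
    then have eq': "(L e + cs \<sigma> e - e1 - e2) + (L r + cs \<sigma> r - r1 - r2) = e' + r'"
      using eq by simp
    have "L e + cs \<sigma> e - e1 - e2 \<in> E" "L r + cs \<sigma> r - r1 - r2 \<in> R"
      using mem 1 2 by (auto intro!: subspace_diff subspace_add E_subspace R_subspace L_E L_R cs_E cs_R)
    then have e': "L e + cs \<sigma> e - e1 - e2 = e'" and r': "L r + cs \<sigma> r - r1 - r2 = r'"
      using decomposition_unique[OF eq'] mem by auto
    have "c * norm r \<le> norm (L r)" using c(2) mem by blast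
    also have "L r = r' - cs \<sigma> r + r1 + r2" using r' by (simp add: algebra_simps)
    also have "norm \<dots> \<le> norm r' + norm (cs \<sigma> r) + norm r1 + norm r2"
      by norm
    also have "\<dots> \<le> norm r' + \<epsilon> * norm r + C * (\<eta> * norm e) + C * (\<epsilon> * norm r)"
      using n sig by (intro add_mono) (auto simp: norm_cs mult_right_mono)
    also have "\<dots> = norm r' + C * (\<eta> * norm e) + \<epsilon> * (1 + C) * norm r" by (simp add: algebra_simps)
    also have "\<dots> \<le> norm r' + C * (\<eta> * norm e) + c / 2 * norm r"
      using \<epsilon>(3) by (intro add_left_mono mult_right_mono) auto
    finally have "norm r \<le> 2 / c * norm r' + 2 * C / c * (\<eta> * norm e)"
      using c(1) by (simp add: field_simps)
    also have "\<dots> \<le> B * norm r' + B * (\<eta> * norm e)"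
      using B eta(2) by (intro add_mono mult_right_mono) auto
    finally have A: "norm r \<le> B * (\<eta> * norm e + norm r')" by (simp add: algebra_simps)
    have "L e + cs \<sigma> e - e' = e1 + e2" using e' by (simp add: algebra_simps)
    then have "norm (L e + cs \<sigma> e - e') \<le> C * (\<eta> * norm e) + C * (\<epsilon> * norm r)"
      using n norm_triangle_ineq[of e1 e2] by simp
    also have "\<dots> \<le> B * (\<eta> * norm e) + B * (1 * norm r)"
      using B eta(2) \<epsilon> C(1) by (intro add_mono mult_mono) auto
    finally show ?thesis using A by (simp add: algebra_simps)
  qed
  then show ?thesis using B(4) \<epsilon> by blast
qed

lemma eigenvalue_perturbation:
  "\<exists>C>0. \<exists>\<epsilon>>0. \<forall>H' \<eta> \<sigma> u. admissible \<epsilon> \<eta> \<sigma> H' \<longrightarrow> u \<noteq> 0 \<longrightarrow> L' \<sigma> H' u = 0 \<longrightarrow>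
      cmod \<sigma> ^ \<delta> \<le> C * \<eta>"
proof -
  obtain C \<epsilon> where C: "C > 0" "\<epsilon> > 0" "\<epsilon> \<le> 1" and blk: "\<And>H' \<eta> \<sigma> e r e' r'. admissible \<epsilon> \<eta> \<sigma> H' \<Longrightarrow>
      e \<in> E \<Longrightarrow> r \<in> R \<Longrightarrow> e' \<in> E \<Longrightarrow> r' \<in> R \<Longrightarrow> L' \<sigma> H' (e + r) = e' + r' \<Longrightarrow>
      norm r \<le> C * (\<eta> * norm e + norm r') \<and>
      norm (L e + cs \<sigma> e - e') \<le> C * (\<eta> * norm e + norm r)"
    using block_estimate by blast
  obtain B where B: "B > 0" "\<And>x. norm (L x) \<le> norm x * B"
    using L.pos_bounded by blast
  define M where "M = 1 + B"
  have M: "M \<ge> 1" "\<And>x. norm (L x) \<le> M * norm x"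
    using B by (auto simp: M_def algebra_simps add_increasing)
  have LM: "norm ((L ^^ j) x) \<le> M ^ j * norm x" for j x
  proof (induction j)
    case (Suc j)
    have "norm ((L ^^ Suc j) x) \<le> M * norm ((L ^^ j) x)" using M(2) by simp
    also have "\<dots> \<le> M * (M ^ j * norm x)" using Suc M(1) by (intro mult_left_mono) auto
    finally show ?case by (simp add: mult.assoc)
  qed simp
  have main: "cmod \<sigma> ^ \<delta> \<le> (real \<delta> * M ^ \<delta> * (C * (1 + C))) * \<eta>"
    if adm: "admissible \<epsilon> \<eta> \<sigma> H'" and u: "u \<noteq> 0" "L' \<sigma> H' u = 0" for H' \<eta> \<sigma> u
  proof -
    obtain e r where er: "u = e + r" "e \<in> E" "r \<in> R" using decomposition by blast
    have eta: "0 \<le> \<eta>" "\<eta> \<le> 1" and sig: "cmod \<sigma> \<le> 1" using adm C by (auto simp: admissible_def)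
    have z: "0 \<in> E" "0 \<in> R" using E_subspace R_subspace subspace_0 by auto
    have b: "norm r \<le> C * (\<eta> * norm e)" "norm (L e + cs \<sigma> e) \<le> C * (\<eta> * norm e + norm r)"
      using blk[OF adm er(2,3) z] u(2) er(1) by auto
    \<comment> \<open>The bound on r by e would otherwise force u = 0; this permits the division by
      the norm of e at the end.\<close>
    have "e \<noteq> 0" using b(1) u(1) er(1) by auto
    define \<rho> where "\<rho> = C * (1 + C) * (\<eta> * norm e)"
    have rho0: "\<rho> \<ge> 0" using C eta by (simp add: \<rho>_def)
    have "C * (\<eta> * norm e + norm r) \<le> C * (\<eta> * norm e + C * (\<eta> * norm e))"
      using b(1) C(1) by (intro mult_left_mono add_left_mono) auto
    then have rho: "norm (L e + cs \<sigma> e) \<le> \<rho>" using b(2) by (simp add: \<rho>_def algebra_simps)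
    \<comment> \<open>Telescoping: the factors L are replaced by -\<sigma> one at a time, each
      replacement costing at most M ^ j \<rho>. At j = \<delta> the power of L vanishes on
      e.\<close>
    have pow: "norm (cs ((- \<sigma>) ^ j) e - (L ^^ j) e) \<le> real j * M ^ j * \<rho>" for j
    proof (induction j)
      case 0 then show ?case by (simp add: cs_one)
    next
      case (Suc j)
      have "cs ((- \<sigma>) ^ Suc j) e - (L ^^ Suc j) e
          = cs (- \<sigma>) (cs ((- \<sigma>) ^ j) e - (L ^^ j) e) - (L ^^ j) (L e + cs \<sigma> e)"
      proof -
        have "cs (- \<sigma>) x = - cs \<sigma> x" for x
          using cs_add_left[of \<sigma> "- \<sigma>" x] by (simp add: cs_zero_left eq_neg_iff_add_eq_0 add.commute)
        moreover have "cs ((- \<sigma>) ^ Suc j) e = cs (- \<sigma>) (cs ((- \<sigma>) ^ j) e)"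
          by (simp add: cs_mult)
        ultimately show ?thesis
          by (simp del: power_Suc add: linear_simps(2)[OF bl_cs] linear_simps(1)[OF bl_power]
              L_power_commute Lpow_cs)
      qed
      also have "norm \<dots> \<le> cmod \<sigma> * norm (cs ((- \<sigma>) ^ j) e - (L ^^ j) e) + M ^ j * norm (L e + cs \<sigma> e)"
        using LM[of j "L e + cs \<sigma> e"] by (intro order_trans[OF norm_triangle_ineq4] add_mono) (auto simp: norm_cs)
      also have "\<dots> \<le> 1 * (real j * M ^ j * \<rho>) + M ^ j * \<rho>"
        using Suc sig rho M(1) by (intro add_mono mult_mono mult_left_mono) auto
      also have "\<dots> = real (Suc j) * M ^ j * \<rho>" by (simp add: algebra_simps)
      also have "\<dots> \<le> real (Suc j) * M ^ Suc j * \<rho>"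
        using M(1) rho0 by (intro mult_right_mono mult_left_mono power_increasing) auto
      finally show ?case .
    qed
    have "cmod \<sigma> ^ \<delta> * norm e \<le> real \<delta> * M ^ \<delta> * \<rho>"
      using pow[of \<delta>] er(2) by (simp add: E_def norm_cs norm_power)
    also have "\<dots> = (real \<delta> * M ^ \<delta> * (C * (1 + C)) * \<eta>) * norm e" by (simp add: \<rho>_def)
    finally show ?thesis using \<open>e \<noteq> 0\<close> by simp
  qed
  have "(real \<delta> * M ^ \<delta> * (C * (1 + C))) * \<eta> \<le> (1 + real \<delta> * M ^ \<delta> * (C * (1 + C))) * \<eta>"
    if "\<eta> \<ge> 0" for \<eta> using that by (simp add: algebra_simps)
  then have "cmod \<sigma> ^ \<delta> \<le> (1 + real \<delta> * M ^ \<delta> * (C * (1 + C))) * \<eta>"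
    if "admissible \<epsilon> \<eta> \<sigma> H'" "u \<noteq> 0" "L' \<sigma> H' u = 0" for H' \<eta> \<sigma> u
    using main[OF that] that(1) unfolding admissible_def by (meson order_trans)
  moreover have "1 + real \<delta> * M ^ \<delta> * (C * (1 + C)) > 0"
    using C M by (intro add_pos_nonneg) auto
  ultimately show ?thesis using C(2) by blast
qed

text \<open>By induction on n, the \<open>R\<close> part of u is of order \<eta> and L ^ n of its
  \<open>E\<close> part is of order \<eta> + |\<sigma>|: pass from u to its image, which is killed
  by one power less, and compare L e with the \<open>E\<close> part of that image. Finally
  \<open>power_near_kernel\<close> replaces the \<open>E\<close> part by an exact kernel
  vector.\<close>

lemma eigenvector_perturbation:
  "\<exists>C>0. \<exists>\<epsilon>>0. \<forall>H' \<eta> \<sigma> u. admissible \<epsilon> \<eta> \<sigma> H' \<longrightarrow> (L' \<sigma> H' ^^ n) u = 0 \<longrightarrow>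
      (\<exists>v. (L ^^ n) v = 0 \<and> norm (u - v) \<le> C * (\<eta> + cmod \<sigma>) * norm u)"
proof -
  obtain C \<epsilon> where C: "C > 0" "\<epsilon> > 0" "\<epsilon> \<le> 1" and blk: "\<And>H' \<eta> \<sigma> e r e' r'. admissible \<epsilon> \<eta> \<sigma> H' \<Longrightarrow>
      e \<in> E \<Longrightarrow> r \<in> R \<Longrightarrow> e' \<in> E \<Longrightarrow> r' \<in> R \<Longrightarrow> L' \<sigma> H' (e + r) = e' + r' \<Longrightarrow>
      norm r \<le> C * (\<eta> * norm e + norm r') \<and>
      norm (L e + cs \<sigma> e - e') \<le> C * (\<eta> * norm e + norm r)"
    using block_estimate by blast
  obtain D where D: "D \<ge> 1" "\<And>x. \<exists>e r. x = e + r \<and> e \<in> E \<and> r \<in> R \<and>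
      norm e \<le> D * norm x \<and> norm r \<le> D * norm x"
    using decomposition by blast
  obtain B0 where B0: "B0 > 0" "\<And>x. norm (H x) \<le> norm x * B0"
    using H.pos_bounded by blast
  define B where "B = 3 + B0"
  have LB: "norm (L' \<sigma> H' x) \<le> B * norm x" if "admissible \<epsilon> \<eta> \<sigma> H'" for H' \<eta> \<sigma> x
  proof -
    have "norm (H' x - H x) \<le> 1 * norm x" "cmod \<sigma> \<le> 1"
      using that C(3) unfolding admissible_def by (meson mult_right_mono norm_ge_zero order_trans)+
    moreover have "norm (cs (1 + \<sigma>) x) \<le> 2 * norm x"
      unfolding norm_cs using norm_triangle_ineq[of 1 \<sigma>] \<open>cmod \<sigma> \<le> 1\<close> by (intro mult_right_mono) auto
    moreover have "norm (L' \<sigma> H' x) \<le> norm (cs (1 + \<sigma>) x) + norm (H' x - H x) + norm (H x)"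
      unfolding L'_def by norm
    ultimately show ?thesis using B0(2)[of x] by (simp add: B_def algebra_simps)
  qed
  have B1: "B \<ge> 1" using B0 by (simp add: B_def)
  have "\<exists>K>0. \<forall>H' \<eta> \<sigma> e r. admissible \<epsilon> \<eta> \<sigma> H' \<longrightarrow> e \<in> E \<longrightarrow> r \<in> R \<longrightarrow> (L' \<sigma> H' ^^ n) (e + r) = 0 \<longrightarrow>
      norm r \<le> K * \<eta> * norm (e + r) \<and> norm ((L ^^ n) e) \<le> K * (\<eta> + cmod \<sigma>) * norm (e + r)"
  proof (induction n)
    case 0
    have "r = 0" "e = 0" if "e \<in> E" "r \<in> R" "e + r = 0" for e r
      using decomposition_unique[of e r 0 0] that subspace_0[OF E_subspace] subspace_0[OF R_subspace] by auto
    then show ?case by (intro exI[of _ 1]) auto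
  next
    case (Suc n)
    then obtain K where K: "K > 0" "\<And>H' \<eta> \<sigma> e r. admissible \<epsilon> \<eta> \<sigma> H' \<Longrightarrow> e \<in> E \<Longrightarrow> r \<in> R \<Longrightarrow>
        (L' \<sigma> H' ^^ n) (e + r) = 0 \<Longrightarrow>
      norm r \<le> K * \<eta> * norm (e + r) \<and> norm ((L ^^ n) e) \<le> K * (\<eta> + cmod \<sigma>) * norm (e + r)"
      by blast
    obtain P where P: "P > 0" "\<And>x. norm ((L ^^ n) x) \<le> norm x * P"
      using bounded_linear.pos_bounded[OF bl_power] by blast
    define K1 where "K1 = C * (D + K * B)"
    define K2 where "K2 = C * (D + K1) + D"
    have pos: "K1 > 0" "K2 > 0" using C K D B1 by (auto simp: K1_def K2_def intro!: add_pos_nonneg mult_pos_pos)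
    show ?case
    proof (intro exI[of _ "K1 + (K * B + K2 * P)"] conjI allI impI)
      show "K1 + (K * B + K2 * P) > 0" using pos K B1 P by (auto intro!: add_pos_nonneg)
      fix H' \<eta> \<sigma> e r
      assume adm: "admissible \<epsilon> \<eta> \<sigma> H'" and er: "e \<in> E" "r \<in> R" and 0: "(L' \<sigma> H' ^^ Suc n) (e + r) = 0"
      define u where "u = e + r"
      have eta: "0 \<le> \<eta>" "\<eta> \<le> 1" using adm by (auto simp: admissible_def)
      obtain e' r' where w: "L' \<sigma> H' u = e' + r'" "e' \<in> E" "r' \<in> R" using D(2) by blast
      have "norm e \<le> D * norm u"
      proof -
        obtain e1 r1 where "u = e1 + r1" "e1 \<in> E" "r1 \<in> R" "norm e1 \<le> D * norm u" using D(2) by blast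
        then show ?thesis using decomposition_unique(1)[of e r e1 r1] er u_def by auto
      qed
      note ne = this
      \<comment> \<open>The induction hypothesis is applied to the image of u, whose components are
        e' and r'.\<close>
      have "(L' \<sigma> H' ^^ n) (e' + r') = 0"
        using 0 by (simp add: funpow_swap1 u_def[symmetric] w(1))
      from K(2)[OF adm w(2,3) this]
      have K': "norm r' \<le> K * \<eta> * norm (e' + r')" "norm ((L ^^ n) e') \<le> K * (\<eta> + cmod \<sigma>) * norm (e' + r')"
        by auto
      have wB: "norm (e' + r') \<le> B * norm u" using LB[OF adm, of u] w(1) by simp
      have r'2: "norm r' \<le> K * \<eta> * (B * norm u)"
        using K'(1) wB K(1) eta(1) by (meson mult_left_mono mult_nonneg_nonneg less_imp_le order_trans)
      have L2: "norm ((L ^^ n) e') \<le> K * (\<eta> + cmod \<sigma>) * (B * norm u)"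
        by (rule order_trans[OF K'(2)]) (use wB K(1) eta(1) in \<open>intro mult_left_mono; simp\<close>)
      from blk[OF adm er w(2,3)] w(1)
      have b: "norm r \<le> C * (\<eta> * norm e + norm r')" "norm (L e + cs \<sigma> e - e') \<le> C * (\<eta> * norm e + norm r)"
        by (auto simp: u_def)
      have "norm r \<le> C * (\<eta> * (D * norm u) + K * \<eta> * (B * norm u))"
        using b(1) r'2 ne eta C(1)
        by (meson add_mono mult_left_mono less_imp_le order_trans)
      also have "\<dots> = K1 * \<eta> * norm u" by (simp add: K1_def algebra_simps)
      finally have nr: "norm r \<le> K1 * \<eta> * norm u" .
      also have "\<dots> \<le> (K1 + (K * B + K2 * P)) * \<eta> * norm u"
        using pos K B1 P eta by (intro mult_right_mono) auto
      finally show "norm r \<le> (K1 + (K * B + K2 * P)) * \<eta> * norm (e + r)" by (simp add: u_def)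
      \<comment> \<open>Dropping the shift term is what brings |\<sigma>| into the estimate, to the
        first power.\<close>
      have "norm (L e - e') \<le> norm (L e + cs \<sigma> e - e') + norm (cs \<sigma> e)" by norm
      also have "\<dots> \<le> C * (\<eta> * (D * norm u) + K1 * \<eta> * norm u) + cmod \<sigma> * (D * norm u)"
        unfolding norm_cs using b(2) nr ne eta C(1)
        by (intro add_mono order_trans[OF b(2)] mult_left_mono) auto
      also have "\<dots> \<le> K2 * (\<eta> + cmod \<sigma>) * norm u"
        using eta C(1) D(1) pos(1) by (simp add: K2_def algebra_simps add_increasing)
      finally have n2: "norm (L e - e') \<le> K2 * (\<eta> + cmod \<sigma>) * norm u" .
      have "(L ^^ Suc n) e = (L ^^ n) e' + (L ^^ n) (L e - e')"
        by (simp add: linear_simps(2)[OF bl_power] funpow_swap1)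
      then have "norm ((L ^^ Suc n) e) \<le> norm ((L ^^ n) e') + norm (L e - e') * P"
        using P(2)[of "L e - e'"] norm_triangle_ineq[of "(L ^^ n) e'" "(L ^^ n) (L e - e')"] by simp
      also have "\<dots> \<le> K * (\<eta> + cmod \<sigma>) * (B * norm u) + K2 * (\<eta> + cmod \<sigma>) * norm u * P"
        using L2 n2 P(1) by (intro add_mono mult_right_mono) auto
      also have "\<dots> = (K * B + K2 * P) * (\<eta> + cmod \<sigma>) * norm u" by (simp add: algebra_simps)
      also have "\<dots> \<le> (K1 + (K * B + K2 * P)) * (\<eta> + cmod \<sigma>) * norm u"
        using pos eta by (intro mult_right_mono) auto
      finally show "norm ((L ^^ Suc n) e) \<le> (K1 + (K * B + K2 * P)) * (\<eta> + cmod \<sigma>) * norm (e + r)"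
        by (simp add: u_def)
    qed
  qed
  then obtain K where K: "K > 0" "\<And>H' \<eta> \<sigma> e r. admissible \<epsilon> \<eta> \<sigma> H' \<Longrightarrow> e \<in> E \<Longrightarrow> r \<in> R \<Longrightarrow>
      (L' \<sigma> H' ^^ n) (e + r) = 0 \<Longrightarrow>
      norm r \<le> K * \<eta> * norm (e + r) \<and> norm ((L ^^ n) e) \<le> K * (\<eta> + cmod \<sigma>) * norm (e + r)"
    by blast
  obtain Q where Q: "Q > 0" "\<And>x. \<exists>u. (L ^^ n) u = 0 \<and> norm (x - u) \<le> Q * norm ((L ^^ n) x)"
    using power_near_kernel by blast
  have "\<exists>v. (L ^^ n) v = 0 \<and> norm (u - v) \<le> (K + Q * K) * (\<eta> + cmod \<sigma>) * norm u"
    if adm: "admissible \<epsilon> \<eta> \<sigma> H'" and u: "(L' \<sigma> H' ^^ n) u = 0" for H' \<eta> \<sigma> u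
  proof -
    have eta: "0 \<le> \<eta>" using adm by (auto simp: admissible_def)
    obtain e r where er: "u = e + r" "e \<in> E" "r \<in> R" using D(2) by blast
    obtain v where v: "(L ^^ n) v = 0" "norm (e - v) \<le> Q * norm ((L ^^ n) e)" using Q(2) by blast
    have k: "norm r \<le> K * \<eta> * norm u" "norm ((L ^^ n) e) \<le> K * (\<eta> + cmod \<sigma>) * norm u"
      using K(2)[OF adm er(2,3)] u er(1) by auto
    have "norm (u - v) \<le> norm r + norm (e - v)" unfolding er(1) by norm
    also have "\<dots> \<le> K * \<eta> * norm u + Q * (K * (\<eta> + cmod \<sigma>) * norm u)"
      using k v(2) Q(1) by (intro add_mono order_trans[OF v(2)] mult_left_mono) auto
    also have "\<dots> \<le> (K + Q * K) * (\<eta> + cmod \<sigma>) * norm u"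
      using eta K(1) by (simp add: algebra_simps)
    finally show ?thesis using v(1) by blast
  qed
  moreover have "K + Q * K > 0" using K Q by (simp add: add_pos_pos)
  ultimately show ?thesis using C(2) by blast
qed

end

subsection \<open>Integration on the unit interval\<close>

abbreviation intg :: "(real \<Rightarrow> complex) \<Rightarrow> bool" where
  "intg f \<equiv> set_integrable lborel {0..1} f"

abbreviation meas :: "(real \<Rightarrow> complex) \<Rightarrow> bool" where
  "meas f \<equiv> set_borel_measurable lborel {0..1} f"

definition primitive :: "(real \<Rightarrow> complex) \<Rightarrow> real \<Rightarrow> complex" where
  "primitive F x = (LINT t:{0..x}|lborel. F t)"

lemma set_integrable_imp_meas: "set_integrable lborel A f \<Longrightarrow> set_borel_measurable lborel A f"
  by (simp add: set_integrable_def set_borel_measurable_def)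

lemma set_integral_Icc_combine:
  fixes f :: "real \<Rightarrow> 'a::{banach, second_countable_topology}"
  assumes "a \<le> b" "b \<le> c" "set_integrable lborel {a..c} f"
  shows "(LINT x:{a..c}|lborel. f x) = (LINT x:{a..b}|lborel. f x) + (LINT x:{b..c}|lborel. f x)"
proof -
  have "{a..c} = {a..b} \<union> {b..c}" using assms by auto
  moreover have "AE x in lborel. \<not> (x \<in> {a..b} \<and> x \<in> {b..c})"
    using AE_lborel_singleton[of b] by eventually_elim auto
  moreover have "set_integrable lborel {a..b} f" "set_integrable lborel {b..c} f"
    using assms by (auto intro: set_integrable_subset)
  ultimately show ?thesis by (simp add: set_integral_Un_AE)
qed

lemma set_integrable_Icc_subset:
  fixes f :: "real \<Rightarrow> 'a::{banach, second_countable_topology}"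
  assumes "set_integrable lborel {0..1} f" "0 \<le> a" "b \<le> 1"
  shows "set_integrable lborel {a..b} f"
  by (rule set_integrable_subset[OF assms(1)]) (use assms in auto)

lemma set_integrable_const: "set_integrable lborel {a..b::real} (\<lambda>_. c::'a::{banach, second_countable_topology})"
  by (rule borel_integrable_atLeastAtMost') auto

lemma aeq_sym: "aeq f g \<Longrightarrow> aeq g f"
  unfolding aeq_def by (auto elim!: eventually_mono)

lemma aeq_trans:
  assumes "aeq f g" "aeq g h" shows "aeq f h"
  using assms[unfolded aeq_def] unfolding aeq_def by eventually_elim auto

lemma aeqI: "(\<And>x. x \<in> {0..1} \<Longrightarrow> f x = g x) \<Longrightarrow> aeq f g"
  unfolding aeq_def by auto

lemma set_integral_aeq:
  assumes "aeq f g" "meas f" "meas g" "A \<in> sets lborel" "A \<subseteq> {0..1}"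
  shows "(LINT x:A|lborel. f x) = (LINT x:A|lborel. g x)"
  unfolding set_lebesgue_integral_def
proof (rule integral_cong_AE)
  have "set_borel_measurable lborel A f" "set_borel_measurable lborel A g"
    using assms set_borel_measurable_subset by blast+
  then show "(\<lambda>x. indicat_real A x *\<^sub>R f x) \<in> borel_measurable lborel"
    "(\<lambda>x. indicat_real A x *\<^sub>R g x) \<in> borel_measurable lborel"
    by (auto simp: set_borel_measurable_def)
  show "AE x in lborel. indicat_real A x *\<^sub>R f x = indicat_real A x *\<^sub>R g x"
    using assms(1) unfolding aeq_def
    by eventually_elim (use assms(5) in \<open>auto simp: indicator_def\<close>)
qed

lemma primitive_aeq:
  assumes "aeq f g" "meas f" "meas g" "0 \<le> x" "x \<le> 1"
  shows "primitive f x = primitive g x"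
  unfolding primitive_def using assms by (intro set_integral_aeq) auto

lemma primitive_diff:
  assumes "intg F" "0 \<le> x" "x \<le> y" "y \<le> 1"
  shows "primitive F y - primitive F x = (LINT t:{x..y}|lborel. F t)"
  unfolding primitive_def
  using set_integral_Icc_combine[of 0 x y F] assms set_integrable_Icc_subset[of F 0 y] by simp

lemma primitive_0: "primitive F 0 = 0"
proof -
  have "AE x in lborel. indicat_real {0..0} x *\<^sub>R F x = 0"
    using AE_lborel_singleton[of "0::real"] by eventually_elim (auto simp: indicator_def)
  then show ?thesis
    unfolding primitive_def set_lebesgue_integral_def by (rule integral_eq_zero_AE)
qed

lemma primitive_minus:
  "intg F \<Longrightarrow> intg G \<Longrightarrow> 0 \<le> x \<Longrightarrow> x \<le> 1 \<Longrightarrow> primitive (\<lambda>x. F x - G x) x = primitive F x - primitive G x"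
  unfolding primitive_def by (intro set_integral_diff(2)) (auto intro: set_integrable_Icc_subset)

lemma primitive_cmult: "primitive (\<lambda>x. c * F x) x = c * primitive F x"
  unfolding primitive_def by simp

lemma primitive_const: "0 \<le> x \<Longrightarrow> primitive (\<lambda>_. c) x = c * of_real x"
  unfolding primitive_def set_lebesgue_integral_def by (simp add: scaleR_conv_of_real)

lemma continuous_aeq_imp_eq:
  fixes f g :: "real \<Rightarrow> complex"
  assumes "continuous_on {0..1} f" "continuous_on {0..1} g" "aeq f g" "x \<in> {0..1}"
  shows "f x = g x"
proof -
  obtain N where N: "{x. \<not> (x \<in> {0..1} \<longrightarrow> f x = g x)} \<subseteq> N" "N \<in> null_sets lborel"
    using assms(3) unfolding aeq_def eventually_ae_filter by auto
  have neg: "negligible N"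
    using N(2) by (simp add: negligible_iff_null_sets null_sets_completionI)
  have "((\<lambda>x. norm (f x - g x)) has_integral 0) {0..1}"
    by (rule has_integral_spike[OF neg, where f = "\<lambda>_. 0"]) (use N in auto)
  then have "norm (f x - g x) = 0"
    using assms by (intro has_integral_0_cbox_imp_0[of 0 1 "\<lambda>x. norm (f x - g x)" x])
      (auto intro!: continuous_intros)
  then show ?thesis by simp
qed

text \<open>The difference, extended by zero to the line, integrates to zero over all half-lines.
  These form a generator of the Borel sets that is stable under intersection, so by the pi-lambda
  argument it integrates to zero over every Borel set.\<close>

lemma primitive_eq_imp_aeq:
  assumes f: "intg f" and g: "intg g"
    and eq: "\<And>x. x \<in> {0..1} \<Longrightarrow> primitive f x = primitive g x"
  shows "aeq f g"
proof -
  define h where "h x = indicat_real {0..1} x *\<^sub>R (f x - g x)" for x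
  have h: "integrable lborel h"
    using set_integral_diff(1)[OF f g] by (simp add: h_def[abs_def] set_integrable_def)
  have hs: "set_integrable lborel A h" if "A \<in> sets lborel" for A
    using integrable_mult_indicator[OF that h] by (simp add: set_integrable_def)
  have low: "(LINT x:{..a}|lborel. h x) = 0" for a
  proof -
    \<comment> \<open>Clipping the end point to [0,1] turns an integral over a half-line into a
      value of the primitives. For a < 0 the two integrands may differ at the point 0, a null
      set.\<close>
    define b where "b = max 0 (min 1 a)"
    have b: "b \<in> {0..1}" by (auto simp: b_def)
    have "indicat_real {..a} x *\<^sub>R h x = indicat_real {0..b} x *\<^sub>R (f x - g x)" if "x \<noteq> 0" for x
      using that by (auto simp: h_def b_def indicator_def)
    with AE_lborel_singleton[of "0::real"]
    have "AE x in lborel. indicat_real {..a} x *\<^sub>R h x = indicat_real {0..b} x *\<^sub>R (f x - g x)"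
      by (rule eventually_mono)
    moreover have i: "set_integrable lborel {0..b} (\<lambda>x. f x - g x)"
      using b by (intro set_integrable_Icc_subset[OF set_integral_diff(1)[OF f g]]) auto
    ultimately have "(LINT x:{..a}|lborel. h x) = (LINT x:{0..b}|lborel. f x - g x)"
      unfolding set_lebesgue_integral_def
      using hs[of "{..a}"] by (intro integral_cong_AE) (auto simp: set_integrable_def)
    also have "\<dots> = primitive f b - primitive g b"
      using primitive_minus[OF f g, of b] b by (simp add: primitive_def)
    finally show ?thesis using eq[OF b] by simp
  qed
  have tot: "(LINT x:UNIV|lborel. h x) = 0"
  proof -
    have "(LINT x:UNIV|lborel. h x) = (LINT x:{..1}|lborel. h x)"
      unfolding set_lebesgue_integral_def by (rule Bochner_Integration.integral_cong) (auto simp: h_def indicator_def)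
    then show ?thesis using low by simp
  qed
  have all: "(LINT x:A|lborel. h x) = 0" if "A \<in> sets lborel" for A
  proof -
    have 1: "A \<in> sigma_sets UNIV (range (\<lambda>a::real. {..a}))"
      using that by (simp add: borel_eq_atMost)
    have 2: "Int_stable (range (\<lambda>a::real. {..a}))"
      by (auto simp: Int_stable_def)
    have 3: "range (\<lambda>a::real. {..a}) \<subseteq> Pow UNIV" by simp
    show ?thesis
      using 2 3 1
    proof (induction rule: sigma_sets_induct_disjoint)
      case (basic A) then show ?case using low by auto
    next
      case empty then show ?case by (simp add: set_lebesgue_integral_def)
    next
      case (compl A)
      then have A: "A \<in> sets lborel" by (simp add: borel_eq_atMost)
      then have "(LINT x:A \<union> (UNIV - A)|lborel. h x) = (LINT x:A|lborel. h x) + (LINT x:UNIV - A|lborel. h x)"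
        by (intro set_integral_Un hs) auto
      then show ?case using compl tot by simp
    next
      case (union A)
      then have A: "A i \<in> sets lborel" for i by (auto simp: borel_eq_atMost)
      have "(LINT x:(\<Union>i. A i)|lborel. h x) = (\<Sum>i. (LINT x:(A i)|lborel. h x))"
        using union(1) A by (intro lebesgue_integral_countable_add hs) (auto simp: disjoint_family_on_def)
      then show ?case using union by simp
    qed
  qed
  have "AE x in lborel. h x = 0"
    by (rule sigma_finite_measure.density_zero[OF sigma_finite_lborel h all])
  then show ?thesis
    unfolding aeq_def by eventually_elim (auto simp: h_def)
qed

lemma integrable_pair_mult:
  fixes f g :: "real \<Rightarrow> complex"
  assumes f: "integrable lborel f" and g: "integrable lborel g"
  shows "integrable (lborel \<Otimes>\<^sub>M lborel) (\<lambda>(x, t). f x * g t)"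
proof (rule lborel_pair.Fubini_integrable)
  show "(\<lambda>(x, t). f x * g t) \<in> borel_measurable (lborel \<Otimes>\<^sub>M lborel)"
    using f g by measurable
  show "integrable lborel (\<lambda>x. \<integral>y. norm (case (x, y) of (x, t) \<Rightarrow> f x * g t) \<partial>lborel)"
    using f by (simp add: norm_mult)
  show "AE x in lborel. integrable lborel (\<lambda>y. case (x, y) of (x, t) \<Rightarrow> f x * g t)"
    using g by simp
qed

text \<open>Fubini on the triangle t \<le> x. This form of integration by parts needs only
  integrable densities.\<close>

lemma integral_primitive_by_parts:
  assumes F: "intg F" and G: "intg G" and y: "0 \<le> y" "y \<le> 1"
  shows "(LINT x:{0..y}|lborel. F x * primitive G x)
       = (LINT t:{0..y}|lborel. G t * (primitive F y - primitive F t))"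
proof -
  define f where "f x = indicat_real {0..y} x *\<^sub>R F x" for x
  define g where "g x = indicat_real {0..y} x *\<^sub>R G x" for x
  have fg: "integrable lborel f" "integrable lborel g"
    using set_integrable_Icc_subset[OF F, of 0 y] set_integrable_Icc_subset[OF G, of 0 y] y
    by (auto simp: f_def[abs_def] g_def[abs_def] set_integrable_def)
  define k where "k x t = indicat_real {z. snd z \<le> fst z} (x, t) *\<^sub>R (f x * g t)" for x t :: real
  have "{z \<in> space (lborel \<Otimes>\<^sub>M lborel :: (real \<times> real) measure). snd z \<le> fst z} \<in> sets (lborel \<Otimes>\<^sub>M lborel)"
    by measurable
  then have "{z::real \<times> real. snd z \<le> fst z} \<in> sets (lborel \<Otimes>\<^sub>M lborel)"
    by (simp add: space_pair_measure)
  from integrable_mult_indicator[OF this integrable_pair_mult[OF fg]]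
  have k: "integrable (lborel \<Otimes>\<^sub>M lborel) (case_prod k)"
    by (simp add: k_def case_prod_beta')
  have "(LINT x:{0..y}|lborel. F x * primitive G x) = (\<integral>x. (\<integral>t. k x t \<partial>lborel) \<partial>lborel)"
    unfolding set_lebesgue_integral_def
  proof (rule Bochner_Integration.integral_cong[OF refl])
    fix x :: real
    have "(\<integral>t. k x t \<partial>lborel) = (\<integral>t. f x * (indicat_real {0..x} t *\<^sub>R G t) \<partial>lborel)"
      by (rule Bochner_Integration.integral_cong[OF refl]) (auto simp: k_def f_def g_def indicator_def)
    also have "\<dots> = f x * primitive G x"
      unfolding primitive_def set_lebesgue_integral_def by (rule integral_mult_right_zero)
    finally show "indicat_real {0..y} x *\<^sub>R (F x * primitive G x) = (\<integral>t. k x t \<partial>lborel)"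
      by (simp add: f_def)
  qed
  also have "\<dots> = (\<integral>t. (\<integral>x. k x t \<partial>lborel) \<partial>lborel)"
    by (rule lborel_pair.Fubini_integral[OF k, symmetric])
  also have "\<dots> = (LINT t:{0..y}|lborel. G t * (primitive F y - primitive F t))"
    unfolding set_lebesgue_integral_def
  proof (rule Bochner_Integration.integral_cong[OF refl])
    fix t :: real
    have "(\<integral>x. k x t \<partial>lborel) = (\<integral>x. g t * (indicat_real {t..y} x *\<^sub>R F x) \<partial>lborel)"
      by (rule Bochner_Integration.integral_cong[OF refl]) (auto simp: k_def f_def g_def indicator_def)
    also have "\<dots> = g t * (LINT x:{t..y}|lborel. F x)"
      unfolding set_lebesgue_integral_def by (rule integral_mult_right_zero)
    also have "\<dots> = indicat_real {0..y} t *\<^sub>R (G t * (primitive F y - primitive F t))"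
      using primitive_diff[OF F, of t y] y by (auto simp: g_def indicator_def)
    finally show "(\<integral>x. k x t \<partial>lborel) = indicat_real {0..y} t *\<^sub>R (G t * (primitive F y - primitive F t))" .
  qed
  finally show ?thesis .
qed

subsection \<open>Square integrable functions\<close>

lemma L2_intg: "L2 f \<Longrightarrow> intg f"
proof -
  assume f: "L2 f"
  have "set_integrable lborel {0..1} (\<lambda>x. 1 + (norm (f x))^2)"
    using f by (intro set_integral_add(1) set_integrable_const) (auto simp: L2_def)
  then show ?thesis
  proof (rule set_integrable_bound)
    show "meas f" using f by (simp add: L2_def)
    have "norm z \<le> norm (1 + (norm z)^2)" for z :: complex
    proof -
      have "0 \<le> (norm z - 1/2)^2" by simp
      then show ?thesis by (simp add: power2_eq_square algebra_simps)
    qed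
    then show "AE x in lborel. x \<in> {0..1} \<longrightarrow> norm (f x) \<le> norm (1 + (norm (f x))^2)" by auto
  qed
qed

lemma meas_mult:
  assumes "meas f" "meas g" shows "meas (\<lambda>x. f x * g x)"
proof -
  have "(\<lambda>x. (indicat_real {0..1} x *\<^sub>R f x) * (indicat_real {0..1} x *\<^sub>R g x)) \<in> borel_measurable lborel"
    using assms unfolding set_borel_measurable_def by (intro borel_measurable_times)
  then show ?thesis
    unfolding set_borel_measurable_def
    by (rule measurable_cong[THEN iffD1, rotated]) (auto simp: indicator_def)
qed

lemma L2_bounded:
  assumes "meas f" "\<And>x. x \<in> {0..1} \<Longrightarrow> norm (f x) \<le> M"
  shows "L2 f"
proof -
  have "set_integrable lborel {0..1} (\<lambda>x::real. M^2)" by (rule set_integrable_const)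
  then have "set_integrable lborel {0..1} (\<lambda>x. (norm (f x))^2)"
  proof (rule set_integrable_bound)
    have "(\<lambda>x. (norm (indicat_real {0..1} x *\<^sub>R f x))^2) \<in> borel_measurable lborel"
      using assms(1) unfolding set_borel_measurable_def by measurable
    then show "set_borel_measurable lborel {0..1} (\<lambda>x. (norm (f x))^2)"
      unfolding set_borel_measurable_def
      by (rule measurable_cong[THEN iffD1, rotated]) (auto simp: indicator_def)
    show "AE x in lborel. x \<in> {0..1} \<longrightarrow> norm ((norm (f x))^2) \<le> norm (M^2)"
      using assms(2) by (auto intro!: AE_I2 power_mono)
  qed
  then show ?thesis using assms(1) by (simp add: L2_def)
qed

lemma continuous_meas: "continuous_on {0..1} f \<Longrightarrow> meas f"
  by (auto intro: set_integrable_imp_meas borel_integrable_atLeastAtMost')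

lemma continuous_unit_bounded:
  fixes f :: "real \<Rightarrow> complex"
  assumes "continuous_on {0..1} f"
  obtains M where "M \<ge> 0" "\<And>x. x \<in> {0..1} \<Longrightarrow> norm (f x) \<le> M"
proof -
  have "bounded (f ` {0..1})"
    using assms compact_continuous_image compact_imp_bounded compact_Icc by blast
  then obtain M where "\<forall>y\<in>f ` {0..1}. norm y \<le> M" by (auto simp: bounded_iff)
  then have "norm (f x) \<le> max M 0" if "x \<in> {0..1}" for x
    using that by (auto intro: max.coboundedI1)
  with that[of "max M 0"] show ?thesis by auto
qed

lemma L2_continuous:
  assumes "continuous_on {0..1} f" shows "L2 f"
proof -
  obtain M where "\<And>x. x \<in> {0..1} \<Longrightarrow> norm (f x) \<le> M"
    using continuous_unit_bounded[OF assms] by metis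
  then show ?thesis by (intro L2_bounded continuous_meas assms) auto
qed

lemma meas_add: "meas f \<Longrightarrow> meas g \<Longrightarrow> meas (\<lambda>x. f x + g x)"
  unfolding set_borel_measurable_def by (simp add: scaleR_add_right)

lemma meas_minus: "meas f \<Longrightarrow> meas g \<Longrightarrow> meas (\<lambda>x. f x - g x)"
  unfolding set_borel_measurable_def by (simp add: scaleR_diff_right)

lemma meas_cnj: "meas f \<Longrightarrow> meas (\<lambda>x. cnj (f x))"
proof -
  assume "meas f"
  then have "(\<lambda>x. cnj (indicat_real {0..1} x *\<^sub>R f x)) \<in> borel_measurable lborel"
    unfolding set_borel_measurable_def by (intro borel_measurable_continuous_on[OF continuous_on_cnj]) auto
  then show ?thesis unfolding set_borel_measurable_def by simp
qed

lemma L2_cmult: "L2 f \<Longrightarrow> L2 (\<lambda>x. c * f x)"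
proof -
  assume f: "L2 f"
  have "meas (\<lambda>x. c * f x)"
    by (rule meas_mult) (use f in \<open>auto simp: L2_def intro: continuous_meas\<close>)
  moreover have "set_integrable lborel {0..1} (\<lambda>x. (norm c)^2 * (norm (f x))^2)"
    using f unfolding L2_def by (intro set_integrable_mult_right) auto
  ultimately show ?thesis by (simp add: L2_def norm_mult power_mult_distrib)
qed

lemma L2_add: assumes f: "L2 f" and g: "L2 g" shows "L2 (\<lambda>x. f x + g x)"
proof -
  have m: "meas (\<lambda>x. f x + g x)" using f g by (auto simp: L2_def intro: meas_add)
  have "set_integrable lborel {0..1} (\<lambda>x. 2 * (norm (f x))^2 + 2 * (norm (g x))^2)"
    using f g unfolding L2_def by (intro set_integral_add(1) set_integrable_mult_right) auto
  then have "set_integrable lborel {0..1} (\<lambda>x. (norm (f x + g x))^2)"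
  proof (rule set_integrable_bound)
    have "(\<lambda>x. (norm (indicat_real {0..1} x *\<^sub>R (f x + g x)))^2) \<in> borel_measurable lborel"
      using m unfolding set_borel_measurable_def by measurable
    then show "set_borel_measurable lborel {0..1} (\<lambda>x. (norm (f x + g x))^2)"
      unfolding set_borel_measurable_def
      by (rule measurable_cong[THEN iffD1, rotated]) (auto simp: indicator_def)
    have "norm ((norm (a + b))^2) \<le> norm (2 * (norm a)^2 + 2 * (norm b)^2)" for a b :: complex
    proof -
      have "(norm (a + b))^2 \<le> (norm a + norm b)^2" by (intro power_mono norm_triangle_ineq) auto
      also have "\<dots> = 2 * (norm a)^2 + 2 * (norm b)^2 - (norm a - norm b)^2"
        by (simp add: power2_eq_square algebra_simps)
      finally have "(norm (a + b))^2 \<le> 2 * (norm a)^2 + 2 * (norm b)^2"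
        by (smt (verit) zero_le_power2)
      then show ?thesis by simp
    qed
    then show "AE x in lborel. x \<in> {0..1} \<longrightarrow>
        norm ((norm (f x + g x))^2) \<le> norm (2 * (norm (f x))^2 + 2 * (norm (g x))^2)" by auto
  qed
  then show ?thesis using m by (simp add: L2_def)
qed

lemma L2_minus: "L2 f \<Longrightarrow> L2 g \<Longrightarrow> L2 (\<lambda>x. f x - g x)"
  using L2_add[of f "\<lambda>x. (- 1) * g x"] L2_cmult[of g "- 1"] by simp

text \<open>Cauchy-Schwarz on a subinterval, from the nonnegative integral of (|f| - I / d)^2 with I
  / d the mean of |f|; the empty length is treated apart because of the division by d.\<close>

lemma L2_norm_integral_le:
  assumes f: "L2 f" and xy: "0 \<le> x" "x \<le> y" "y \<le> 1"
  shows "(LINT t:{x..y}|lborel. norm (f t)) \<le> l2norm f * sqrt (y - x)"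
proof (cases "x = y")
  case True
  have "AE t in lborel. indicat_real {y..y} t *\<^sub>R norm (f t) = 0"
    using AE_lborel_singleton[of y] by eventually_elim (auto simp: indicator_def)
  then have "(LINT t:{x..y}|lborel. norm (f t)) = 0"
    unfolding True set_lebesgue_integral_def by (rule integral_eq_zero_AE)
  with True show ?thesis by simp
next
  case False
  define d where "d = y - x"
  have d: "d > 0" using False xy by (simp add: d_def)
  have i1: "set_integrable lborel {x..y} (\<lambda>t. norm (f t))"
    using set_integrable_Icc_subset[OF set_integrable_norm[OF L2_intg[OF f]]] xy by auto
  have i2: "set_integrable lborel {x..y} (\<lambda>t. (norm (f t))^2)"
    by (rule set_integrable_Icc_subset) (use f xy in \<open>auto simp: L2_def\<close>)
  define I where "I = (LINT t:{x..y}|lborel. norm (f t))"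
  define Q where "Q = (LINT t:{x..y}|lborel. (norm (f t))^2)"
  have Ipos: "I \<ge> 0" unfolding I_def set_lebesgue_integral_def by (intro integral_nonneg_AE) auto
  have c: "(LINT t:{x..y}|lborel. a) = a * d" for a :: real
    using xy by (simp add: set_lebesgue_integral_def d_def mult.commute)
  have "0 \<le> (LINT t:{x..y}|lborel. (norm (f t) - I / d)^2)"
    unfolding set_lebesgue_integral_def by (intro integral_nonneg_AE) auto
  also have "\<dots> = (LINT t:{x..y}|lborel. (norm (f t))^2 - (2 * I / d) * norm (f t) + (I / d)^2)"
    by (rule set_lebesgue_integral_cong) (auto simp: power2_eq_square algebra_simps)
  also have "\<dots> = Q - (2 * I / d) * I + (I / d)^2 * d"
  proof -
    have i3: "set_integrable lborel {x..y} (\<lambda>t. (2 * I / d) * norm (f t))"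
      using i1 by (rule set_integrable_mult_right)
    show ?thesis
      unfolding set_integral_add(2)[OF set_integral_diff(1)[OF i2 i3] set_integrable_const]
        set_integral_diff(2)[OF i2 i3] c set_integral_mult_right
      by (simp add: I_def Q_def)
  qed
  also have "\<dots> = Q - I^2 / d" using d by (simp add: power2_eq_square field_simps)
  finally have "I^2 \<le> Q * d" using d by (simp add: field_simps)
  also have "Q \<le> (LINT t:{0..1}|lborel. (norm (f t))^2)"
    unfolding Q_def set_lebesgue_integral_def
    using i2 f xy by (intro integral_mono) (auto simp: set_integrable_def L2_def indicator_def)
  finally have "I^2 \<le> (LINT t:{0..1}|lborel. (norm (f t))^2) * d" using d by simp
  then have "I \<le> sqrt ((LINT t:{0..1}|lborel. (norm (f t))^2) * d)" by (rule real_le_rsqrt)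
  then show ?thesis by (simp add: I_def l2norm_def real_sqrt_mult d_def)
qed

text \<open>For \<open>F\<close> in \<open>L\<^sup>2\<close> the primitive is Hoelder continuous of order one half; this is the only
  consequence of square integrability that the error analysis uses.\<close>

definition sqrt_growth :: "(real \<Rightarrow> complex) \<Rightarrow> real \<Rightarrow> bool" where
  "sqrt_growth F N \<longleftrightarrow> intg F \<and> 0 \<le> N \<and> (\<forall>x y. 0 \<le> x \<longrightarrow> x \<le> y \<longrightarrow> y \<le> 1 \<longrightarrow>
     (LINT t:{x..y}|lborel. norm (F t)) \<le> N * sqrt (y - x))"

lemma sqrt_growth_intg: "sqrt_growth F N \<Longrightarrow> intg F"
  and sqrt_growth_nonneg: "sqrt_growth F N \<Longrightarrow> 0 \<le> N"
  by (auto simp: sqrt_growth_def)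

lemma l2norm_nonneg: "0 \<le> l2norm f"
  unfolding l2norm_def set_lebesgue_integral_def by (auto intro!: integral_nonneg_AE)

lemma L2_sqrt_growth: "L2 F \<Longrightarrow> sqrt_growth F (l2norm F)"
  by (simp add: sqrt_growth_def L2_intg L2_norm_integral_le l2norm_nonneg)

lemma intg_norm_subinterval:
  fixes F :: "real \<Rightarrow> complex"
  assumes "intg F" "0 \<le> x" "y \<le> 1" shows "set_integrable lborel {x..y} (\<lambda>t. norm (F t))"
  using set_integrable_Icc_subset[OF set_integrable_norm[OF assms(1)] assms(2,3)] .

lemma le_sqrt_unit: "0 \<le> x \<Longrightarrow> x \<le> 1 \<Longrightarrow> x \<le> sqrt x"
  using mult_left_le[of x x] by (intro real_le_rsqrt) (simp add: power2_eq_square)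

lemma set_integral_Icc_const:
  "a \<le> b \<Longrightarrow> (LINT t:{a..b}|lborel. c) = (b - a) * (c::real)"
  by (simp add: set_lebesgue_integral_def)

text \<open>On the unit interval a length is at most its square root. Thus one class covers both L2
  data and elements of C[0,1], with the L2 norm or the supremum bound as constant.\<close>

lemma bounded_sqrt_growth:
  assumes "meas f" "\<And>x. x \<in> {0..1} \<Longrightarrow> norm (f x) \<le> M" "0 \<le> M"
  shows "sqrt_growth f M"
  unfolding sqrt_growth_def
proof (intro conjI allI impI)
  show i: "intg f" by (rule L2_intg[OF L2_bounded[OF assms(1,2)]])
  fix x y :: real assume xy: "0 \<le> x" "x \<le> y" "y \<le> 1"
  have "(LINT t:{x..y}|lborel. norm (f t)) \<le> (LINT t:{x..y}|lborel. M)"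
    using xy assms(2) by (intro set_integral_mono intg_norm_subinterval i set_integrable_const) auto
  also have "\<dots> = (y - x) * M" using xy by (simp add: set_integral_Icc_const)
  also have "\<dots> \<le> sqrt (y - x) * M"
    using xy assms(3) by (intro mult_right_mono le_sqrt_unit) auto
  finally show "(LINT t:{x..y}|lborel. norm (f t)) \<le> M * sqrt (y - x)" by (simp add: mult.commute)
qed (rule assms(3))

lemma sqrt_growth_add:
  assumes F: "sqrt_growth F N" and G: "sqrt_growth G M"
  shows "sqrt_growth (\<lambda>x. F x + G x) (N + M)"
  unfolding sqrt_growth_def
proof (intro conjI allI impI)
  have i: "intg F" "intg G" using F G by (auto simp: sqrt_growth_def)
  show s: "intg (\<lambda>x. F x + G x)" by (intro set_integral_add(1) i)
  show "0 \<le> N + M" using F G by (auto simp: sqrt_growth_def)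
  fix x y :: real assume xy: "0 \<le> x" "x \<le> y" "y \<le> 1"
  have "(LINT t:{x..y}|lborel. norm (F t + G t)) \<le> (LINT t:{x..y}|lborel. norm (F t) + norm (G t))"
    using xy by (intro set_integral_mono set_integral_add(1) intg_norm_subinterval i s norm_triangle_ineq) auto
  also have "\<dots> = (LINT t:{x..y}|lborel. norm (F t)) + (LINT t:{x..y}|lborel. norm (G t))"
    using xy by (intro set_integral_add(2) intg_norm_subinterval i) auto
  also have "\<dots> \<le> N * sqrt (y - x) + M * sqrt (y - x)"
    using F G xy by (intro add_mono) (auto simp: sqrt_growth_def)
  finally show "(LINT t:{x..y}|lborel. norm (F t + G t)) \<le> (N + M) * sqrt (y - x)"
    by (simp add: algebra_simps)
qed

lemma sqrt_growth_mult:
  assumes F: "sqrt_growth F N" and r: "meas r" "\<And>x. x \<in> {0..1} \<Longrightarrow> norm (r x) \<le> M" "0 \<le> M"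
  shows "sqrt_growth (\<lambda>x. F x * r x) (N * M)"
  unfolding sqrt_growth_def
proof (intro conjI allI impI)
  have i: "intg F" and N: "0 \<le> N" using F by (auto simp: sqrt_growth_def)
  have "intg (\<lambda>x. of_real M * F x)" using i by (rule set_integrable_mult_right)
  then show s: "intg (\<lambda>x. F x * r x)"
  proof (rule set_integrable_bound)
    show "meas (\<lambda>x. F x * r x)"
      by (intro meas_mult r set_integrable_imp_meas i)
    show "AE x in lborel. x \<in> {0..1} \<longrightarrow> norm (F x * r x) \<le> norm (of_real M * F x)"
      using r(2,3) by (auto simp: norm_mult mult.commute[of M] intro!: AE_I2 mult_left_mono)
  qed
  show "0 \<le> N * M" using N r(3) by simp
  fix x y :: real assume xy: "0 \<le> x" "x \<le> y" "y \<le> 1"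
  have "(LINT t:{x..y}|lborel. norm (F t * r t)) \<le> (LINT t:{x..y}|lborel. M * norm (F t))"
    using xy r(2,3) i s
    by (intro set_integral_mono intg_norm_subinterval set_integrable_mult_right)
       (auto simp: norm_mult mult.commute[of M] intro!: mult_left_mono)
  also have "\<dots> = M * (LINT t:{x..y}|lborel. norm (F t))" by simp
  also have "\<dots> \<le> M * (N * sqrt (y - x))"
    using F xy r(3) by (intro mult_left_mono) (auto simp: sqrt_growth_def)
  finally show "(LINT t:{x..y}|lborel. norm (F t * r t)) \<le> N * M * sqrt (y - x)"
    by (simp add: algebra_simps)
qed

lemma sqrt_growth_cmult:
  assumes "sqrt_growth F N" shows "sqrt_growth (\<lambda>x. c * F x) (norm c * N)"
proof -
  have "sqrt_growth (\<lambda>x. F x * c) (N * norm c)"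
    by (rule sqrt_growth_mult[OF assms]) (auto intro: continuous_meas)
  then show ?thesis by (simp add: mult.commute)
qed

lemma sqrt_growth_minus:
  assumes "sqrt_growth F N" "sqrt_growth G M"
  shows "sqrt_growth (\<lambda>x. F x - G x) (N + M)"
  using sqrt_growth_add[OF assms(1) sqrt_growth_cmult[OF assms(2), of "- 1"]] by simp

lemma sqrt_growth_primitive:
  assumes F: "sqrt_growth F N" and xy: "0 \<le> x" "x \<le> y" "y \<le> 1"
  shows "norm (primitive F y - primitive F x) \<le> N * sqrt (y - x)"
proof -
  have i: "set_integrable lborel {x..y} F"
    by (rule set_integrable_Icc_subset) (use F xy in \<open>auto simp: sqrt_growth_def\<close>)
  have "norm (primitive F y - primitive F x) \<le> (LINT t:{x..y}|lborel. norm (F t))"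
    using primitive_diff[OF sqrt_growth_intg[OF F] xy] set_integral_norm_bound[OF i] by simp
  also have "\<dots> \<le> N * sqrt (y - x)" using F xy by (auto simp: sqrt_growth_def)
  finally show ?thesis .
qed

lemma sqrt_growth_primitive_bound:
  assumes F: "sqrt_growth F N" and x: "0 \<le> x" "x \<le> 1"
  shows "norm (primitive F x) \<le> N"
proof -
  have "norm (primitive F x) \<le> N * sqrt x"
    using sqrt_growth_primitive[OF F, of 0 x] x by (simp add: primitive_0)
  also have "\<dots> \<le> N * 1"
    using x sqrt_growth_nonneg[OF F] by (intro mult_left_mono) auto
  finally show ?thesis by simp
qed

lemma continuous_on_primitive:
  assumes F: "sqrt_growth F N"
  shows "continuous_on {0..1} (primitive F)"
proof -
  have "((\<lambda>y. primitive F y) \<longlongrightarrow> primitive F x) (at x within {0..1})" if x: "x \<in> {0..1}" for x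
  proof -
    have "norm (primitive F y - primitive F x) \<le> N * sqrt \<bar>y - x\<bar>" if "y \<in> {0..1}" for y
      using sqrt_growth_primitive[OF F, of x y] sqrt_growth_primitive[OF F, of y x] that x
      by (cases "x \<le> y") (auto simp: norm_minus_commute)
    then have "\<forall>\<^sub>F y in at x within {0..1}. norm (primitive F y - primitive F x) \<le> N * sqrt \<bar>y - x\<bar>"
      by (auto simp: eventually_at_filter)
    moreover have "((\<lambda>y. N * sqrt \<bar>y - x\<bar>) \<longlongrightarrow> N * sqrt \<bar>x - x\<bar>) (at x within {0..1})"
      by (intro tendsto_intros)
    ultimately have "((\<lambda>y. primitive F y - primitive F x) \<longlongrightarrow> 0) (at x within {0..1})"
      by (auto intro: Lim_null_comparison)
    then show ?thesis using LIM_zero_cancel by blast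
  qed
  then show ?thesis by (simp add: continuous_on_def)
qed

subsection \<open>The space of test functions\<close>

text \<open>\<open>wd\<close> chooses some weak derivative, and \<open>has_wderiv\<close> leaves an
  additive constant free. Comparing continuous representatives at 0 shows that this constant is
  zero, and comparing them at 1 gives the vanishing mean.\<close>

lemma Vspace_wd:
  assumes "w \<in> Vspace"
  shows "L2 (wd w)" "aeq w (primitive (wd w))" "primitive (wd w) 1 = 0"
proof -
  obtain g where g: "L2 w" "L2 g" "aeq w (primitive g)" "primitive g 1 = 0"
    using assms by (auto simp: Vspace_def H01_def aeq_def primitive_def)
  have "has_wderiv w g"
    using g by (auto simp: has_wderiv_def aeq_def primitive_def intro!: exI[of _ 0])
  then have "has_wderiv w (wd w)" unfolding wd_def by (rule someI[of "has_wderiv w"])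
  then obtain c where c: "L2 (wd w)" "aeq w (\<lambda>x. c + primitive (wd w) x)"
    by (auto simp: has_wderiv_def aeq_def primitive_def)
  have eq: "c + primitive (wd w) x = primitive g x" if "x \<in> {0..1}" for x
  proof (rule continuous_aeq_imp_eq[OF _ _ _ that])
    show "aeq (\<lambda>x. c + primitive (wd w) x) (primitive g)"
      using aeq_trans[OF aeq_sym[OF c(2)] g(3)] .
  qed (auto intro!: continuous_intros continuous_on_primitive[OF L2_sqrt_growth] c g)
  have c0: "c = 0" using eq[of 0] by (simp add: primitive_0)
  show "L2 (wd w)" by fact
  show "aeq w (primitive (wd w))" using c(2) c0 by simp
  show "primitive (wd w) 1 = 0" using eq[of 1] c0 g(4) by simp
qed

text \<open>Densities are determined almost everywhere by their primitives, so the chosen derivative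
  of a primitive is the given density up to a null set.\<close>

lemma VspaceI:
  assumes g: "L2 g" "primitive g 1 = 0" and w: "L2 w" "\<And>x. x \<in> {0..1} \<Longrightarrow> w x = primitive g x"
  shows "w \<in> Vspace" "aeq (wd w) g"
proof -
  show V: "w \<in> Vspace"
    using assms by (auto simp: Vspace_def H01_def primitive_def)
  note W = Vspace_wd[OF V]
  show "aeq (wd w) g"
  proof (rule primitive_eq_imp_aeq)
    show "primitive (wd w) x = primitive g x" if "x \<in> {0..1}" for x
    proof (rule continuous_aeq_imp_eq[OF _ _ _ that])
      show "aeq (primitive (wd w)) (primitive g)"
        by (rule aeq_trans[OF aeq_sym[OF W(2)] aeqI]) (use w in auto)
    qed (auto intro!: continuous_on_primitive[OF L2_sqrt_growth] W g)
  qed (auto intro: L2_intg W g)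
qed

subsection \<open>The fractional derivative operator\<close>

text \<open>The Riemann-Liouville integral of order \<alpha> - 1 of a density. It is separated from
  \<open>RL\<close> because a chosen weak derivative behaves linearly only almost everywhere, while
  densities can be added and subtracted pointwise.\<close>

definition rl :: "real \<Rightarrow> (real \<Rightarrow> complex) \<Rightarrow> real \<Rightarrow> complex" where
  "rl \<alpha> g x = of_real (1 / Gamma (\<alpha> - 1)) *
      (LINT t:{0..x}|lborel. of_real ((x - t) powr (\<alpha> - 2)) * g t)"

lemma RL_eq_rl: "RL \<alpha> w x = rl \<alpha> (wd w) x"
  by (simp add: RL_def rl_def)

lemma meas_real_mult:
  assumes "meas g" "k \<in> borel_measurable borel"
  shows "meas (\<lambda>t. of_real (k t) * g t)"
proof -
  have "(\<lambda>t. of_real (k t) * (indicat_real {0..1} t *\<^sub>R g t)) \<in> borel_measurable lborel"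
    using assms unfolding set_borel_measurable_def by measurable
  then show ?thesis
    unfolding set_borel_measurable_def
    by (rule measurable_cong[THEN iffD1, rotated]) (auto simp: indicator_def)
qed

lemma rl_aeq:
  assumes "aeq f g" "meas f" "meas g" "x \<in> {0..1}"
  shows "rl \<alpha> f x = rl \<alpha> g x"
proof -
  have "(LINT t:{0..x}|lborel. of_real ((x - t) powr (\<alpha> - 2)) * f t)
      = (LINT t:{0..x}|lborel. of_real ((x - t) powr (\<alpha> - 2)) * g t)"
  proof (rule set_integral_aeq)
    show "aeq (\<lambda>t. of_real ((x - t) powr (\<alpha> - 2)) * f t) (\<lambda>t. of_real ((x - t) powr (\<alpha> - 2)) * g t)"
      using assms(1) unfolding aeq_def by eventually_elim auto
  qed (use assms in \<open>auto intro!: meas_real_mult\<close>)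
  then show ?thesis by (simp add: rl_def)
qed

text \<open>The reflection t \<mapsto> x - t moves the singularity to 0, where the gauge integral of
  the power is known; nonnegativity makes it a Lebesgue integral.\<close>

lemma powr_reflected_integral:
  fixes a x \<beta> :: real
  assumes \<beta>: "- 1 < \<beta>" and ax: "a \<le> x"
  shows "set_integrable lborel {a..x} (\<lambda>t. (x - t) powr \<beta>)"
    "(LINT t:{a..x}|lborel. (x - t) powr \<beta>) = (x - a) powr (\<beta> + 1) / (\<beta> + 1)"
proof -
  let ?c = "x - a" and ?k = "\<lambda>s::real. s powr \<beta>"
  let ?f = "\<lambda>s. indicat_real {0..?c} s * ?k s"
  have hi: "(?k has_integral (?c powr (\<beta> + 1) / (\<beta> + 1))) {0..?c}"
    using has_integral_powr_from_0[of \<beta> ?c] assms by simp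
  then have "set_integrable lebesgue {0..?c} ?k"
    by (intro nonnegative_absolutely_integrable_1) auto
  then have s: "set_integrable lborel {0..?c} ?k"
    unfolding set_integrable_def by (subst (asm) integrable_completion) auto
  then have i: "integrable lborel ?f"
    by (simp add: set_integrable_def)
  have "(LINT x:{0..?c}|lborel. ?k x) = integral {0..?c} ?k"
    by (rule set_borel_integral_eq_integral(2)[OF s])
  then have v: "(\<integral>s. ?f s \<partial>lborel) = ?c powr (\<beta> + 1) / (\<beta> + 1)"
    using hi by (simp add: set_lebesgue_integral_def integral_unique)
  have eq: "(\<lambda>t. ?f (x + (-1) * t)) = (\<lambda>t. indicat_real {a..x} t *\<^sub>R (x - t) powr \<beta>)"
    by (auto simp: indicator_def fun_eq_iff)
  show "set_integrable lborel {a..x} (\<lambda>t. (x - t) powr \<beta>)"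
    using lborel_integrable_real_affine[OF i, of "-1" x] unfolding set_integrable_def eq by simp
  show "(LINT t:{a..x}|lborel. (x - t) powr \<beta>) = (x - a) powr (\<beta> + 1) / (\<beta> + 1)"
    using lborel_integral_real_affine[of "-1" ?f x] v unfolding set_lebesgue_integral_def eq by simp
qed

locale frac_order =
  fixes \<alpha> :: real
  assumes \<alpha>_gt: "3/2 < \<alpha>" and \<alpha>_less: "\<alpha> < 2"
begin

definition ker :: "real \<Rightarrow> real" where "ker s = s powr (\<alpha> - 2)"

text \<open>This is 1 / Gamma \<alpha>, the maximum over [0,1] of the fractional integral of the
  constant 1.\<close>

definition c\<alpha> :: real where "c\<alpha> = 1 / (Gamma (\<alpha> - 1) * (\<alpha> - 1))"

lemma c\<alpha>_pos: "c\<alpha> > 0"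
  using \<alpha>_gt by (auto simp: c\<alpha>_def intro!: divide_pos_pos mult_pos_pos Gamma_real_pos)

lemma ker_nonneg: "0 \<le> ker s"
  by (simp add: ker_def)

lemma ker_meas [measurable]: "ker \<in> borel_measurable borel"
  unfolding ker_def by measurable

lemma ker_integral_full:
  assumes "a \<le> x"
  shows "set_integrable lborel {a..x} (\<lambda>t. ker (x - t))"
    "(LINT t:{a..x}|lborel. ker (x - t)) = (x - a) powr (\<alpha> - 1) / (\<alpha> - 1)"
  using powr_reflected_integral[of "\<alpha> - 2" a x] \<alpha>_gt assms by (auto simp: ker_def)

lemma ker_integral:
  assumes "a \<le> b" "b \<le> x"
  shows "set_integrable lborel {a..b} (\<lambda>t. ker (x - t))"
    "(LINT t:{a..b}|lborel. ker (x - t)) = ((x - a) powr (\<alpha> - 1) - (x - b) powr (\<alpha> - 1)) / (\<alpha> - 1)"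
proof -
  show i: "set_integrable lborel {a..b} (\<lambda>t. ker (x - t))"
    using ker_integral_full(1)[of a x] assms by (auto intro: set_integrable_subset)
  show "(LINT t:{a..b}|lborel. ker (x - t)) = ((x - a) powr (\<alpha> - 1) - (x - b) powr (\<alpha> - 1)) / (\<alpha> - 1)"
    using set_integral_Icc_combine[of a b x "\<lambda>t. ker (x - t)"] assms
      ker_integral_full[of a x] ker_integral_full(2)[of b x] by (simp add: diff_divide_distrib)
qed

lemma ker_mult_integrable:
  assumes g: "meas g" "\<And>t. t \<in> {0..1} \<Longrightarrow> norm (g t) \<le> M" and x: "0 \<le> a" "a \<le> b" "b \<le> x" "b \<le> 1"
  shows "set_integrable lborel {a..b} (\<lambda>t. of_real (ker (x - t)) * g t)"
proof -
  have "set_integrable lborel {a..b} (\<lambda>t. M * ker (x - t))"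
    using ker_integral(1)[OF x(2,3)] by (rule set_integrable_mult_right)
  then show ?thesis
  proof (rule set_integrable_bound)
    show "set_borel_measurable lborel {a..b} (\<lambda>t. of_real (ker (x - t)) * g t)"
    proof (rule set_borel_measurable_subset)
      show "meas (\<lambda>t. of_real (ker (x - t)) * g t)" by (intro meas_real_mult g) measurable
    qed (use x in auto)
    have "norm (of_real (ker (x - t)) * g t) \<le> norm (M * ker (x - t))" if "t \<in> {a..b}" for t
    proof -
      have "norm (g t) \<le> M" using g(2)[of t] that x by auto
      moreover then have "0 \<le> M" using norm_ge_zero order_trans by blast
      ultimately show ?thesis
        using ker_nonneg[of "x - t"] by (simp add: norm_mult abs_mult mult.commute mult_right_mono)
    qed
    then show "AE t in lborel. t \<in> {a..b} \<longrightarrow> norm (of_real (ker (x - t)) * g t) \<le> norm (M * ker (x - t))"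
      by auto
  qed
qed

lemma ker_mult_bound:
  assumes g: "meas g" "\<And>t. t \<in> {0..1} \<Longrightarrow> norm (g t) \<le> M" and x: "0 \<le> a" "a \<le> b" "b \<le> x" "b \<le> 1"
  shows "norm (LINT t:{a..b}|lborel. of_real (ker (x - t)) * g t)
     \<le> M * (((x - a) powr (\<alpha> - 1) - (x - b) powr (\<alpha> - 1)) / (\<alpha> - 1))"
proof -
  note i = ker_mult_integrable[OF g x]
  have "norm (LINT t:{a..b}|lborel. of_real (ker (x - t)) * g t)
      \<le> (LINT t:{a..b}|lborel. norm (of_real (ker (x - t)) * g t))"
    by (rule set_integral_norm_bound[OF i])
  also have "\<dots> \<le> (LINT t:{a..b}|lborel. M * ker (x - t))"
  proof (rule set_integral_mono)
    show "norm (of_real (ker (x - t)) * g t) \<le> M * ker (x - t)" if "t \<in> {a..b}" for t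
      using g(2)[of t] that x ker_nonneg[of "x - t"]
      by (auto simp: norm_mult mult.commute[of M] intro!: mult_left_mono)
  qed (use i ker_integral(1)[OF x(2,3)] in \<open>auto intro: set_integrable_norm\<close>)
  also have "\<dots> = M * (LINT t:{a..b}|lborel. ker (x - t))" by simp
  finally show ?thesis using ker_integral(2)[OF x(2,3)] by simp
qed

lemma rl_ker: "rl \<alpha> g x = of_real (1 / Gamma (\<alpha> - 1)) * (LINT t:{0..x}|lborel. of_real (ker (x - t)) * g t)"
  by (simp add: rl_def ker_def)

lemma Gamma_pos: "Gamma (\<alpha> - 1) > 0"
  using \<alpha>_gt by (intro Gamma_real_pos) auto

lemma rl_norm:
  assumes "norm (LINT t:{0..x}|lborel. of_real (ker (x - t)) * g t) \<le> B / (\<alpha> - 1)"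
  shows "norm (rl \<alpha> g x) \<le> c\<alpha> * B"
proof -
  have "norm (rl \<alpha> g x) \<le> 1 / Gamma (\<alpha> - 1) * (B / (\<alpha> - 1))"
    unfolding rl_ker norm_mult norm_of_real using Gamma_pos assms
    by (intro mult_mono) auto
  then show ?thesis by (simp add: c\<alpha>_def)
qed

lemma rl_bound:
  assumes g: "meas g" "\<And>t. t \<in> {0..1} \<Longrightarrow> norm (g t) \<le> M" and x: "x \<in> {0..1}"
  shows "norm (rl \<alpha> g x) \<le> c\<alpha> * (M * x powr (\<alpha> - 1))"
  using ker_mult_bound[OF g, of 0 x x] x by (intro rl_norm) auto

lemma rl_bound_1:
  assumes g: "meas g" "\<And>t. t \<in> {0..1} \<Longrightarrow> norm (g t) \<le> M" "0 \<le> M" and x: "x \<in> {0..1}"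
  shows "norm (rl \<alpha> g x) \<le> c\<alpha> * M"
proof -
  have "x powr (\<alpha> - 1) \<le> 1 powr (\<alpha> - 1)"
    using x \<alpha>_gt by (intro powr_mono2) auto
  then have "c\<alpha> * (M * x powr (\<alpha> - 1)) \<le> c\<alpha> * (M * 1)"
    using g(3) c\<alpha>_pos by (intro mult_left_mono) auto
  with rl_bound[OF g(1,2) x] show ?thesis by simp
qed

lemma rl_cmult: "rl \<alpha> (\<lambda>t. c * g t) x = c * rl \<alpha> g x"
proof -
  have "(LINT t:{0..x}|lborel. of_real (ker (x - t)) * (c * g t))
      = (LINT t:{0..x}|lborel. c * (of_real (ker (x - t)) * g t))"
    by (simp add: mult.left_commute)
  then show ?thesis by (simp add: rl_ker)
qed

lemma rl_diff:
  assumes f: "meas f" "\<And>t. t \<in> {0..1} \<Longrightarrow> norm (f t) \<le> M"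
    and g: "meas g" "\<And>t. t \<in> {0..1} \<Longrightarrow> norm (g t) \<le> N" and x: "x \<in> {0..1}"
  shows "rl \<alpha> (\<lambda>t. f t - g t) x = rl \<alpha> f x - rl \<alpha> g x"
  using set_integral_diff(2)[OF ker_mult_integrable[OF f, of 0 x x] ker_mult_integrable[OF g, of 0 x x]] x
  by (simp add: rl_ker right_diff_distrib)

text \<open>Split the integral up to y at x. The part over {x..y} sees kernel mass (y - x) powr
  (\<alpha> - 1) / (\<alpha> - 1). On {0..x} the kernel difference is nonnegative almost everywhere,
  since the kernel decreases, and its integral is at most the same quantity; hence the factor
  2.\<close>

lemma rl_hoelder:
  assumes g: "meas g" "\<And>t. t \<in> {0..1} \<Longrightarrow> norm (g t) \<le> M" and xy: "0 \<le> x" "x \<le> y" "y \<le> 1"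
  shows "norm (rl \<alpha> g y - rl \<alpha> g x) \<le> c\<alpha> * (2 * M * (y - x) powr (\<alpha> - 1))"
proof -
  have M: "0 \<le> M" using order_trans[OF norm_ge_zero g(2)[of 0]] by simp
  define I where "I = (LINT t:{0..x}|lborel. of_real (ker (x - t) - ker (y - t)) * g t)"
  have i1: "set_integrable lborel {0..x} (\<lambda>t. of_real (ker (x - t)) * g t)"
    and i2: "set_integrable lborel {0..x} (\<lambda>t. of_real (ker (y - t)) * g t)"
    and i3: "set_integrable lborel {0..y} (\<lambda>t. of_real (ker (y - t)) * g t)"
    using ker_mult_integrable[OF g] xy by auto
  have I: "I = (LINT t:{0..x}|lborel. of_real (ker (x - t)) * g t) - (LINT t:{0..x}|lborel. of_real (ker (y - t)) * g t)"
    using set_integral_diff(2)[OF i1 i2] by (simp add: I_def left_diff_distrib)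
  have iI: "set_integrable lborel {0..x} (\<lambda>t. of_real (ker (x - t) - ker (y - t)) * g t)"
    using set_integral_diff(1)[OF i1 i2] by (simp add: left_diff_distrib)
  have "norm I \<le> (LINT t:{0..x}|lborel. norm (of_real (ker (x - t) - ker (y - t)) * g t))"
    unfolding I_def by (rule set_integral_norm_bound[OF iI])
  also have "\<dots> \<le> (LINT t:{0..x}|lborel. M * (ker (x - t) - ker (y - t)))"
  proof (rule set_integral_mono_AE)
    show "set_integrable lborel {0..x} (\<lambda>t. norm (of_real (ker (x - t) - ker (y - t)) * g t))"
      by (rule set_integrable_norm[OF iI])
    show "set_integrable lborel {0..x} (\<lambda>t. M * (ker (x - t) - ker (y - t)))"
      using ker_integral(1)[of 0 x x] ker_integral(1)[of 0 x y] xy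
      by (intro set_integrable_mult_right set_integral_diff(1)) auto
    \<comment> \<open>At t = x the convention that 0 powr a is 0 breaks the monotonicity of
      \<open>ker\<close>, so this null set is excluded.\<close>
    have "norm (of_real (ker (x - t) - ker (y - t)) * g t) \<le> M * (ker (x - t) - ker (y - t))"
      if "t \<noteq> x" "t \<in> {0..x}" for t
    proof -
      have "ker (y - t) \<le> ker (x - t)"
        unfolding ker_def using that xy \<alpha>_less by (intro powr_mono2') auto
      moreover have "norm (g t) \<le> M" using g(2)[of t] that xy by auto
      ultimately show ?thesis
        by (simp only: norm_mult norm_of_real mult.commute[of M]) (auto intro!: mult_left_mono)
    qed
    with AE_lborel_singleton[of x]
    show "AE t\<in>{0..x} in lborel. norm (of_real (ker (x - t) - ker (y - t)) * g t) \<le> M * (ker (x - t) - ker (y - t))"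
      by (auto elim!: eventually_mono)
  qed
  also have "\<dots> = M * ((LINT t:{0..x}|lborel. ker (x - t)) - (LINT t:{0..x}|lborel. ker (y - t)))"
    using ker_integral(1)[of 0 x x] ker_integral(1)[of 0 x y] xy by (simp add: set_integral_diff)
  also have "\<dots> = M * ((x powr (\<alpha> - 1) - y powr (\<alpha> - 1) + (y - x) powr (\<alpha> - 1)) / (\<alpha> - 1))"
    using ker_integral(2)[of 0 x x] ker_integral(2)[of 0 x y] xy by (simp add: diff_divide_distrib add_divide_distrib)
  also have "\<dots> \<le> M * ((y - x) powr (\<alpha> - 1) / (\<alpha> - 1))"
  proof -
    have "x powr (\<alpha> - 1) \<le> y powr (\<alpha> - 1)" using xy \<alpha>_gt by (intro powr_mono2) auto
    then show ?thesis using M \<alpha>_gt by (intro mult_left_mono divide_right_mono) auto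
  qed
  finally have b1: "norm I \<le> M * ((y - x) powr (\<alpha> - 1) / (\<alpha> - 1))" .
  define J where "J = (LINT t:{x..y}|lborel. of_real (ker (y - t)) * g t)"
  have b2: "norm J \<le> M * ((y - x) powr (\<alpha> - 1) / (\<alpha> - 1))"
    using ker_mult_bound[OF g, of x y y] xy by (simp add: J_def)
  have "rl \<alpha> g y - rl \<alpha> g x = of_real (1 / Gamma (\<alpha> - 1)) * (J - I)"
    unfolding rl_ker right_diff_distrib[symmetric]
    using set_integral_Icc_combine[OF xy(1,2) i3] I by (simp add: J_def)
  also have "norm \<dots> \<le> 1 / Gamma (\<alpha> - 1) * (2 * M * (y - x) powr (\<alpha> - 1) / (\<alpha> - 1))"
    unfolding norm_mult norm_of_real
  proof (intro mult_mono)
    show "norm (J - I) \<le> 2 * M * (y - x) powr (\<alpha> - 1) / (\<alpha> - 1)"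
      using norm_triangle_ineq4[of J I] b1 b2 by simp
  qed (use Gamma_pos in auto)
  finally show ?thesis by (simp add: c\<alpha>_def)
qed

text \<open>Oscillation: a density whose primitive is of size \<open>h\<close> gains \<open>h powr (\<alpha> - 1)\<close>; away from the
  singularity of the kernel this is an integration by parts.\<close>

lemma rl_oscillation:
  assumes g: "meas g" "\<And>t. t \<in> {0..1} \<Longrightarrow> norm (g t) \<le> M" and h: "0 < h"
    and P: "\<And>t. t \<in> {0..1} \<Longrightarrow> norm (primitive g t) \<le> h * M" and x: "x \<in> {0..1}"
  shows "norm (rl \<alpha> g x) \<le> c\<alpha> * (3 * M * h powr (\<alpha> - 1))"
proof -
  have M: "0 \<le> M" using order_trans[OF norm_ge_zero g(2)[of 0]] by simp
  show ?thesis
  proof (cases "x \<le> h")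
    case True
    have "x powr (\<alpha> - 1) \<le> h powr (\<alpha> - 1)" using x True \<alpha>_gt by (intro powr_mono2) auto
    then have "M * x powr (\<alpha> - 1) \<le> 3 * M * h powr (\<alpha> - 1)"
      using M by (intro mult_mono) auto
    then have "c\<alpha> * (M * x powr (\<alpha> - 1)) \<le> c\<alpha> * (3 * M * h powr (\<alpha> - 1))"
      using c\<alpha>_pos by (intro mult_left_mono) auto
    with rl_bound[OF g x] show ?thesis by simp
  next
    case False
    define y where "y = x - h"
    have y: "0 \<le> y" "y < x" "x \<le> 1" "y \<le> 1" using False x h by (auto simp: y_def)
    \<comment> \<open>The derivative of \<open>\<lambda>s. ker (x - s)\<close>. Cut off at distance
      h from x it is continuous, and \<open>F\<close> is an integrable density whose primitive
      reproduces the kernel up to a constant.\<close>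
    define \<phi> where "\<phi> s = (2 - \<alpha>) * (x - s) powr (\<alpha> - 3)" for s
    define F where "F s = (if s \<in> {0..y} then of_real (\<phi> s) else 0 :: complex)" for s
    have cont: "continuous_on {0..y} \<phi>"
      unfolding \<phi>_def using y by (intro continuous_intros) auto
    have i\<phi>: "set_integrable lborel {0..y} (\<lambda>s. of_real (\<phi> s) :: complex)"
      by (intro borel_integrable_atLeastAtMost' continuous_intros cont)
    have "(\<lambda>s. indicat_real {0..y} s *\<^sub>R (of_real (\<phi> s) :: complex)) = (\<lambda>s. indicat_real {0..1} s *\<^sub>R F s)"
      using y by (auto simp: F_def indicator_def fun_eq_iff)
    then have iF: "intg F"
      using i\<phi> by (simp add: set_integrable_def)
    have prF: "primitive F y - primitive F t = of_real (h powr (\<alpha> - 2) - ker (x - t))"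
      and int\<phi>: "(LINT s:{t..y}|lborel. \<phi> s) = h powr (\<alpha> - 2) - ker (x - t)" if t: "t \<in> {0..y}" for t
    proof -
      have "(LINT s:{t..y}|lborel. \<phi> s) = ker (x - y) - ker (x - t)"
        unfolding set_lebesgue_integral_def
      proof (rule integral_FTC_atLeastAtMost)
        show "t \<le> y" using t by simp
        show "continuous_on {t..y} \<phi>" by (rule continuous_on_subset[OF cont]) (use t in auto)
        show "((\<lambda>s. ker (x - s)) has_vector_derivative \<phi> s) (at s within {t..y})" if "t \<le> s" "s \<le> y" for s
        proof -
          have "((\<lambda>s. (x - s) powr (\<alpha> - 2)) has_real_derivative \<phi> s) (at s)"
          proof -
            have "((\<lambda>s. x - s) has_real_derivative - 1) (at s)"
              by (auto intro!: derivative_eq_intros)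
            from DERIV_fun_powr[OF this, of "\<alpha> - 2"] that y show ?thesis
              by (simp add: \<phi>_def algebra_simps)
          qed
          then show ?thesis
            unfolding ker_def has_real_derivative_iff_has_vector_derivative
            by (rule has_vector_derivative_at_within)
        qed
      qed
      then show 1: "(LINT s:{t..y}|lborel. \<phi> s) = h powr (\<alpha> - 2) - ker (x - t)"
        by (simp add: y_def ker_def)
      have "primitive F y - primitive F t = (LINT s:{t..y}|lborel. F s)"
        using primitive_diff[OF iF, of t y] t y by auto
      also have "\<dots> = (LINT s:{t..y}|lborel. of_real (\<phi> s))"
        by (rule set_lebesgue_integral_cong) (use t in \<open>auto simp: F_def\<close>)
      also have "\<dots> = of_real (LINT s:{t..y}|lborel. \<phi> s)"
        by (rule set_integral_complex_of_real)
      finally show "primitive F y - primitive F t = of_real (h powr (\<alpha> - 2) - ker (x - t))"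
        using 1 by simp
    qed
    have ig: "intg g" by (rule L2_intg[OF L2_bounded[OF g]])
    have igy: "set_integrable lborel {0..y} g" using set_integrable_Icc_subset[OF ig, of 0 y] y by simp
    define A where "A = (LINT t:{0..y}|lborel. of_real (ker (x - t)) * g t)"
    define B where "B = (LINT s:{0..y}|lborel. F s * primitive g s)"
    \<comment> \<open>Integration by parts read backwards: it expresses the far part A of the
      fractional integral by a boundary term at y and an integral B that contains only the small
      primitive of g.\<close>
    have "B = (LINT t:{0..y}|lborel. g t * (primitive F y - primitive F t))"
      unfolding B_def using y by (intro integral_primitive_by_parts iF ig) auto
    also have "\<dots> = (LINT t:{0..y}|lborel. of_real (h powr (\<alpha> - 2)) * g t - of_real (ker (x - t)) * g t)"
      by (rule set_lebesgue_integral_cong) (auto simp: prF algebra_simps)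
    also have "\<dots> = of_real (h powr (\<alpha> - 2)) * primitive g y - A"
      using set_integral_diff(2)[OF set_integrable_mult_right[OF igy] ker_mult_integrable[OF g, of 0 y x]] y
      by (simp add: A_def primitive_def)
    finally have A: "A = of_real (h powr (\<alpha> - 2)) * primitive g y - B" by simp
    have contg: "continuous_on {0..1} (primitive g)"
      by (rule continuous_on_primitive[OF bounded_sqrt_growth[OF g M]])
    have iB: "set_integrable lborel {0..y} (\<lambda>s. of_real (\<phi> s) * primitive g s)"
      using y by (intro borel_integrable_atLeastAtMost' continuous_intros cont continuous_on_subset[OF contg]) auto
    have \<phi>0: "\<phi> s \<ge> 0" for s using \<alpha>_less by (simp add: \<phi>_def)
    have "B = (LINT s:{0..y}|lborel. of_real (\<phi> s) * primitive g s)"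
      unfolding B_def by (rule set_lebesgue_integral_cong) (auto simp: F_def)
    also have "norm \<dots> \<le> (LINT s:{0..y}|lborel. norm (of_real (\<phi> s) * primitive g s))"
      by (rule set_integral_norm_bound[OF iB])
    also have "\<dots> \<le> (LINT s:{0..y}|lborel. (h * M) * \<phi> s)"
    proof (rule set_integral_mono)
      show "norm (of_real (\<phi> s) * primitive g s) \<le> h * M * \<phi> s" if "s \<in> {0..y}" for s
        using P[of s] that y \<phi>0[of s] by (auto simp: norm_mult mult.commute[of "h * M"] intro!: mult_left_mono)
    qed (use set_integrable_norm[OF iB] in \<open>auto intro!: borel_integrable_atLeastAtMost' continuous_intros cont\<close>)
    \<comment> \<open>The integral of \<phi> is the total variation of the kernel away from its
      singularity, at most h powr (\<alpha> - 2); the primitive of g supplies the factor h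
      M.\<close>
    also have "\<dots> = h * M * (h powr (\<alpha> - 2) - ker x)"
      using int\<phi>[of 0] y by simp
    also have "\<dots> \<le> h * M * h powr (\<alpha> - 2)"
      using h M ker_nonneg[of x] by (intro mult_left_mono) auto
    finally have "norm B \<le> h * M * h powr (\<alpha> - 2)" .
    moreover have hp: "h powr (\<alpha> - 1) = h * h powr (\<alpha> - 2)"
      using powr_mult_base[of h "\<alpha> - 2"] h by (simp add: algebra_simps)
    ultimately have "norm B \<le> M * h powr (\<alpha> - 1)" by (simp add: algebra_simps)
    moreover have "norm (of_real (h powr (\<alpha> - 2)) * primitive g y) \<le> h powr (\<alpha> - 2) * (h * M)"
      unfolding norm_mult norm_of_real using P[of y] y by (intro mult_mono) auto
    then have "norm (of_real (h powr (\<alpha> - 2)) * primitive g y) \<le> M * h powr (\<alpha> - 1)"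
      by (simp add: hp algebra_simps)
    ultimately have nA: "norm A \<le> 2 * M * h powr (\<alpha> - 1)"
      unfolding A by (intro order_trans[OF norm_triangle_ineq4]) auto
    have nC: "norm (LINT t:{y..x}|lborel. of_real (ker (x - t)) * g t) \<le> M * (h powr (\<alpha> - 1) / (\<alpha> - 1))"
      using ker_mult_bound[OF g, of y x x] y by (simp add: y_def)
    have "(LINT t:{0..x}|lborel. of_real (ker (x - t)) * g t) = A + (LINT t:{y..x}|lborel. of_real (ker (x - t)) * g t)"
      unfolding A_def using y ker_mult_integrable[OF g, of 0 x x] by (intro set_integral_Icc_combine) auto
    then have "norm (LINT t:{0..x}|lborel. of_real (ker (x - t)) * g t)
        \<le> 2 * M * h powr (\<alpha> - 1) + M * h powr (\<alpha> - 1) / (\<alpha> - 1)"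
      using nA nC norm_triangle_ineq[of A "LINT t:{y..x}|lborel. of_real (ker (x - t)) * g t"] by simp
    \<comment> \<open>As \<alpha> - 1 < 1, dividing by it enlarges the bound. The boundary term, the
      integral B and the part near the singularity then share one denominator and give the constant
      3.\<close>
    also have "2 * M * h powr (\<alpha> - 1) \<le> 2 * M * h powr (\<alpha> - 1) / (\<alpha> - 1)"
      using M \<alpha>_gt \<alpha>_less by (simp add: le_divide_eq mult_left_le)
    finally show ?thesis
      by (intro rl_norm) (simp add: add_divide_distrib[symmetric])
  qed
qed

end

subsection \<open>Local projection onto polynomials\<close>

definition local_mean :: "real \<Rightarrow> real \<Rightarrow> (real \<Rightarrow> complex) \<Rightarrow> complex" where
  "local_mean a b v = of_real (1 / (b - a)) * (LINT t:{a..b}|lborel. v t)"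

text \<open>The L2 coefficient with respect to t - (a + b) / 2, whose squared norm is (b - a)^3 /
  12. Setting it to 0 for k = 0 lets one formula serve both degrees.\<close>

definition local_slope :: "nat \<Rightarrow> real \<Rightarrow> real \<Rightarrow> (real \<Rightarrow> complex) \<Rightarrow> complex" where
  "local_slope k a b v = (if k = 0 then 0 else
     of_real (12 / (b - a) ^ 3) * (LINT t:{a..b}|lborel. of_real (t - (a + b) / 2) * v t))"

text \<open>For k \<le> 1 this is the L2 projection onto polynomials of degree at most k, in the
  orthogonal basis of 1 and t - (a + b) / 2, rewritten in monomials.\<close>

definition local_poly :: "nat \<Rightarrow> real \<Rightarrow> real \<Rightarrow> (real \<Rightarrow> complex) \<Rightarrow> complex poly" where
  "local_poly k a b v = [: local_mean a b v - local_slope k a b v * of_real ((a + b) / 2), local_slope k a b v :]"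

lemma poly_local_poly:
  "poly (local_poly k a b v) (of_real t) = local_mean a b v + local_slope k a b v * of_real (t - (a + b) / 2)"
  by (simp add: local_poly_def algebra_simps)

lemma degree_local_poly: "degree (local_poly k a b v) \<le> k"
  by (cases "k = 0") (auto simp: local_poly_def local_slope_def)

context
  fixes a b :: real
  assumes ab: "a < b"
begin

lemma integral_centered:
  "(LINT t:{a..b}|lborel. t - (a + b) / 2) = 0"
  "(LINT t:{a..b}|lborel. (t - (a + b) / 2)^2) = (b - a)^3 / 12"
proof -
  define m where "m = (a + b) / 2"
  have "(LINT t:{a..b}|lborel. t - m) = (b - m)^2 / 2 - (a - m)^2 / 2"
    unfolding set_lebesgue_integral_def
    by (rule integral_FTC_atLeastAtMost[where F = "\<lambda>t. (t - m)^2 / 2"])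
       (use ab in \<open>auto intro!: derivative_eq_intros continuous_intros simp: has_real_derivative_iff_has_vector_derivative[symmetric]\<close>)
  also have "\<dots> = 0" by (simp add: m_def power2_eq_square field_simps)
  finally show "(LINT t:{a..b}|lborel. t - (a + b) / 2) = 0" by (simp add: m_def)
  have "(LINT t:{a..b}|lborel. (t - m)^2) = (b - m)^3 / 3 - (a - m)^3 / 3"
    unfolding set_lebesgue_integral_def
    by (rule integral_FTC_atLeastAtMost[where F = "\<lambda>t. (t - m)^3 / 3"])
       (use ab in \<open>auto intro!: derivative_eq_intros continuous_intros simp: has_real_derivative_iff_has_vector_derivative[symmetric]\<close>)
  also have "\<dots> = (b - a)^3 / 12" by (simp add: m_def power3_eq_cube field_simps)
  finally show "(LINT t:{a..b}|lborel. (t - (a + b) / 2)^2) = (b - a)^3 / 12" by (simp add: m_def)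
qed

lemma integral_centered_complex:
  "(LINT t:{a..b}|lborel. complex_of_real (t - (a + b) / 2)) = 0"
  "(LINT t:{a..b}|lborel. complex_of_real ((t - (a + b) / 2)^2)) = of_real ((b - a)^3 / 12)"
  using integral_centered by (simp_all only: set_integral_complex_of_real of_real_0)

lemma integral_const_complex: "(LINT t:{a..b}|lborel. c) = of_real (b - a) * (c::complex)"
  using ab by (simp add: set_lebesgue_integral_def scaleR_conv_of_real)

lemma continuous_integrable:
  "continuous_on {a..b} v \<Longrightarrow> set_integrable lborel {a..b} (v::real \<Rightarrow> complex)"
  by (rule borel_integrable_atLeastAtMost')

lemma local_diff:
  assumes v: "continuous_on {a..b} v" and w: "continuous_on {a..b} w"
  shows "local_mean a b (\<lambda>t. v t - w t) = local_mean a b v - local_mean a b w"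
    "local_slope k a b (\<lambda>t. v t - w t) = local_slope k a b v - local_slope k a b w"
proof -
  show "local_mean a b (\<lambda>t. v t - w t) = local_mean a b v - local_mean a b w"
    using set_integral_diff(2)[OF continuous_integrable[OF v] continuous_integrable[OF w]]
    by (simp add: local_mean_def right_diff_distrib)
  have "set_integrable lborel {a..b} (\<lambda>t. of_real (t - (a + b) / 2) * v t)"
    "set_integrable lborel {a..b} (\<lambda>t. of_real (t - (a + b) / 2) * w t)"
    using v w by (auto intro!: continuous_integrable continuous_intros)
  from set_integral_diff(2)[OF this]
  show "local_slope k a b (\<lambda>t. v t - w t) = local_slope k a b v - local_slope k a b w"
    by (simp add: local_slope_def right_diff_distrib)
qed

lemma local_affine:
  assumes "k = 0 \<Longrightarrow> D = 0"
  shows "local_mean a b (\<lambda>t. A + D * of_real (t - (a + b) / 2)) = A"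
    "local_slope k a b (\<lambda>t. A + D * of_real (t - (a + b) / 2)) = D"
proof -
  let ?m = "(a + b) / 2"
  have i: "set_integrable lborel {a..b} (\<lambda>t. D * of_real (t - ?m))"
    "set_integrable lborel {a..b} (\<lambda>t. A)"
    "set_integrable lborel {a..b} (\<lambda>t. A * of_real (t - ?m))"
    "set_integrable lborel {a..b} (\<lambda>t. D * of_real ((t - ?m)^2))"
    by (auto intro!: continuous_integrable continuous_intros)
  have "(LINT t:{a..b}|lborel. A + D * of_real (t - ?m)) = of_real (b - a) * A"
    unfolding set_integral_add(2)[OF i(2,1)] set_integral_mult_right integral_centered_complex integral_const_complex
    by simp
  then show "local_mean a b (\<lambda>t. A + D * of_real (t - ?m)) = A"
    using ab by (simp only: local_mean_def) (simp flip: of_real_mult of_real_diff mult.assoc)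
  have "(LINT t:{a..b}|lborel. of_real (t - ?m) * (A + D * of_real (t - ?m)))
      = (LINT t:{a..b}|lborel. A * of_real (t - ?m) + D * of_real ((t - ?m)^2))"
  proof -
    have "z * (A + D * z) = A * z + D * z^2" for z
      by (simp add: power2_eq_square algebra_simps)
    then show ?thesis by (simp only: of_real_power)
  qed
  also have "\<dots> = D * of_real ((b - a)^3 / 12)"
    unfolding set_integral_add(2)[OF i(3,4)] set_integral_mult_right integral_centered_complex by simp
  finally show "local_slope k a b (\<lambda>t. A + D * of_real (t - ?m)) = D"
  proof -
    assume e: "(LINT t:{a..b}|lborel. of_real (t - ?m) * (A + D * of_real (t - ?m))) = D * of_real ((b - a)^3 / 12)"
    have "complex_of_real (12 / (b - a)^3) * (D * of_real ((b - a)^3 / 12))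
        = D * of_real (12 / (b - a)^3 * ((b - a)^3 / 12))"
      by (simp only: of_real_mult mult.left_commute mult.assoc)
    also have "12 / (b - a)^3 * ((b - a)^3 / 12) = 1" using ab by simp
    finally have "complex_of_real (12 / (b - a)^3) * (D * of_real ((b - a)^3 / 12)) = D" by simp
    then show ?thesis
      unfolding local_slope_def e using assms by (cases "k = 0") (simp, simp only: if_False)
  qed
qed

text \<open>With l = b - a the mean is at most B, and the slope, at most 6 B / l, acts over a
  distance of at most l / 2; so 4 = 1 + 3. The constant is the same for every interval, hence
  uniform over meshes.\<close>

lemma local_bound:
  assumes v: "continuous_on {a..b} v" and B: "\<And>t. t \<in> {a..b} \<Longrightarrow> norm (v t) \<le> B" and t: "t \<in> {a..b}"
  shows "norm (poly (local_poly k a b v) (of_real t)) \<le> 4 * B"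
proof -
  define l where "l = b - a"
  have l: "l > 0" using ab by (simp add: l_def)
  have B0: "0 \<le> B" using B[OF t] norm_ge_zero order_trans by blast
  have c: "(LINT t:{a..b}|lborel. K) = l * K" for K :: real
    using ab by (simp add: set_integral_Icc_const l_def)
  have "norm (LINT t:{a..b}|lborel. v t) \<le> (LINT t:{a..b}|lborel. norm (v t))"
    by (rule set_integral_norm_bound[OF continuous_integrable[OF v]])
  also have "\<dots> \<le> (LINT t:{a..b}|lborel. B)"
    using B by (intro set_integral_mono set_integrable_norm continuous_integrable v set_integrable_const) auto
  finally have 1: "norm (LINT t:{a..b}|lborel. v t) \<le> l * B" by (simp add: c)
  have i: "set_integrable lborel {a..b} (\<lambda>t. of_real (t - (a + b) / 2) * v t)"
    using v by (auto intro!: continuous_integrable continuous_intros)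
  have mid: "\<bar>s - (a + b) / 2\<bar> \<le> l / 2" if "s \<in> {a..b}" for s
    using that by (auto simp: l_def abs_le_iff field_simps)
  have "norm (LINT t:{a..b}|lborel. of_real (t - (a + b) / 2) * v t)
      \<le> (LINT t:{a..b}|lborel. norm (of_real (t - (a + b) / 2) * v t))"
    by (rule set_integral_norm_bound[OF i])
  also have "\<dots> \<le> (LINT t:{a..b}|lborel. l / 2 * B)"
  proof (rule set_integral_mono)
    show "norm (complex_of_real (s - (a + b) / 2) * v s) \<le> l / 2 * B" if "s \<in> {a..b}" for s
      unfolding norm_mult norm_of_real using mid[OF that] B[OF that] l by (intro mult_mono) auto
  qed (intro set_integrable_norm i set_integrable_const)+
  finally have 2: "norm (LINT t:{a..b}|lborel. of_real (t - (a + b) / 2) * v t) \<le> l^2 / 2 * B"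
    by (simp add: c power2_eq_square)
  have m: "norm (local_mean a b v) \<le> B"
  proof -
    have "norm (local_mean a b v) = 1 / l * norm (LINT t:{a..b}|lborel. v t)"
      using l by (simp only: local_mean_def norm_mult norm_of_real l_def[symmetric]) simp
    also have "\<dots> \<le> 1 / l * (l * B)" using l by (intro mult_left_mono 1) auto
    finally show ?thesis using l by simp
  qed
  have s: "norm (local_slope k a b v) \<le> 6 / l * B"
  proof (cases "k = 0")
    case True then show ?thesis using l B0 by (simp add: local_slope_def)
  next
    case False
    have "norm (local_slope k a b v) = 12 / l^3 * norm (LINT t:{a..b}|lborel. of_real (t - (a + b) / 2) * v t)"
      using l False by (simp only: local_slope_def if_False norm_mult norm_of_real l_def[symmetric]) simp
    also have "\<dots> \<le> 12 / l^3 * (l^2 / 2 * B)" using l by (intro mult_left_mono 2) auto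
    also have "\<dots> = 6 / l * B" using l by (simp add: power2_eq_square power3_eq_cube)
    finally show ?thesis .
  qed
  have "norm (poly (local_poly k a b v) (of_real t)) \<le> norm (local_mean a b v) + norm (local_slope k a b v) * \<bar>t - (a + b) / 2\<bar>"
    unfolding poly_local_poly by (rule order_trans[OF norm_triangle_ineq]) (simp only: norm_mult norm_of_real order_refl)
  also have "\<dots> \<le> B + 6 / l * B * (l / 2)"
    using m s mid[OF t] l B0 by (intro add_mono mult_mono) auto
  finally show ?thesis using l by simp
qed

text \<open>The projection reproduces the affine comparison function, so the error of v is that of
  the difference, and 5 = 1 + 4 with the stability bound. Any local approximation thus bounds the
  projection error.\<close>

lemma local_approx:
  assumes v: "continuous_on {a..b} v" and k: "k = 0 \<Longrightarrow> D = 0"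
    and B: "\<And>t. t \<in> {a..b} \<Longrightarrow> norm (v t - (A + D * of_real (t - (a + b) / 2))) \<le> B" and t: "t \<in> {a..b}"
  shows "norm (v t - poly (local_poly k a b v) (of_real t)) \<le> 5 * B"
proof -
  define s where "s t = A + D * complex_of_real (t - (a + b) / 2)" for t
  have s: "continuous_on {a..b} s" unfolding s_def by (intro continuous_intros)
  have ps: "poly (local_poly k a b s) (of_real t) = s t"
    unfolding poly_local_poly s_def[abs_def] by (simp only: local_affine[of k D A, OF k])
  have "poly (local_poly k a b (\<lambda>t. v t - s t)) (of_real t)
      = poly (local_poly k a b v) (of_real t) - poly (local_poly k a b s) (of_real t)"
    unfolding poly_local_poly local_diff[OF v s] by (simp add: algebra_simps)
  then have "v t - poly (local_poly k a b v) (of_real t)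
      = (v t - s t) - poly (local_poly k a b (\<lambda>t. v t - s t)) (of_real t)"
    using ps by simp
  also have "norm \<dots> \<le> norm (v t - s t) + norm (poly (local_poly k a b (\<lambda>t. v t - s t)) (of_real t))"
    by (rule norm_triangle_ineq4)
  also have "\<dots> \<le> B + 4 * B"
  proof (rule add_mono)
    have B': "norm (v t - s t) \<le> B" if "t \<in> {a..b}" for t using B[OF that] by (simp only: s_def)
    show "norm (v t - s t) \<le> B" by (rule B'[OF t])
    show "norm (poly (local_poly k a b (\<lambda>t. v t - s t)) (of_real t)) \<le> 4 * B"
      by (rule local_bound[OF _ B' t]) (intro continuous_intros v s)
  qed
  finally show ?thesis by simp
qed

text \<open>By linearity and reproduction the error has zero mean and zero slope, and a test
  polynomial of degree at most k is a combination of 1 and, for k = 1, the centered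
  variable.\<close>

lemma local_orthogonal:
  assumes v: "continuous_on {a..b} v" and P: "degree P \<le> k" and k: "k \<le> 1"
  shows "(LINT t:{a..b}|lborel. (v t - poly (local_poly k a b v) (of_real t)) * cnj (poly P (of_real t))) = 0"
proof -
  let ?m = "(a + b) / 2"
  define e where "e t = v t - poly (local_poly k a b v) (of_real t)" for t
  have ce: "continuous_on {a..b} e" unfolding e_def using v by (intro continuous_intros) auto
  have cl: "continuous_on {a..b} (\<lambda>t. poly (local_poly k a b v) (complex_of_real t))"
    by (intro continuous_intros)
  define p q where "p = coeff P 0" and "q = coeff P 1"
  have Peq: "P = [:p, q:]"
    using P k by (intro poly_eqI) (auto simp: p_def q_def coeff_pCons split: nat.splits intro: coeff_eq_0)
  have q0: "q = 0" if "k = 0" using P that by (simp add: q_def coeff_eq_0)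
  have pp: "(\<lambda>t. poly (local_poly k a b v) (of_real t)) = (\<lambda>t. local_mean a b v + local_slope k a b v * of_real (t - ?m))"
    by (simp only: poly_local_poly)
  have k0: "local_slope k a b v = 0" if "k = 0" using that by (simp add: local_slope_def)
  have e_mean: "local_mean a b e = 0" and e_slope: "local_slope k a b e = 0"
    using local_diff[OF v cl] local_affine[of k "local_slope k a b v" "local_mean a b v", OF k0]
    unfolding e_def pp by auto
  have m0: "(LINT t:{a..b}|lborel. e t) = 0"
    using e_mean ab by (simp add: local_mean_def)
  have m1: "k \<noteq> 0 \<Longrightarrow> (LINT t:{a..b}|lborel. of_real (t - ?m) * e t) = 0"
    using e_slope ab by (simp add: local_slope_def)
  have i: "set_integrable lborel {a..b} (\<lambda>t. cnj (p + q * of_real ?m) * e t)"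
    "set_integrable lborel {a..b} (\<lambda>t. cnj q * (of_real (t - ?m) * e t))"
    using ce by (auto intro!: continuous_integrable continuous_intros)
  have "(LINT t:{a..b}|lborel. e t * cnj (poly P (of_real t)))
      = (LINT t:{a..b}|lborel. cnj (p + q * of_real ?m) * e t + cnj q * (of_real (t - ?m) * e t))"
    by (rule set_lebesgue_integral_cong) (auto simp: Peq algebra_simps)
  also have "\<dots> = 0"
    unfolding set_integral_add(2)[OF i] set_integral_mult_right m0 using m1 q0 by (cases "k = 0") auto
  finally show ?thesis by (simp add: e_def)
qed

end

subsection \<open>Piecewise polynomials on a mesh\<close>

text \<open>The last cell is closed, so that the cells cover \<open>[0,1]\<close>.\<close>

definition cell :: "real list \<Rightarrow> nat \<Rightarrow> real set" where
  "cell xs i = {xs ! i ..< xs ! Suc i} \<union> (if Suc (Suc i) = length xs then {xs ! Suc i} else {})"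

definition pw :: "real list \<Rightarrow> (nat \<Rightarrow> complex poly) \<Rightarrow> real \<Rightarrow> complex" where
  "pw xs P t = (\<Sum>i<length xs - 1. indicat_real (cell xs i) t *\<^sub>R poly (P i) (of_real t))"

definition pwpoly :: "nat \<Rightarrow> real list \<Rightarrow> (real \<Rightarrow> complex) set" where
  "pwpoly k xs = {pw xs P | P. \<forall>i. degree (P i) \<le> k}"

definition proj :: "nat \<Rightarrow> real list \<Rightarrow> (real \<Rightarrow> complex) \<Rightarrow> real \<Rightarrow> complex" where
  "proj k xs v = pw xs (\<lambda>i. local_poly k (xs ! i) (xs ! Suc i) v)"

locale mesh =
  fixes xs :: "real list"
  assumes mesh: "is_mesh xs"
begin

definition n :: nat where "n = length xs - 1"

lemma len: "length xs = Suc n" and n_pos: "0 < n"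
  using mesh by (auto simp: is_mesh_def n_def)

lemma first: "xs ! 0 = 0" and last: "xs ! n = 1"
proof -
  have "xs \<noteq> []" using len by auto
  then show "xs ! 0 = 0" "xs ! n = 1"
    using mesh len hd_conv_nth[of xs] last_conv_nth[of xs] by (auto simp: is_mesh_def)
qed

lemma less: "i < j \<Longrightarrow> j \<le> n \<Longrightarrow> xs ! i < xs ! j"
  using mesh len by (auto simp: is_mesh_def sorted_wrt_iff_nth_less)

lemma le: "i \<le> j \<Longrightarrow> j \<le> n \<Longrightarrow> xs ! i \<le> xs ! j"
  using less[of i j] by (cases "i = j") auto

lemma node_bounds: "i \<le> n \<Longrightarrow> 0 \<le> xs ! i \<and> xs ! i \<le> 1"
  using le[of 0 i] le[of i n] first last by auto

lemma cell_subset: "i < n \<Longrightarrow> cell xs i \<subseteq> {xs ! i..xs ! Suc i}"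
  using less[of i "Suc i"] by (auto simp: cell_def)

lemma cell_meas [measurable]: "cell xs i \<in> sets borel"
  by (auto simp: cell_def)

lemma cell_exists:
  assumes "t \<in> {0..1}"
  obtains i where "i < n" "t \<in> cell xs i"
proof (cases "t = 1")
  case True
  have "1 \<in> cell xs (n - 1)"
    using n_pos last len by (auto simp: cell_def)
  with True show ?thesis using n_pos by (intro that[of "n - 1"]) auto
next
  case False
  define S where "S = {i. i < n \<and> xs ! i \<le> t}"
  have S: "finite S" "0 \<in> S" using assms first n_pos by (auto simp: S_def)
  define i where "i = Max S"
  have iS: "i \<in> S" unfolding i_def using S by (intro Max_in) auto
  have "t < xs ! Suc i"
  proof (rule ccontr)
    assume "\<not> t < xs ! Suc i"
    then have le: "xs ! Suc i \<le> t" by simp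
    show False
    proof (cases "Suc i = n")
      case True
      then show False using le last False assms by auto
    next
      case neq: False
      then have "Suc i \<in> S" using iS le by (auto simp: S_def)
      then have "Suc i \<le> i" unfolding i_def using S by (intro Max_ge) auto
      then show False by simp
    qed
  qed
  then show ?thesis using iS by (intro that[of i]) (auto simp: S_def cell_def)
qed

lemma cell_disjoint:
  assumes "i < n" "j < n" "t \<in> cell xs i" "t \<in> cell xs j"
  shows "i = j"
proof (rule ccontr)
  have *: False if "i < j" "i < n" "j < n" "t \<in> cell xs i" "t \<in> cell xs j" for i j
  proof -
    have "t < xs ! Suc i"
      using that len by (auto simp: cell_def split: if_splits)
    moreover have "xs ! Suc i \<le> xs ! j" using le[of "Suc i" j] that by auto
    moreover have "xs ! j \<le> t" using cell_subset[of j] that by auto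
    ultimately show False by simp
  qed
  assume "i \<noteq> j"
  then show False using *[of i j] *[of j i] assms by (cases "i < j") auto
qed

lemma pw_cell:
  assumes "i < n" "t \<in> cell xs i"
  shows "pw xs P t = poly (P i) (of_real t)"
proof -
  have "indicat_real (cell xs j) t *\<^sub>R poly (P j) (of_real t) = (if j = i then poly (P i) (of_real t) else 0)"
    if "j < n" for j
    using cell_disjoint[OF that assms(1) _ assms(2)] assms(2) by (cases "j = i") (auto simp: indicator_def)
  then have "pw xs P t = (\<Sum>j<n. if j = i then poly (P i) (of_real t) else 0)"
    unfolding pw_def n_def[symmetric] by (intro sum.cong) auto
  then show ?thesis using assms(1) by simp
qed

lemma pw_meas: "meas (pw xs P)"
proof -
  have [measurable]: "(\<lambda>t. poly Q (complex_of_real t)) \<in> borel_measurable borel" for Q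
    by (intro borel_measurable_continuous_onI continuous_intros)
  have "pw xs P \<in> borel_measurable lborel"
    unfolding pw_def[abs_def] by measurable
  then show ?thesis unfolding set_borel_measurable_def by simp
qed

lemma pw_bounded:
  "\<exists>M\<ge>0. \<forall>t\<in>{0..1}. norm (pw xs P t) \<le> M"
proof -
  have "\<exists>M\<ge>0. \<forall>t\<in>{0..1}. norm (poly (P i) (complex_of_real t)) \<le> M" for i
    using continuous_unit_bounded[of "\<lambda>t. poly (P i) (complex_of_real t)"]
    by (metis continuous_on_poly continuous_on_of_real_id)
  then obtain M where M: "\<And>i. M i \<ge> 0" "\<And>i t. t \<in> {0..1} \<Longrightarrow> norm (poly (P i) (complex_of_real t)) \<le> M i"
    by metis
  have "norm (pw xs P t) \<le> (\<Sum>i<n. M i)" if t: "t \<in> {0..1}" for t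
  proof -
    obtain i where i: "i < n" "t \<in> cell xs i" using cell_exists[OF t] .
    then have "norm (pw xs P t) \<le> M i" using M(2)[OF t] by (simp add: pw_cell)
    also have "\<dots> \<le> (\<Sum>i<n. M i)" using i M(1) by (intro member_le_sum) auto
    finally show ?thesis .
  qed
  then show ?thesis using M(1) by (intro exI[of _ "\<Sum>i<n. M i"]) (auto intro: sum_nonneg)
qed

lemma pw_L2: "L2 (pw xs P)"
  using pw_bounded pw_meas by (metis L2_bounded)

lemma pw_diff: "pw xs P t - pw xs Q t = pw xs (\<lambda>i. P i - Q i) t"
  by (simp only: pw_def sum_subtractf[symmetric] scaleR_diff_right[symmetric] poly_diff)

lemma pw_const: "t \<in> {0..1} \<Longrightarrow> pw xs (\<lambda>_. [:c:]) t = c"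
  by (erule cell_exists) (simp add: pw_cell)

text \<open>A cell and its closed element differ at most in the right node, a null set, so formulas
  valid on cells may be integrated over closed elements.\<close>

lemma element_integral_cong:
  fixes f g :: "real \<Rightarrow> complex"
  assumes i: "i < n" and eq: "\<And>t. t \<in> cell xs i \<Longrightarrow> f t = g t" and fg: "meas f" "meas g"
    and ab: "xs ! i \<le> a" "b \<le> xs ! Suc i"
  shows "(LINT t:{a..b}|lborel. f t) = (LINT t:{a..b}|lborel. g t)"
  unfolding set_lebesgue_integral_def
proof (rule integral_cong_AE)
  have sub: "{a..b} \<subseteq> {0..1}" using node_bounds[of i] node_bounds[of "Suc i"] i ab by auto
  have "set_borel_measurable lborel {a..b} f" "set_borel_measurable lborel {a..b} g"
    using fg sub by (auto intro: set_borel_measurable_subset)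
  then show "(\<lambda>x. indicat_real {a..b} x *\<^sub>R f x) \<in> borel_measurable lborel"
    "(\<lambda>x. indicat_real {a..b} x *\<^sub>R g x) \<in> borel_measurable lborel"
    by (auto simp: set_borel_measurable_def)
  have "indicat_real {a..b} t *\<^sub>R f t = indicat_real {a..b} t *\<^sub>R g t" if "t \<noteq> xs ! Suc i" for t
    using that eq[of t] ab by (auto simp: indicator_def cell_def)
  with AE_lborel_singleton[of "xs ! Suc i"]
  show "AE t in lborel. indicat_real {a..b} t *\<^sub>R f t = indicat_real {a..b} t *\<^sub>R g t"
    by (rule eventually_mono)
qed

lemma primitive_node_zero:
  assumes F: "intg F" and 0: "\<And>i. i < n \<Longrightarrow> (LINT t:{xs ! i..xs ! Suc i}|lborel. F t) = 0"
  shows "j \<le> n \<Longrightarrow> primitive F (xs ! j) = 0"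
proof (induction j)
  case 0 then show ?case by (simp add: first primitive_0)
next
  case (Suc j)
  then show ?case
    using primitive_diff[OF F, of "xs ! j" "xs ! Suc j"] node_bounds[of j] node_bounds[of "Suc j"]
      le[of j "Suc j"] 0[of j] by auto
qed

lemma integral_zero_elements:
  assumes F: "intg F" and 0: "\<And>i. i < n \<Longrightarrow> (LINT t:{xs ! i..xs ! Suc i}|lborel. F t) = 0"
  shows "(LINT t:{0..1}|lborel. F t) = 0"
  using primitive_node_zero[OF assms, of n] by (simp add: last primitive_def)

lemma element_length: "i < n \<Longrightarrow> xs ! Suc i - xs ! i \<le> meshsize xs"
proof -
  assume i: "i < n"
  have "{xs ! Suc i - xs ! i | i. Suc i < length xs} = (\<lambda>i. xs ! Suc i - xs ! i) ` {..<n}"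
    by (auto simp: len)
  then show ?thesis unfolding meshsize_def using i by (intro Max_ge) (auto simp: len)
qed

lemma meshsize_pos: "0 < meshsize xs"
  using element_length[of 0] less[of 0 1] n_pos by auto

lemma proj_pwpoly: "proj k xs v \<in> pwpoly k xs"
  unfolding proj_def pwpoly_def using degree_local_poly by blast

lemma continuous_on_element:
  "continuous_on {0..1} v \<Longrightarrow> i < n \<Longrightarrow> continuous_on {xs ! i..xs ! Suc i} v"
  using node_bounds[of i] node_bounds[of "Suc i"] by (auto intro: continuous_on_subset)

lemma proj_element_orthogonal:
  assumes v: "continuous_on {0..1} v" and P: "\<And>i. degree (P i) \<le> k" and k: "k \<le> 1" and i: "i < n"
  shows "(LINT t:{xs ! i..xs ! Suc i}|lborel. (v t - proj k xs v t) * cnj (pw xs P t)) = 0"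
proof -
  have "(LINT t:{xs ! i..xs ! Suc i}|lborel. (v t - proj k xs v t) * cnj (pw xs P t))
    = (LINT t:{xs ! i..xs ! Suc i}|lborel. (v t - poly (local_poly k (xs ! i) (xs ! Suc i) v) (of_real t)) * cnj (poly (P i) (of_real t)))"
  proof (rule element_integral_cong[OF i])
    show "meas (\<lambda>t. (v t - proj k xs v t) * cnj (pw xs P t))"
      unfolding proj_def by (intro meas_mult meas_minus meas_cnj pw_meas continuous_meas v)
    show "meas (\<lambda>t. (v t - poly (local_poly k (xs ! i) (xs ! Suc i) v) (of_real t)) * cnj (poly (P i) (of_real t)))"
      by (intro continuous_meas continuous_intros v)
  qed (auto simp: proj_def pw_cell[OF i])
  also have "\<dots> = 0"
    by (rule local_orthogonal) (use less[of i "Suc i"] continuous_on_element[OF v i] P k i in auto)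
  finally show ?thesis .
qed

lemma proj_orthogonal:
  assumes v: "continuous_on {0..1} v" and s: "s \<in> pwpoly k xs" and k: "k \<le> 1"
  shows "ip (\<lambda>t. v t - proj k xs v t) s = 0"
proof -
  obtain P where P: "s = pw xs P" "\<And>i. degree (P i) \<le> k" using s by (auto simp: pwpoly_def)
  obtain M where M: "M \<ge> 0" "\<forall>t\<in>{0..1}. norm (s t) \<le> M" using pw_bounded P(1) by blast
  have "sqrt_growth (\<lambda>t. (v t - proj k xs v t) * cnj (s t)) (l2norm (\<lambda>t. v t - proj k xs v t) * M)"
    using M P(1) pw_meas unfolding proj_def
    by (intro sqrt_growth_mult L2_sqrt_growth L2_minus L2_continuous v pw_L2 meas_cnj) auto
  then show ?thesis
    unfolding ip_def P(1)
    using proj_element_orthogonal[OF v P(2) k] by (intro integral_zero_elements) (auto dest: sqrt_growth_intg)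
qed

lemma proj_error:
  assumes v: "continuous_on {0..1} v" and k: "k \<le> 1"
    and B: "\<And>i. i < n \<Longrightarrow> \<exists>A D. (k = 0 \<longrightarrow> D = 0) \<and>
      (\<forall>t\<in>{xs ! i..xs ! Suc i}. norm (v t - (A + D * of_real (t - (xs ! i + xs ! Suc i) / 2))) \<le> B)"
  shows "\<And>t. t \<in> {0..1} \<Longrightarrow> norm (v t - proj k xs v t) \<le> 5 * B"
    "\<And>t. t \<in> {0..1} \<Longrightarrow> norm (primitive (\<lambda>t. v t - proj k xs v t) t) \<le> meshsize xs * (5 * B)"
proof -
  show bd: "norm (v t - proj k xs v t) \<le> 5 * B" if t: "t \<in> {0..1}" for t
  proof -
    obtain i where i: "i < n" "t \<in> cell xs i" using cell_exists[OF t] .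
    obtain A D where AD: "k = 0 \<longrightarrow> D = 0"
      "\<forall>t\<in>{xs ! i..xs ! Suc i}. norm (v t - (A + D * of_real (t - (xs ! i + xs ! Suc i) / 2))) \<le> B"
      using B[OF i(1)] by blast
    have "norm (v t - poly (local_poly k (xs ! i) (xs ! Suc i) v) (of_real t)) \<le> 5 * B"
      by (rule local_approx[where A = A and D = D])
         (use less[of i "Suc i"] continuous_on_element[OF v i(1)] AD i cell_subset[OF i(1)] in auto)
    then show ?thesis by (simp add: proj_def pw_cell[OF i])
  qed
  fix t :: real assume t: "t \<in> {0..1}"
  let ?d = "\<lambda>t. v t - proj k xs v t"
  have L: "L2 ?d" unfolding proj_def by (intro L2_minus L2_continuous v pw_L2)
  have z: "(LINT t:{xs ! i..xs ! Suc i}|lborel. ?d t) = 0" if i: "i < n" for i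
  proof -
    have "(LINT t:{xs ! i..xs ! Suc i}|lborel. ?d t) = (LINT t:{xs ! i..xs ! Suc i}|lborel. ?d t * cnj (pw xs (\<lambda>_. [:1:]) t))"
      by (rule set_lebesgue_integral_cong) (use node_bounds[of i] node_bounds[of "Suc i"] i in \<open>auto simp: pw_const\<close>)
    also have "\<dots> = 0" by (rule proj_element_orthogonal[OF v _ k i]) simp
    finally show ?thesis .
  qed
  obtain i where i: "i < n" "t \<in> cell xs i" using cell_exists[OF t] .
  have ti: "xs ! i \<le> t" "t \<le> xs ! Suc i" using cell_subset[OF i(1)] i(2) by auto
  have nb: "0 \<le> xs ! i" "t \<le> 1" using node_bounds[of i] i t by auto
  \<comment> \<open>The primitive vanishes at the node to the left of t, which leaves an integral
    over part of a single element.\<close>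
  have "primitive ?d t = primitive ?d t - primitive ?d (xs ! i)"
    using primitive_node_zero[OF L2_intg[OF L] z, of i] i by simp
  also have "\<dots> = (LINT s:{xs ! i..t}|lborel. ?d s)"
    using primitive_diff[OF L2_intg[OF L]] nb ti by blast
  also have "norm \<dots> \<le> (LINT s:{xs ! i..t}|lborel. norm (?d s))"
    by (rule set_integral_norm_bound[OF set_integrable_Icc_subset[OF L2_intg[OF L] nb]])
  also have "\<dots> \<le> (LINT s:{xs ! i..t}|lborel. 5 * B)"
    using nb bd by (intro set_integral_mono intg_norm_subinterval L2_intg L set_integrable_const) auto
  also have "\<dots> = (t - xs ! i) * (5 * B)" using ti by (simp add: set_integral_Icc_const)
  also have "\<dots> \<le> meshsize xs * (5 * B)"
    using element_length[OF i(1)] ti order_trans[OF norm_ge_zero bd[OF t]] by (intro mult_right_mono) auto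
  finally show "norm (primitive ?d t) \<le> meshsize xs * (5 * B)" .
qed

text \<open>The comparison function is the value at the left node, a constant and thus available for
  both degrees.\<close>

lemma proj_error_primitive:
  assumes F: "sqrt_growth F N" and k: "k \<le> 1"
  defines "d \<equiv> \<lambda>t. primitive F t - proj k xs (primitive F) t"
  shows "\<And>t. t \<in> {0..1} \<Longrightarrow> norm (d t) \<le> 5 * (N * sqrt (meshsize xs))"
    "\<And>t. t \<in> {0..1} \<Longrightarrow> norm (primitive d t) \<le> meshsize xs * (5 * (N * sqrt (meshsize xs)))"
proof -
  have B: "\<exists>A D. (k = 0 \<longrightarrow> D = 0) \<and> (\<forall>t\<in>{xs ! i..xs ! Suc i}.
      norm (primitive F t - (A + D * of_real (t - (xs ! i + xs ! Suc i) / 2))) \<le> N * sqrt (meshsize xs))"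
    if i: "i < n" for i
  proof -
    have "norm (primitive F t - primitive F (xs ! i)) \<le> N * sqrt (meshsize xs)"
      if t: "t \<in> {xs ! i..xs ! Suc i}" for t
    proof -
      have "norm (primitive F t - primitive F (xs ! i)) \<le> N * sqrt (t - xs ! i)"
        using sqrt_growth_primitive[OF F, of "xs ! i" t] t node_bounds[of i] node_bounds[of "Suc i"] i by auto
      also have "\<dots> \<le> N * sqrt (meshsize xs)"
        using element_length[OF i] t sqrt_growth_nonneg[OF F] by (intro mult_left_mono) auto
      finally show ?thesis .
    qed
    then show ?thesis
      by (intro exI[of _ "primitive F (xs ! i)"] exI[of _ 0]) auto
  qed
  note err = proj_error[OF continuous_on_primitive[OF F] k B]
  show "norm (d t) \<le> 5 * (N * sqrt (meshsize xs))" if "t \<in> {0..1}" for t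
    unfolding d_def by (rule err(1)[OF _ that])
  show "norm (primitive d t) \<le> meshsize xs * (5 * (N * sqrt (meshsize xs)))" if "t \<in> {0..1}" for t
    unfolding d_def by (rule err(2)[OF _ that])
qed

text \<open>The comparison function is the first order Taylor polynomial at the left node, with the
  value of the continuous representative \<open>G\<close> as slope. Its remainder is the integral of
  G s - G a over at most one element, which gains a full factor h.\<close>

lemma proj_error_primitive_hoelder:
  assumes F: "sqrt_growth F N'" and FG: "aeq F G" and G: "continuous_on {0..1} G"
    and hold: "\<And>x y. 0 \<le> x \<Longrightarrow> x \<le> y \<Longrightarrow> y \<le> 1 \<Longrightarrow> norm (G y - G x) \<le> N * sqrt (y - x)"
  defines "d \<equiv> \<lambda>t. primitive F t - proj 1 xs (primitive F) t"
  shows "\<And>t. t \<in> {0..1} \<Longrightarrow> norm (d t) \<le> 5 * (N * (meshsize xs * sqrt (meshsize xs)))"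
    "\<And>t. t \<in> {0..1} \<Longrightarrow> norm (primitive d t) \<le> meshsize xs * (5 * (N * (meshsize xs * sqrt (meshsize xs))))"
proof -
  have "norm (G 1 - G 0) \<le> N" using hold[of 0 1] by simp
  then have N: "0 \<le> N" by (rule order_trans[OF norm_ge_zero])
  have iG: "intg G" by (intro L2_intg L2_continuous G)
  have B: "\<exists>A D. ((1::nat) = 0 \<longrightarrow> D = 0) \<and> (\<forall>t\<in>{xs ! i..xs ! Suc i}.
      norm (primitive F t - (A + D * of_real (t - (xs ! i + xs ! Suc i) / 2))) \<le> N * (meshsize xs * sqrt (meshsize xs)))"
    if i: "i < n" for i
  proof -
    define a where "a = xs ! i"
    have a: "0 \<le> a" "xs ! Suc i \<le> 1" using node_bounds[of i] node_bounds[of "Suc i"] i by (auto simp: a_def)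
    define h where "h = meshsize xs"
    have *: "norm (primitive F t - (primitive F a + G a * of_real (t - a))) \<le> N * (h * sqrt h)"
      if t: "t \<in> {a..xs ! Suc i}" for t
    proof -
      have th: "t - a \<le> h" "0 \<le> t - a" "t \<le> 1" using t element_length[OF i] a by (auto simp: h_def a_def)
      have "primitive F t - primitive F a = primitive G t - primitive G a"
        using primitive_aeq[OF FG set_integrable_imp_meas[OF sqrt_growth_intg[OF F]] set_integrable_imp_meas[OF iG]] th a
        by simp
      also have "\<dots> = (LINT s:{a..t}|lborel. G s)" using primitive_diff[OF iG, of a t] th a by auto
      finally have "primitive F t - (primitive F a + G a * of_real (t - a)) = (LINT s:{a..t}|lborel. G s) - (LINT s:{a..t}|lborel. G a)"
        using th by (simp add: set_lebesgue_integral_def scaleR_conv_of_real algebra_simps)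
      also have "\<dots> = (LINT s:{a..t}|lborel. G s - G a)"
        using th a iG by (intro set_integral_diff(2)[symmetric] set_integrable_const) (auto intro: set_integrable_Icc_subset)
      also have "norm \<dots> \<le> (LINT s:{a..t}|lborel. norm (G s - G a))"
        using th a iG by (intro set_integral_norm_bound set_integral_diff(1) set_integrable_const) (auto intro: set_integrable_Icc_subset)
      also have "\<dots> \<le> (LINT s:{a..t}|lborel. N * sqrt h)"
      proof (rule set_integral_mono)
        show "set_integrable lborel {a..t} (\<lambda>s. norm (G s - G a))"
          using th a iG by (intro set_integrable_norm set_integral_diff(1) set_integrable_const) (auto intro: set_integrable_Icc_subset)
        fix s assume s: "s \<in> {a..t}"
        have "norm (G s - G a) \<le> N * sqrt (s - a)" using hold[of a s] s th a by auto
        also have "\<dots> \<le> N * sqrt h" using N s th by (intro mult_left_mono) auto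
        finally show "norm (G s - G a) \<le> N * sqrt h" .
      qed (rule set_integrable_const)
      also have "\<dots> = (t - a) * (N * sqrt h)" using th by (simp add: set_integral_Icc_const)
      also have "\<dots> \<le> h * (N * sqrt h)" using N th by (intro mult_right_mono) auto
      finally show ?thesis by (simp add: algebra_simps)
    qed
    show ?thesis
    proof (intro exI conjI ballI)
      fix t assume t: "t \<in> {xs ! i..xs ! Suc i}"
      \<comment> \<open>The Taylor polynomial is recentered from the left node to the midpoint, the
        form that \<open>proj_error\<close> expects.\<close>
      have eq: "primitive F a + G a * of_real (t - a) = primitive F a + G a * of_real (m - a) + G a * of_real (t - m)" for m
        by (simp add: algebra_simps)
      show "norm (primitive F t - (primitive F a + G a * of_real ((xs ! i + xs ! Suc i) / 2 - a)
          + G a * of_real (t - (xs ! i + xs ! Suc i) / 2))) \<le> N * (meshsize xs * sqrt (meshsize xs))"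
        unfolding eq[symmetric] h_def[symmetric] by (rule *) (use t in \<open>simp add: a_def\<close>)
    qed simp
  qed
  note err = proj_error[OF continuous_on_primitive[OF F] order_refl B]
  show "norm (d t) \<le> 5 * (N * (meshsize xs * sqrt (meshsize xs)))" if "t \<in> {0..1}" for t
    unfolding d_def by (rule err(1)[OF _ that])
  show "norm (primitive d t) \<le> meshsize xs * (5 * (N * (meshsize xs * sqrt (meshsize xs))))" if "t \<in> {0..1}" for t
    unfolding d_def by (rule err(2)[OF _ that])
qed

end

section \<open>Linearity and uniform boundedness of the piecewise projection\<close>

lemma proj_cong:
  assumes "is_mesh xs" "\<And>t. t \<in> {0..1} \<Longrightarrow> v t = w t"
  shows "proj k xs v t = proj k xs w t"
proof -
  interpret mesh xs by unfold_locales fact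
  have "local_poly k (xs ! i) (xs ! Suc i) v = local_poly k (xs ! i) (xs ! Suc i) w" if i: "i < n" for i
  proof -
    have eq: "v s = w s" if "s \<in> {xs ! i..xs ! Suc i}" for s
      using that node_bounds[of i] node_bounds[of "Suc i"] i assms(2) by auto
    have "(LINT t:{xs ! i..xs ! Suc i}|lborel. v t) = (LINT t:{xs ! i..xs ! Suc i}|lborel. w t)"
      by (rule set_lebesgue_integral_cong) (use eq in auto)
    moreover have "(LINT t:{xs ! i..xs ! Suc i}|lborel. of_real (t - (xs ! i + xs ! Suc i) / 2) * v t)
       = (LINT t:{xs ! i..xs ! Suc i}|lborel. of_real (t - (xs ! i + xs ! Suc i) / 2) * w t)"
      by (rule set_lebesgue_integral_cong) (use eq in auto)
    ultimately show ?thesis by (simp only: local_poly_def local_mean_def local_slope_def)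
  qed
  then show ?thesis unfolding proj_def pw_def n_def[symmetric] by (intro sum.cong) auto
qed

lemma local_poly_diff:
  assumes "a < b" "continuous_on {a..b} v" "continuous_on {a..b} w"
  shows "local_poly k a b (\<lambda>t. v t - w t) = local_poly k a b v - local_poly k a b w"
  unfolding local_poly_def local_diff[OF assms] by (simp add: algebra_simps)

lemma local_poly_cmult: "local_poly k a b (\<lambda>t. c * v t) = smult c (local_poly k a b v)"
proof -
  have "(LINT t:{a..b}|lborel. of_real (t - (a + b) / 2) * (c * v t))
     = c * (LINT t:{a..b}|lborel. of_real (t - (a + b) / 2) * v t)"
    by (simp only: mult.left_commute[of _ c] set_integral_mult_right)
  then have "local_mean a b (\<lambda>t. c * v t) = c * local_mean a b v"
    "local_slope k a b (\<lambda>t. c * v t) = c * local_slope k a b v"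
    unfolding local_mean_def local_slope_def set_integral_mult_right by (auto simp only: mult.left_commute[of _ c] mult_zero_right if_True if_False split: if_split)
  then show ?thesis by (simp add: local_poly_def algebra_simps)
qed

context mesh
begin

lemma proj_diff:
  assumes "continuous_on {0..1} v" "continuous_on {0..1} w"
  shows "proj k xs (\<lambda>t. v t - w t) t = proj k xs v t - proj k xs w t"
proof -
  have "local_poly k (xs ! i) (xs ! Suc i) (\<lambda>t. v t - w t) =
      local_poly k (xs ! i) (xs ! Suc i) v - local_poly k (xs ! i) (xs ! Suc i) w" if "i < n" for i
    using that less[of i "Suc i"] by (intro local_poly_diff continuous_on_element assms) auto
  then have "proj k xs (\<lambda>t. v t - w t) t
      = pw xs (\<lambda>i. local_poly k (xs ! i) (xs ! Suc i) v - local_poly k (xs ! i) (xs ! Suc i) w) t"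
    unfolding proj_def pw_def n_def[symmetric] by (intro sum.cong) auto
  then show ?thesis unfolding proj_def pw_diff .
qed

lemma proj_cmult: "proj k xs (\<lambda>t. c * v t) t = c * proj k xs v t"
  unfolding proj_def local_poly_cmult pw_def sum_distrib_left
  by (intro sum.cong) (auto simp: scaleR_conv_of_real)

lemma proj_bound:
  assumes v: "continuous_on {0..1} v" and B: "\<And>t. t \<in> {0..1} \<Longrightarrow> norm (v t) \<le> B" and t: "t \<in> {0..1}"
  shows "norm (proj k xs v t) \<le> 6 * B"
proof -
  obtain i where i: "i < n" "t \<in> cell xs i" using cell_exists[OF t] .
  have "norm (poly (local_poly k (xs ! i) (xs ! Suc i) v) (of_real t)) \<le> 4 * B"
    by (rule local_bound) (use less[of i "Suc i"] i continuous_on_element[OF v] B cell_subset[OF i(1)]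
      node_bounds[of i] node_bounds[of "Suc i"] in auto)
  moreover have "0 \<le> B" by (rule order_trans[OF norm_ge_zero B[OF t]])
  ultimately show ?thesis by (simp add: proj_def pw_cell[OF i])
qed

lemma proj_meas: "meas (proj k xs v)"
  unfolding proj_def by (rule pw_meas)

end

section \<open>Finite element functions as primitives of piecewise polynomials\<close>

lemma integral_poly_pderiv:
  fixes P :: "complex poly"
  assumes "a \<le> b"
  shows "(LINT t:{a..b}|lborel. poly (pderiv P) (of_real t)) = poly P (of_real b) - poly P (of_real a)"
  unfolding set_lebesgue_integral_def
  by (rule integral_FTC_atLeastAtMost[OF assms])
     (auto intro!: has_vector_derivative_real_field poly_DERIV continuous_intros)

lemma Vspace_L2: "w \<in> Vspace \<Longrightarrow> L2 w"
  by (simp add: Vspace_def H01_def)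

context mesh
begin

text \<open>The derivatives of the polynomial pieces assemble to a piecewise polynomial. Continuity
  of v at the nodes makes the element-wise fundamental theorem add up to v being its
  primitive.\<close>

lemma Vh_derivative:
  assumes v: "v \<in> Vh k xs"
  obtains s where "s \<in> pwpoly k xs" "v \<in> Vspace" "aeq (wd v) s"
proof -
  have "\<forall>i. \<exists>P :: complex poly. i < n \<longrightarrow> degree P \<le> k + 1 \<and> (\<forall>x\<in>{xs ! i .. xs ! Suc i}. v x = poly P (of_real x))"
    using v len by (auto simp: Vh_def)
  then obtain P :: "nat \<Rightarrow> complex poly" where
    P: "\<And>i. i < n \<Longrightarrow> degree (P i) \<le> k + 1" "\<And>i x. i < n \<Longrightarrow> x \<in> {xs ! i .. xs ! Suc i} \<Longrightarrow> v x = poly (P i) (of_real x)"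
    by metis
  \<comment> \<open>\<open>pwpoly\<close> bounds the degree at every index; beyond the mesh, where P
    is arbitrary, the zero polynomial takes its place.\<close>
  define S where "S i = (if i < n then pderiv (P i) else 0)" for i
  have deg: "degree (S i) \<le> k" for i using P(1)[of i] by (auto simp: S_def degree_pderiv)
  define s where "s = pw xs S"
  have sL: "L2 s" unfolding s_def by (rule pw_L2)
  have step: "primitive s x - primitive s (xs ! i) = v x - v (xs ! i)"
    if i: "i < n" and x: "x \<in> {xs ! i..xs ! Suc i}" for i x
  proof -
    have nb: "0 \<le> xs ! i" "x \<le> 1" "xs ! i \<le> x"
      using x node_bounds[of i] node_bounds[of "Suc i"] i by auto
    have "primitive s x - primitive s (xs ! i) = (LINT t:{xs ! i..x}|lborel. s t)"
      using nb by (intro primitive_diff L2_intg sL) auto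
    also have "\<dots> = (LINT t:{xs ! i..x}|lborel. poly (pderiv (P i)) (of_real t))"
      by (rule element_integral_cong[OF i])
         (use i x pw_cell[OF i] in \<open>auto simp: s_def S_def intro!: pw_meas continuous_meas continuous_intros\<close>)
    also have "\<dots> = v x - v (xs ! i)"
      using integral_poly_pderiv[OF nb(3), of "P i"] P(2)[OF i x] P(2)[OF i, of "xs ! i"] x by simp
    finally show ?thesis .
  qed
  have node: "primitive s (xs ! j) = v (xs ! j)" if "j \<le> n" for j
    using that
  proof (induction j)
    case 0 then show ?case using v by (simp add: first primitive_0 Vh_def)
  next
    case (Suc j)
    then show ?case using step[of j "xs ! Suc j"] le[of j "Suc j"] by auto
  qed
  have eq: "v x = primitive s x" if x: "x \<in> {0..1}" for x
  proof -
    obtain i where i: "i < n" "x \<in> cell xs i" using cell_exists[OF x] .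
    then show ?thesis using step[of i x] node[of i] cell_subset[of i] by auto
  qed
  have "primitive s 1 = 0" using eq[of 1] v by (simp add: Vh_def)
  moreover have "L2 v" using v by (auto simp: Vh_def intro: L2_continuous)
  ultimately have "v \<in> Vspace" "aeq (wd v) s" using VspaceI[OF sL] eq by auto
  moreover have "s \<in> pwpoly k xs" using deg by (auto simp: pwpoly_def s_def)
  ultimately show ?thesis using that by blast
qed

text \<open>Every piece has an explicit antiderivative, adjusted by a constant to match at the left
  node. With \<open>Vh_derivative\<close> this identifies the derivatives of finite element
  functions as the piecewise polynomials of mean zero, up to null sets.\<close>

lemma primitive_in_Vh:
  assumes s: "s \<in> pwpoly k xs" and g: "L2 g" "aeq g s" "primitive g 1 = 0" and k: "k \<le> 1"
  shows "primitive g \<in> Vh k xs"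
proof -
  obtain P where P: "s = pw xs P" "\<And>i. degree (P i) \<le> k" using s by (auto simp: pwpoly_def)
  have anti: "\<exists>Q :: complex poly. pderiv Q = P i \<and> degree Q \<le> k + 1" for i
  proof -
    have eq: "P i = [:coeff (P i) 0, coeff (P i) 1:]"
      using P(2)[of i] k by (intro poly_eqI) (auto simp: coeff_pCons split: nat.splits intro: coeff_eq_0)
    show ?thesis
    proof (cases "k = 0")
      case True
      then have "degree (P i) = 0" using P(2)[of i] by simp
      then obtain c where "P i = [:c:]" by (rule degree_eq_zeroE)
      then show ?thesis
        by (intro exI[of _ "[:0, c:]"]) (auto simp: pderiv_pCons)
    next
      case False
      have "pderiv [:0, coeff (P i) 0, coeff (P i) 1 / 2:] = P i"
        by (subst (3) eq) (simp add: pderiv_pCons)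
      moreover have "degree [:0, coeff (P i) 0, coeff (P i) 1 / 2:] \<le> k + 1"
        using False k by auto
      ultimately show ?thesis by blast
    qed
  qed
  have pg: "primitive g x = primitive s x" if "x \<in> {0..1}" for x
    using primitive_aeq[OF g(2)] g(1) that by (auto simp: L2_def P(1) pw_meas)
  have "\<exists>Q :: complex poly. degree Q \<le> k + 1 \<and> (\<forall>x\<in>{xs ! i .. xs ! Suc i}. primitive g x = poly Q (of_real x))"
    if i: "i < n" for i
  proof -
    obtain Q where Q: "pderiv Q = P i" "degree Q \<le> k + 1" using anti by blast
    define c where "c = primitive s (xs ! i) - poly Q (of_real (xs ! i))"
    have "primitive g x = poly ([:c:] + Q) (of_real x)" if x: "x \<in> {xs ! i .. xs ! Suc i}" for x
    proof -
      have nb: "0 \<le> xs ! i" "x \<le> 1" "xs ! i \<le> x"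
        using x node_bounds[of i] node_bounds[of "Suc i"] i by auto
      have "primitive s x - primitive s (xs ! i) = (LINT t:{xs ! i..x}|lborel. s t)"
        using nb unfolding P(1) by (intro primitive_diff L2_intg pw_L2) auto
      also have "\<dots> = (LINT t:{xs ! i..x}|lborel. poly (pderiv Q) (of_real t))"
        by (rule element_integral_cong[OF i])
           (use i x pw_cell[OF i] in \<open>auto simp: P(1) Q intro!: pw_meas continuous_meas continuous_intros\<close>)
      also have "\<dots> = poly Q (of_real x) - poly Q (of_real (xs ! i))"
        by (rule integral_poly_pderiv[OF nb(3)])
      finally show ?thesis using pg[of x] nb by (simp add: c_def algebra_simps)
    qed
    moreover have "degree ([:c:] + Q) \<le> k + 1" using Q by (intro degree_add_le) auto
    ultimately show ?thesis by blast
  qed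
  then show ?thesis
    using continuous_on_primitive[OF L2_sqrt_growth[OF g(1)]] g(3) len by (auto simp: Vh_def primitive_0)
qed

end

subsection \<open>The bilinear form\<close>

lemma L2_mult_integrable:
  assumes f: "L2 f" and g: "L2 g" shows "intg (\<lambda>x. f x * g x)"
proof (rule set_integrable_bound)
  show "set_integrable lborel {0..1} (\<lambda>x. (norm (f x))^2 + (norm (g x))^2)"
    using f g by (intro set_integral_add(1)) (auto simp: L2_def)
  show "meas (\<lambda>x. f x * g x)" using f g by (intro meas_mult) (auto simp: L2_def)
  have "a * b \<le> a^2 + b^2" if "0 \<le> a" "0 \<le> b" for a b :: real
  proof -
    have "0 \<le> (a - b)^2 + a * b" using that by simp
    then show ?thesis using that by (simp add: power2_eq_square algebra_simps)
  qed
  then show "AE x in lborel. x \<in> {0..1} \<longrightarrow> norm (f x * g x) \<le> norm ((norm (f x))^2 + (norm (g x))^2)"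
    by (auto simp: norm_mult)
qed

lemma L2_cnj: "L2 f \<Longrightarrow> L2 (\<lambda>x. cnj (f x))"
  by (simp add: L2_def meas_cnj)

lemma ip_aeq_right:
  assumes "aeq g g'" "meas f" "meas g" "meas g'"
  shows "ip f g = ip f g'"
  unfolding ip_def
proof (rule set_integral_aeq)
  show "aeq (\<lambda>x. f x * cnj (g x)) (\<lambda>x. f x * cnj (g' x))"
    using assms(1) unfolding aeq_def by eventually_elim auto
qed (use assms in \<open>auto intro!: meas_mult meas_cnj\<close>)

lemma ip_aeq_left:
  assumes "aeq f f'" "meas f" "meas f'" "meas g"
  shows "ip f g = ip f' g"
  unfolding ip_def
proof (rule set_integral_aeq)
  show "aeq (\<lambda>x. f x * cnj (g x)) (\<lambda>x. f' x * cnj (g x))"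
    using assms(1) unfolding aeq_def by eventually_elim auto
qed (use assms in \<open>auto intro!: meas_mult meas_cnj\<close>)

lemma ip_diff_left: "L2 f \<Longrightarrow> L2 g \<Longrightarrow> L2 h \<Longrightarrow> ip (\<lambda>x. f x - g x) h = ip f h - ip g h"
  unfolding ip_def left_diff_distrib
  by (intro set_integral_diff(2) L2_mult_integrable L2_cnj)

lemma set_integral_cnj: "(LINT x:A|M. cnj (f x)) = cnj (LINT x:A|M. f x)"
proof -
  have "(LINT x:A|M. cnj (f x)) = (\<integral>x. cnj (indicat_real A x *\<^sub>R f x) \<partial>M)"
    by (simp add: set_lebesgue_integral_def del: Bochner_Integration.integral_cnj)
  then show ?thesis by (simp only: Bochner_Integration.integral_cnj set_lebesgue_integral_def)
qed

lemma ip_const_left: "ip (\<lambda>_. c) h = c * cnj (primitive h 1)"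
  unfolding ip_def primitive_def by (simp add: set_integral_cnj)

lemma ip_self_zero:
  assumes f: "L2 f" and 0: "ip f f = 0" shows "aeq f (\<lambda>_. 0)"
proof -
  have "ip f f = (LINT x:{0..1}|lborel. complex_of_real ((norm (f x))^2))"
    unfolding ip_def by (simp only: complex_norm_square)
  also have "\<dots> = of_real (LINT x:{0..1}|lborel. (norm (f x))^2)" by (rule set_integral_complex_of_real)
  finally have "(\<integral>x. indicat_real {0..1} x *\<^sub>R (norm (f x))^2 \<partial>lborel) = 0"
    using 0 by (simp add: set_lebesgue_integral_def)
  moreover have "integrable lborel (\<lambda>x. indicat_real {0..1} x *\<^sub>R (norm (f x))^2)"
    using f by (simp add: L2_def set_integrable_def)
  ultimately have "AE x in lborel. indicat_real {0..1} x *\<^sub>R (norm (f x))^2 = 0"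
    by (subst (asm) integral_nonneg_eq_0_iff_AE) auto
  then show ?thesis unfolding aeq_def by eventually_elim auto
qed

text \<open>Integration by parts without boundary terms, as the primitive of g vanishes at both
  ends.\<close>

lemma ip_primitive_right:
  assumes F: "sqrt_growth F N" and g: "L2 g" "primitive g 1 = 0"
  shows "ip F (primitive g) = - ip (primitive F) g"
proof -
  have cp: "cnj (primitive g x) = primitive (\<lambda>t. cnj (g t)) x" for x
    unfolding primitive_def by (simp add: set_integral_cnj)
  have pF: "L2 (primitive F)" by (rule L2_continuous[OF continuous_on_primitive[OF F]])
  have i: "intg (\<lambda>t. cnj (g t) * primitive F t)" by (intro L2_mult_integrable L2_cnj g pF)
  have i': "intg (\<lambda>t. cnj (g t) * primitive F 1)"
    by (intro set_integrable_mult_left L2_intg L2_cnj g)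
  have "ip F (primitive g) = (LINT x:{0..1}|lborel. F x * primitive (\<lambda>t. cnj (g t)) x)"
    by (simp add: ip_def cp)
  also have "\<dots> = (LINT t:{0..1}|lborel. cnj (g t) * (primitive F 1 - primitive F t))"
    by (rule integral_primitive_by_parts) (auto intro: sqrt_growth_intg F L2_intg L2_cnj g)
  also have "\<dots> = (LINT t:{0..1}|lborel. cnj (g t) * primitive F 1) - (LINT t:{0..1}|lborel. cnj (g t) * primitive F t)"
    unfolding right_diff_distrib by (rule set_integral_diff(2)[OF i' i])
  also have "(LINT t:{0..1}|lborel. cnj (g t) * primitive F 1) = 0"
    using cp[of 1] g(2) by (simp add: primitive_def)
  also have "(LINT t:{0..1}|lborel. cnj (g t) * primitive F t) = ip (primitive F) g"
    unfolding ip_def by (simp add: mult.commute)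
  finally show ?thesis by simp
qed

lemma rl_meas: assumes g: "meas g" shows "meas (rl \<alpha> g)"
proof -
  define g0 where "g0 t = indicat_real {0..1} t *\<^sub>R g t" for t
  have [measurable]: "g0 \<in> borel_measurable lborel" using g by (simp add: set_borel_measurable_def g0_def[abs_def])
  define k where "k x t = (if 0 \<le> t \<and> t \<le> x then complex_of_real ((x - t) powr (\<alpha> - 2)) * g0 t else 0)" for x t
  have "(\<lambda>x. \<integral>t. k x t \<partial>lborel) \<in> borel_measurable lborel"
  proof (rule lborel.borel_measurable_lebesgue_integral)
    show "(\<lambda>(x, t). k x t) \<in> borel_measurable (lborel \<Otimes>\<^sub>M lborel)"
      unfolding k_def by measurable
  qed
  then have m: "(\<lambda>x. indicat_real {0..1} x *\<^sub>R (of_real (1 / Gamma (\<alpha> - 1)) * (\<integral>t. k x t \<partial>lborel))) \<in> borel_measurable lborel"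
    by measurable
  have eq: "indicat_real {0..1} x *\<^sub>R (of_real (1 / Gamma (\<alpha> - 1)) * (\<integral>t. k x t \<partial>lborel)) = indicat_real {0..1} x *\<^sub>R rl \<alpha> g x" for x
  proof (cases "x \<in> {0..1}")
    case True
    have "(\<integral>t. k x t \<partial>lborel) = (LINT t:{0..x}|lborel. of_real ((x - t) powr (\<alpha> - 2)) * g t)"
      unfolding set_lebesgue_integral_def
      by (rule Bochner_Integration.integral_cong) (use True in \<open>auto simp: k_def g0_def indicator_def\<close>)
    then show ?thesis by (simp add: rl_def)
  qed simp
  from m show ?thesis unfolding set_borel_measurable_def eq .
qed

context frac_order
begin

text \<open>Here \<alpha> > 3/2 enters: 2 (\<alpha> - 2) > -1 makes the kernel square integrable,
  and its product with g is at most the sum of the two squares. A finite bound is enough, since it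
  only serves to start the argument for an arbitrary element of V.\<close>

lemma rl_L2_bounded:
  assumes g: "L2 g"
  obtains B where "B \<ge> 0" "\<And>x. x \<in> {0..1} \<Longrightarrow> norm (rl \<alpha> g x) \<le> B"
proof -
  let ?b = "2 * \<alpha> - 4"
  define Q where "Q = (LINT t:{0..1}|lborel. (norm (g t))^2)"
  define B where "B = 1 / Gamma (\<alpha> - 1) * (1 / (?b + 1) + Q)"
  have "norm (rl \<alpha> g x) \<le> B" if x: "x \<in> {0..1}" for x
  proof -
    have i1: "set_integrable lborel {0..x} (\<lambda>t. (x - t) powr ?b)"
      and v1: "(LINT t:{0..x}|lborel. (x - t) powr ?b) = x powr (?b + 1) / (?b + 1)"
      using powr_reflected_integral[of ?b 0 x] \<alpha>_gt x by auto
    have i2: "set_integrable lborel {0..x} (\<lambda>t. (norm (g t))^2)"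
      by (rule set_integrable_Icc_subset) (use g x in \<open>auto simp: L2_def\<close>)
    have i3: "set_integrable lborel {0..x} (\<lambda>t. (x - t) powr ?b + (norm (g t))^2)"
      by (rule set_integral_add(1)[OF i1 i2])
    have bd: "norm (of_real (ker (x - t)) * g t) \<le> (x - t) powr ?b + (norm (g t))^2" for t
    proof -
      have "(x - t) powr ?b = ker (x - t) ^ 2"
        unfolding ker_def power2_eq_square powr_add[symmetric] by simp
      moreover have "ker (x - t) * norm (g t) \<le> ker (x - t) ^ 2 + (norm (g t))^2"
      proof -
        have "0 \<le> (ker (x - t) - norm (g t))^2 + ker (x - t) * norm (g t)"
          using ker_nonneg[of "x - t"] by simp
        then show ?thesis by (simp add: power2_eq_square algebra_simps)
      qed
      ultimately show ?thesis using ker_nonneg[of "x - t"] by (simp add: norm_mult)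
    qed
    have m: "meas (\<lambda>t. of_real (ker (x - t)) * g t)"
      using g by (intro meas_real_mult) (auto simp: L2_def)
    have i: "set_integrable lborel {0..x} (\<lambda>t. of_real (ker (x - t)) * g t)"
    proof (rule set_integrable_bound[OF i3])
      show "set_borel_measurable lborel {0..x} (\<lambda>t. of_real (ker (x - t)) * g t)"
        using m x by (auto intro: set_borel_measurable_subset)
      show "AE t in lborel. t \<in> {0..x} \<longrightarrow> norm (of_real (ker (x - t)) * g t) \<le> norm ((x - t) powr ?b + (norm (g t))^2)"
        using bd by (auto intro!: AE_I2 order_trans[OF bd])
    qed
    have "norm (LINT t:{0..x}|lborel. of_real (ker (x - t)) * g t) \<le> (LINT t:{0..x}|lborel. norm (of_real (ker (x - t)) * g t))"
      by (rule set_integral_norm_bound[OF i])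
    also have "\<dots> \<le> (LINT t:{0..x}|lborel. (x - t) powr ?b + (norm (g t))^2)"
      using bd by (intro set_integral_mono set_integrable_norm i i3)
    also have "\<dots> = x powr (?b + 1) / (?b + 1) + (LINT t:{0..x}|lborel. (norm (g t))^2)"
      using set_integral_add(2)[OF i1 i2] v1 by simp
    also have "\<dots> \<le> 1 / (?b + 1) + Q"
    proof (rule add_mono)
      have "x powr (?b + 1) \<le> 1 powr (?b + 1)" using x \<alpha>_gt by (intro powr_mono2) auto
      then show "x powr (?b + 1) / (?b + 1) \<le> 1 / (?b + 1)" using \<alpha>_gt by (intro divide_right_mono) auto
      show "(LINT t:{0..x}|lborel. (norm (g t))^2) \<le> Q"
        unfolding Q_def set_lebesgue_integral_def
        using i2 g x by (intro integral_mono) (auto simp: set_integrable_def L2_def indicator_def)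
    qed
    finally show ?thesis
      unfolding rl_ker norm_mult norm_of_real B_def using Gamma_pos by (intro mult_mono) auto
  qed
  then have "norm (rl \<alpha> g x) \<le> max B 0" if "x \<in> {0..1}" for x
    using that by (auto intro: max.coboundedI1)
  with that[of "max B 0"] show ?thesis by simp
qed

end

text \<open>The right-hand side of the equation w'' = load for the exact solution: the lower order
  terms of the form minus the datum, with r for the fractional derivative of w.\<close>

definition load :: "(real \<Rightarrow> real) \<Rightarrow> (real \<Rightarrow> real) \<Rightarrow> (real \<Rightarrow> complex) \<Rightarrow> (real \<Rightarrow> complex) \<Rightarrow> real \<Rightarrow> complex" where
  "load q p f r x = of_real (q x) * r x + r 1 * of_real (p x) - f x"

lemma load_sqrt_growth:
  assumes q: "sqrt_growth (\<lambda>x. of_real (q x)) Nq" and p: "sqrt_growth (\<lambda>x. of_real (p x)) Np"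
    and f: "sqrt_growth f N" and r: "meas r" "\<And>x. x \<in> {0..1} \<Longrightarrow> norm (r x) \<le> M" "0 \<le> M"
  shows "sqrt_growth (load q p f r) (Nq * M + M * Np + N)"
proof -
  have 1: "sqrt_growth (\<lambda>x. of_real (q x) * r x) (Nq * M)"
    by (rule sqrt_growth_mult[OF q r])
  have 2: "sqrt_growth (\<lambda>x. r 1 * of_real (p x)) (norm (r 1) * Np)"
    by (rule sqrt_growth_cmult[OF p])
  have "sqrt_growth (load q p f r) (Nq * M + norm (r 1) * Np + N)"
    unfolding load_def[abs_def] by (intro sqrt_growth_minus sqrt_growth_add 1 2 f)
  moreover have "norm (r 1) * Np \<le> M * Np"
    using r(2)[of 1] sqrt_growth_nonneg[OF p] by (intro mult_right_mono) auto
  ultimately show ?thesis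
    unfolding sqrt_growth_def by (smt (verit) mult_right_mono real_sqrt_ge_zero)
qed

text \<open>Integration by parts moves the lower order terms and the datum onto the derivative of
  the test function. The variational problem thereby becomes an orthogonality to the derivatives of
  test functions.\<close>

lemma (in frac_order) Aform_residual:
  assumes q: "L2 (\<lambda>x. of_real (q x))" and p: "L2 (\<lambda>x. of_real (p x))" and f: "L2 f"
    and w: "w \<in> Vspace" and \<phi>: "\<phi> \<in> Vspace"
  shows "Aform \<alpha> q p w \<phi> - ip f \<phi> = ip (\<lambda>t. wd w t - primitive (load q p f (rl \<alpha> (wd w))) t) (wd \<phi>)"
proof -
  note W = Vspace_wd[OF w] and P = Vspace_wd[OF \<phi>]
  define r where "r = rl \<alpha> (wd w)"
  define u where "u = primitive (wd \<phi>)"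
  have r: "meas r" unfolding r_def using W(1) by (auto intro: rl_meas simp: L2_def)
  obtain B where B: "B \<ge> 0" "\<And>x. x \<in> {0..1} \<Longrightarrow> norm (r x) \<le> B"
    unfolding r_def using rl_L2_bounded[OF W(1)] by blast
  have uc: "continuous_on {0..1} u" unfolding u_def by (rule continuous_on_primitive[OF L2_sqrt_growth[OF P(1)]])
  then obtain U where U: "U \<ge> 0" "\<And>x. x \<in> {0..1} \<Longrightarrow> norm (u x) \<le> U" using continuous_unit_bounded by metis
  have m: "meas \<phi>" "meas u" "meas f" "meas (\<lambda>x. of_real (q x))" "meas (\<lambda>x. of_real (p x))"
    using Vspace_L2[OF \<phi>] uc f q p by (auto simp: L2_def intro: continuous_meas)
  have ae: "aeq \<phi> u" using P(2) by (simp add: u_def)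
  have aeq': "aeq (\<lambda>x. of_real (q x) * \<phi> x) (\<lambda>x. of_real (q x) * u x)"
    using ae unfolding aeq_def by eventually_elim auto
  let ?F = "load q p f r"
  have F: "sqrt_growth ?F (l2norm (\<lambda>x. of_real (q x)) * B + B * l2norm (\<lambda>x. of_real (p x)) + l2norm f)"
    by (intro load_sqrt_growth L2_sqrt_growth q p f r B)
  have g1: "intg (\<lambda>x. (of_real (q x) * r x) * cnj (u x))"
    by (rule sqrt_growth_intg, rule sqrt_growth_mult[OF sqrt_growth_mult[OF L2_sqrt_growth[OF q] r B(2,1)] meas_cnj[OF m(2)] _ U(1)])
       (use U in auto)
  have g2: "intg (\<lambda>x. (r 1 * of_real (p x)) * cnj (u x))"
    by (rule sqrt_growth_intg, rule sqrt_growth_mult[OF sqrt_growth_cmult[OF L2_sqrt_growth[OF p]] meas_cnj[OF m(2)] _ U(1)])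
       (use U in auto)
  have g3: "intg (\<lambda>x. f x * cnj (u x))"
    by (rule sqrt_growth_intg, rule sqrt_growth_mult[OF L2_sqrt_growth[OF f] meas_cnj[OF m(2)] _ U(1)])
       (use U in auto)
  have 1: "ip (RL \<alpha> w) (\<lambda>x. of_real (q x) * \<phi> x) = (LINT x:{0..1}|lborel. (of_real (q x) * r x) * cnj (u x))"
  proof -
    have "ip (RL \<alpha> w) (\<lambda>x. of_real (q x) * \<phi> x) = ip r (\<lambda>x. of_real (q x) * u x)"
      unfolding RL_eq_rl[abs_def] r_def[symmetric]
      by (rule ip_aeq_right[OF aeq' r]) (intro meas_mult m)+
    also have "\<dots> = (LINT x:{0..1}|lborel. (of_real (q x) * r x) * cnj (u x))"
      unfolding ip_def by (rule set_lebesgue_integral_cong) auto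
    finally show ?thesis .
  qed
  have 2: "RL \<alpha> w 1 * ip (\<lambda>x. of_real (p x)) \<phi> = (LINT x:{0..1}|lborel. (r 1 * of_real (p x)) * cnj (u x))"
  proof -
    have "ip (\<lambda>x. of_real (p x)) \<phi> = ip (\<lambda>x. of_real (p x)) u" by (rule ip_aeq_right[OF ae m(5,1,2)])
    then show ?thesis by (simp add: ip_def RL_eq_rl r_def mult.assoc)
  qed
  have 3: "ip f \<phi> = (LINT x:{0..1}|lborel. f x * cnj (u x))"
    unfolding ip_aeq_right[OF ae m(3,1,2)] by (simp add: ip_def)
  have "ip ?F u = (LINT x:{0..1}|lborel. (of_real (q x) * r x) * cnj (u x) + (r 1 * of_real (p x)) * cnj (u x) - f x * cnj (u x))"
    unfolding ip_def by (rule set_lebesgue_integral_cong) (auto simp: load_def algebra_simps)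
  also have "\<dots> = ip (RL \<alpha> w) (\<lambda>x. of_real (q x) * \<phi> x) + RL \<alpha> w 1 * ip (\<lambda>x. of_real (p x)) \<phi> - ip f \<phi>"
    unfolding 1 2 3 set_integral_diff(2)[OF set_integral_add(1)[OF g1 g2] g3] set_integral_add(2)[OF g1 g2] ..
  finally have "Aform \<alpha> q p w \<phi> - ip f \<phi> = ip (wd w) (wd \<phi>) + ip ?F u" by (simp add: Aform_def)
  also have "ip ?F u = - ip (primitive ?F) (wd \<phi>)"
    unfolding u_def by (rule ip_primitive_right[OF F P(1,3)])
  also have "ip (wd w) (wd \<phi>) + - ip (primitive ?F) (wd \<phi>) = ip (\<lambda>t. wd w t - primitive ?F t) (wd \<phi>)"
    by (simp add: ip_diff_left W P L2_continuous continuous_on_primitive[OF F])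
  finally show ?thesis by (simp add: r_def)
qed

subsection \<open>Continuous functions on the unit interval as a Banach space\<close>

text \<open>\<open>C[0,1]\<close> is represented by bounded continuous functions on the line that are constant
  outside \<open>[0,1]\<close>.\<close>

definition unit_clamp :: "real \<Rightarrow> real" where "unit_clamp x = max 0 (min 1 x)"

definition extend :: "(real \<Rightarrow> complex) \<Rightarrow> real \<Rightarrow>\<^sub>C complex" where
  "extend f = Bcontfun (\<lambda>x. f (unit_clamp x))"

lemma unit_clamp_mem: "unit_clamp x \<in> {0..1}"
  by (simp add: unit_clamp_def)

lemma unit_clamp_id: "x \<in> {0..1} \<Longrightarrow> unit_clamp x = x"
  by (simp add: unit_clamp_def)

lemma extend_apply:
  assumes "continuous_on {0..1} f"
  shows "apply_bcontfun (extend f) x = f (unit_clamp x)"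
proof -
  obtain M where "\<And>x. x \<in> {0..1} \<Longrightarrow> norm (f x) \<le> M"
    using continuous_unit_bounded[OF assms] by metis
  then have "bounded (range (\<lambda>x. f (unit_clamp x)))"
    using unit_clamp_mem by (auto simp: bounded_iff)
  moreover have "continuous_on UNIV (\<lambda>x. f (unit_clamp x))"
  proof (rule continuous_on_compose2[OF assms])
    show "continuous_on UNIV unit_clamp" unfolding unit_clamp_def[abs_def] by (intro continuous_intros)
  qed (use unit_clamp_mem in auto)
  ultimately show ?thesis
    unfolding extend_def by (subst Bcontfun_inverse) (auto simp: bcontfun_def)
qed

lemma extend_unit: "continuous_on {0..1} f \<Longrightarrow> x \<in> {0..1} \<Longrightarrow> apply_bcontfun (extend f) x = f x"
  by (simp add: extend_apply unit_clamp_id)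

definition cscale :: "complex \<Rightarrow> (real \<Rightarrow>\<^sub>C complex) \<Rightarrow> real \<Rightarrow>\<^sub>C complex" where
  "cscale c f = Bcontfun (\<lambda>x. c * f x)"

lemma cscale_apply [simp]: "apply_bcontfun (cscale c f) x = c * f x"
proof -
  obtain M where "\<And>x. norm (f x) \<le> M"
    using bounded_apply_bcontfun[of f] by (auto simp: bounded_iff)
  then have "norm (c * f x) \<le> norm c * M" for x by (simp add: norm_mult mult_left_mono)
  then have "bounded (range (\<lambda>x. c * f x))" by (auto simp: bounded_iff)
  then show ?thesis
    unfolding cscale_def by (subst Bcontfun_inverse) (auto simp: bcontfun_def intro!: continuous_intros)
qed

interpretation cscale: complex_scaling cscale
proof
  fix z w :: complex and x y :: "real \<Rightarrow>\<^sub>C complex" and t :: real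
  show "cscale z (x + y) = cscale z x + cscale z y"
    by (rule bcontfun_eqI) (simp add: distrib_left)
  show "cscale (z + w) x = cscale z x + cscale w x"
    by (rule bcontfun_eqI) (simp add: distrib_right)
  show "cscale z (cscale w x) = cscale (z * w) x"
    by (rule bcontfun_eqI) simp
  show "cscale (of_real t) x = t *\<^sub>R x"
    by (rule bcontfun_eqI) (simp add: scaleR_conv_of_real)
  show "norm (cscale z x) = cmod z * norm x"
  proof (rule antisym)
    show *: "norm (cscale z x) \<le> cmod z * norm x" for z x
      by (rule norm_bound) (simp add: norm_mult norm_bounded mult_left_mono)
    show "cmod z * norm x \<le> norm (cscale z x)"
    proof (cases "z = 0")
      case False
      have "x = cscale (1 / z) (cscale z x)" using False by (intro bcontfun_eqI) simp
      then have "norm x \<le> cmod (1 / z) * norm (cscale z x)" using * by metis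
      then show ?thesis using False by (simp add: norm_divide field_simps)
    qed simp
  qed
qed

lemma bcontfun_meas: "meas (apply_bcontfun r)"
  by (intro continuous_meas) auto

lemma bcontfun_L2: "L2 (apply_bcontfun r)"
  by (intro L2_continuous) auto

lemma bcontfun_sqrt_growth: "sqrt_growth (apply_bcontfun r) (norm r)"
  by (intro bounded_sqrt_growth bcontfun_meas norm_bounded) auto

text \<open>A common frame for the exact and the discrete problem: \<open>W\<close> is the space of
  trial and test functions, \<open>G\<close> the class of their derivatives before the zero mean is
  imposed, and \<open>Pr\<close> the orthogonal projection of continuous functions onto
  \<open>G\<close>. In one dimension \<open>W_G\<close> and \<open>G_W\<close> let one pass freely
  between \<open>W\<close> and the mean-zero part of \<open>G\<close>. The factor 6 is a common
  bound for both instances.\<close>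

locale galerkin = frac_order \<alpha> for \<alpha> :: real +
  fixes q p :: "real \<Rightarrow> real" and W G :: "(real \<Rightarrow> complex) set"
    and Pr :: "(real \<Rightarrow> complex) \<Rightarrow> real \<Rightarrow> complex"
  assumes q: "L2 (\<lambda>x. of_real (q x))" and p: "L2 (\<lambda>x. of_real (p x))"
    and W_Vspace: "\<phi> \<in> W \<Longrightarrow> \<phi> \<in> Vspace" and W_G: "\<phi> \<in> W \<Longrightarrow> wd \<phi> \<in> G"
    and G_W: "g \<in> G \<Longrightarrow> primitive g 1 = 0 \<Longrightarrow> primitive g \<in> W"
    and G_L2: "g \<in> G \<Longrightarrow> L2 g"
    and G_diff: "g \<in> G \<Longrightarrow> g' \<in> G \<Longrightarrow> (\<lambda>x. g x - g' x) \<in> G"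
    and G_const: "(\<lambda>_. c) \<in> G"
    and Pr_G: "continuous_on {0..1} v \<Longrightarrow> Pr v \<in> G"
    and Pr_orth: "continuous_on {0..1} v \<Longrightarrow> g \<in> G \<Longrightarrow> ip (\<lambda>t. v t - Pr v t) g = 0"
    and Pr_cong: "(\<And>t. t \<in> {0..1} \<Longrightarrow> v t = v' t) \<Longrightarrow> Pr v = Pr v'"
    and Pr_bound: "continuous_on {0..1} v \<Longrightarrow> (\<And>t. t \<in> {0..1} \<Longrightarrow> norm (v t) \<le> M) \<Longrightarrow> t \<in> {0..1} \<Longrightarrow> norm (Pr v t) \<le> 6 * M"
    and Pr_diff: "continuous_on {0..1} v \<Longrightarrow> continuous_on {0..1} v' \<Longrightarrow> Pr (\<lambda>t. v t - v' t) t = Pr v t - Pr v' t"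
    and Pr_cmult: "Pr (\<lambda>t. c * v t) t = c * Pr v t"
begin

text \<open>The subtracted number is the mean of \<open>primitive F\<close>. Constants belong to
  \<open>G\<close>, so projecting preserves the mean and the result is the projection onto the
  mean-zero part of \<open>G\<close>, that is, the derivative of the solution with load F.\<close>

definition dens :: "(real \<Rightarrow> complex) \<Rightarrow> real \<Rightarrow> complex" where
  "dens F t = Pr (primitive F) t - primitive (primitive F) 1"

text \<open>The solution operator of the principal part: the fractional derivative of the element of
  \<open>W\<close> that solves w'' = F variationally.\<close>

definition P :: "(real \<Rightarrow> complex) \<Rightarrow> real \<Rightarrow>\<^sub>C complex" where
  "P F = extend (rl \<alpha> (dens F))"

lemma dens_G: "sqrt_growth F N \<Longrightarrow> dens F \<in> G"
  unfolding dens_def[abs_def] by (intro G_diff Pr_G G_const continuous_on_primitive)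

lemma dens_L2: "sqrt_growth F N \<Longrightarrow> L2 (dens F)"
  by (intro G_L2 dens_G)

lemma dens_meas: "sqrt_growth F N \<Longrightarrow> meas (dens F)"
  using dens_L2 by (simp add: L2_def)

text \<open>Six for the projection and one for the mean.\<close>

lemma dens_bound:
  assumes F: "sqrt_growth F N" and t: "t \<in> {0..1}"
  shows "norm (dens F t) \<le> 7 * N"
proof -
  have c: "continuous_on {0..1} (primitive F)" by (rule continuous_on_primitive[OF F])
  have b: "norm (primitive F s) \<le> N" if "s \<in> {0..1}" for s
    using sqrt_growth_primitive_bound[OF F] that by auto
  have "norm (Pr (primitive F) t) \<le> 6 * N" by (rule Pr_bound[OF c b t])
  moreover have "norm (primitive (primitive F) 1) \<le> N"
    by (rule sqrt_growth_primitive_bound[OF bounded_sqrt_growth[OF continuous_meas[OF c] b sqrt_growth_nonneg[OF F]]]) auto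
  ultimately show ?thesis unfolding dens_def by (intro order_trans[OF norm_triangle_ineq4]) auto
qed

lemma dens_mean:
  assumes F: "sqrt_growth F N" shows "primitive (dens F) 1 = 0"
proof -
  have c: "continuous_on {0..1} (primitive F)" by (rule continuous_on_primitive[OF F])
  have "ip (\<lambda>t. primitive F t - Pr (primitive F) t) (\<lambda>_. 1) = 0" by (rule Pr_orth[OF c G_const])
  then have "primitive (primitive F) 1 = primitive (Pr (primitive F)) 1"
    using primitive_minus[OF L2_intg[OF L2_continuous[OF c]] L2_intg[OF G_L2[OF Pr_G[OF c]]], of 1]
    by (simp add: ip_def primitive_def)
  then show ?thesis
    unfolding dens_def[abs_def]
    by (subst primitive_minus) (auto intro: L2_intg G_L2 Pr_G c set_integrable_const simp: primitive_const)
qed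

lemma rl_dens_hoelder:
  assumes "sqrt_growth F N" "0 \<le> x" "x \<le> y" "y \<le> 1"
  shows "norm (rl \<alpha> (dens F) y - rl \<alpha> (dens F) x) \<le> c\<alpha> * (14 * N * (y - x) powr (\<alpha> - 1))"
  using rl_hoelder[OF dens_meas[OF assms(1)] dens_bound[OF assms(1)] assms(2-4)] by simp

lemma rl_dens_continuous:
  assumes F: "sqrt_growth F N" shows "continuous_on {0..1} (rl \<alpha> (dens F))"
proof -
  let ?f = "rl \<alpha> (dens F)"
  have "(?f \<longlongrightarrow> ?f x) (at x within {0..1})" if x: "x \<in> {0..1}" for x
  proof -
    have "norm (?f y - ?f x) \<le> c\<alpha> * (14 * N * \<bar>y - x\<bar> powr (\<alpha> - 1))" if "y \<in> {0..1}" for y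
      using rl_dens_hoelder[OF F, of x y] rl_dens_hoelder[OF F, of y x] that x
      by (cases "x \<le> y") (auto simp: norm_minus_commute)
    then have "\<forall>\<^sub>F y in at x within {0..1}. norm (?f y - ?f x) \<le> c\<alpha> * (14 * N * \<bar>y - x\<bar> powr (\<alpha> - 1))"
      by (auto simp: eventually_at_filter)
    moreover have "((\<lambda>y. c\<alpha> * (14 * N * \<bar>y - x\<bar> powr (\<alpha> - 1))) \<longlongrightarrow> c\<alpha> * (14 * N * 0)) (at x within {0..1})"
    proof -
      have "((\<lambda>y. \<bar>y - x\<bar>) \<longlongrightarrow> \<bar>x - x\<bar>) (at x within {0..1})" by (intro tendsto_intros)
      then have "((\<lambda>y. \<bar>y - x\<bar> powr (\<alpha> - 1)) \<longlongrightarrow> 0) (at x within {0..1})"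
        using \<alpha>_gt by (intro tendsto_zero_powrI[of _ _ _ "\<alpha> - 1"]) (auto intro!: always_eventually)
      then show ?thesis by (intro tendsto_intros)
    qed
    ultimately have "((\<lambda>y. ?f y - ?f x) \<longlongrightarrow> 0) (at x within {0..1})"
      by (auto intro: Lim_null_comparison)
    then show ?thesis using LIM_zero_cancel by blast
  qed
  then show ?thesis by (simp add: continuous_on_def)
qed

lemma P_apply: "sqrt_growth F N \<Longrightarrow> apply_bcontfun (P F) x = rl \<alpha> (dens F) (unit_clamp x)"
  unfolding P_def by (rule extend_apply[OF rl_dens_continuous])

lemma P_unit: "sqrt_growth F N \<Longrightarrow> x \<in> {0..1} \<Longrightarrow> apply_bcontfun (P F) x = rl \<alpha> (dens F) x"
  by (simp add: P_apply unit_clamp_id)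

lemma P_hoelder:
  assumes "sqrt_growth F N" "0 \<le> x" "x \<le> y" "y \<le> 1"
  shows "norm (P F y - P F x) \<le> c\<alpha> * (14 * N * (y - x) powr (\<alpha> - 1))"
  using rl_dens_hoelder[OF assms] assms by (simp add: P_unit[OF assms(1)])

definition bP :: real where "bP = 7 * c\<alpha>"

lemma bP_pos: "bP > 0" using c\<alpha>_pos by (simp add: bP_def)

lemma P_bound:
  assumes F: "sqrt_growth F N" shows "norm (P F) \<le> bP * N"
proof (rule norm_bound)
  fix x
  have "norm (rl \<alpha> (dens F) (unit_clamp x)) \<le> c\<alpha> * (7 * N)"
    using sqrt_growth_nonneg[OF F]
    by (intro rl_bound_1 dens_meas[OF F] dens_bound[OF F] unit_clamp_mem) auto
  then show "norm (P F x) \<le> bP * N" by (simp add: P_apply[OF F] bP_def)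
qed

lemma P_cong:
  assumes "aeq F F'" "meas F" "meas F'" shows "P F = P F'"
proof -
  have eq: "primitive F t = primitive F' t" if "t \<in> {0..1}" for t
    using primitive_aeq[OF assms] that by auto
  have "primitive (primitive F) 1 = primitive (primitive F') 1"
    unfolding primitive_def[of "primitive _"] by (rule set_lebesgue_integral_cong) (use eq in auto)
  then have "dens F = dens F'"
    using Pr_cong[OF eq] by (auto simp: dens_def fun_eq_iff)
  then show ?thesis by (simp add: P_def)
qed

lemma P_diff:
  assumes F: "sqrt_growth F N" and F': "sqrt_growth F' N'"
  shows "P (\<lambda>x. F x - F' x) = P F - P F'"
proof (rule bcontfun_eqI)
  fix x
  note FF = sqrt_growth_minus[OF F F']
  have c: "continuous_on {0..1} (primitive F)" "continuous_on {0..1} (primitive F')"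
    using F F' by (auto intro: continuous_on_primitive)
  have eq: "primitive (\<lambda>x. F x - F' x) t = primitive F t - primitive F' t" if "t \<in> {0..1}" for t
    using primitive_minus[OF sqrt_growth_intg[OF F] sqrt_growth_intg[OF F']] that by auto
  have "Pr (primitive (\<lambda>x. F x - F' x)) = Pr (\<lambda>t. primitive F t - primitive F' t)"
    by (rule Pr_cong[OF eq])
  moreover have "primitive (primitive (\<lambda>x. F x - F' x)) 1 = primitive (\<lambda>t. primitive F t - primitive F' t) 1"
    unfolding primitive_def[of "primitive (\<lambda>x. F x - F' x)"] primitive_def[of "\<lambda>t. primitive F t - primitive F' t"]
    by (rule set_lebesgue_integral_cong) (use eq in auto)
  moreover have "\<dots> = primitive (primitive F) 1 - primitive (primitive F') 1"
    by (rule primitive_minus) (auto intro!: L2_intg L2_continuous c)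
  ultimately have "dens (\<lambda>x. F x - F' x) = (\<lambda>t. dens F t - dens F' t)"
    using Pr_diff[OF c] by (auto simp: dens_def fun_eq_iff)
  then show "P (\<lambda>x. F x - F' x) x = apply_bcontfun (P F - P F') x"
    using rl_diff[OF dens_meas[OF F] dens_bound[OF F] dens_meas[OF F'] dens_bound[OF F'] unit_clamp_mem]
    by (simp add: P_apply[OF F] P_apply[OF F'] P_apply[OF FF])
qed

lemma P_cmult:
  assumes F: "sqrt_growth F N"
  shows "P (\<lambda>x. c * F x) = cscale c (P F)"
proof (rule bcontfun_eqI)
  fix x
  have e: "primitive (\<lambda>x. c * F x) = (\<lambda>t. c * primitive F t)" by (simp add: primitive_cmult fun_eq_iff)
  have "dens (\<lambda>x. c * F x) = (\<lambda>t. c * dens F t)"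
    unfolding dens_def[abs_def] e by (simp add: Pr_cmult primitive_cmult right_diff_distrib fun_eq_iff)
  then show "P (\<lambda>x. c * F x) x = cscale c (P F) x"
    by (simp add: P_apply[OF F] P_apply[OF sqrt_growth_cmult[OF F]] rl_cmult)
qed

lemma P_add:
  assumes F: "sqrt_growth F N" and F': "sqrt_growth F' N'"
  shows "P (\<lambda>x. F x + F' x) = P F + P F'"
proof -
  have "P (\<lambda>x. F x - (- 1) * F' x) = P F - cscale (- 1) (P F')"
    using P_diff[OF F sqrt_growth_cmult[OF F', of "- 1"]] P_cmult[OF F', of "- 1"] by simp
  also have "cscale (- 1) (P F') = - P F'" by (rule bcontfun_eqI) simp
  finally show ?thesis by simp
qed

text \<open>A common growth constant makes the values uniformly bounded and uniformly Hoelder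
  continuous of order \<alpha> - 1, so Arzela-Ascoli applies on [0,1]. Since they are extended by
  clamping, uniform convergence there is convergence in norm.\<close>

lemma P_sequence_compact:
  assumes F: "\<And>n::nat. sqrt_growth (F n) N"
  shows "\<exists>l r. strict_mono r \<and> (\<lambda>n. P (F (r n))) \<longlonglongrightarrow> l"
proof -
  have eqc: "\<exists>d>0. \<forall>n y. y \<in> {0..1} \<and> norm (x - y) < d \<longrightarrow> norm (apply_bcontfun (P (F n)) x - P (F n) y) < e"
    if x: "x \<in> {0..1}" and e: "e > 0" for x e :: real
  proof -
    define C where "C = c\<alpha> * (14 * N) + 1"
    have C: "C > 0" using c\<alpha>_pos sqrt_growth_nonneg[OF F] by (simp add: C_def add_nonneg_pos)
    \<comment> \<open>The solution of C d powr (\<alpha> - 1) = e; the summand 1 in C ensures that C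
      is positive.\<close>
    define d where "d = (e / C) powr (1 / (\<alpha> - 1))"
    have d: "d > 0" using C e by (simp add: d_def)
    have "norm (P (F n) x - P (F n) y) < e" if y: "y \<in> {0..1}" "norm (x - y) < d" for n y
    proof -
      have "norm (P (F n) x - P (F n) y) \<le> c\<alpha> * (14 * N * \<bar>x - y\<bar> powr (\<alpha> - 1))"
        using P_hoelder[OF F, of x y n] P_hoelder[OF F, of y x n] x y
        by (cases "x \<le> y") (auto simp: norm_minus_commute)
      also have "\<dots> \<le> C * \<bar>x - y\<bar> powr (\<alpha> - 1)" by (simp add: C_def algebra_simps)
      also have "\<dots> < C * d powr (\<alpha> - 1)"
        using y C \<alpha>_gt by (intro mult_strict_left_mono powr_less_mono2) auto
      also have "d powr (\<alpha> - 1) = e / C"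
        using \<alpha>_gt e C by (simp add: d_def powr_powr)
      finally show ?thesis using C by simp
    qed
    then show ?thesis using d by blast
  qed
  have bd: "norm (P (F n) x) \<le> bP * N" for n x
    using order_trans[OF norm_bounded P_bound[OF F]] .
  obtain g r where g: "continuous_on {0..1} g" and r: "strict_mono (r :: nat \<Rightarrow> nat)"
    and lim: "\<And>e. 0 < e \<Longrightarrow> \<exists>M. \<forall>n x. n \<ge> M \<and> x \<in> {0..1} \<longrightarrow> norm (apply_bcontfun (P (F (r n))) x - g x) < e"
    by (rule Arzela_Ascoli[of "{0..1::real}" "\<lambda>n. apply_bcontfun (P (F n))" "bP * N"]) (use bd eqc in auto)
  have "(\<lambda>n. P (F (r n))) \<longlonglongrightarrow> extend g"
  proof (rule metric_LIMSEQ_I)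
    fix e :: real assume "e > 0"
    then obtain M where M: "\<And>n x. n \<ge> M \<Longrightarrow> x \<in> {0..1} \<Longrightarrow> norm (P (F (r n)) x - g x) < e / 2"
      using lim[of "e/2"] by auto
    have "dist (P (F (r n))) (extend g) \<le> e / 2" if "n \<ge> M" for n
    proof (rule dist_bound)
      fix x
      have "norm (P (F (r n)) (unit_clamp x) - g (unit_clamp x)) < e / 2"
        by (rule M[OF that unit_clamp_mem])
      moreover have "P (F (r n)) (unit_clamp x) = P (F (r n)) x"
        using P_apply[OF F] by (simp add: unit_clamp_id[OF unit_clamp_mem])
      ultimately show "dist (P (F (r n)) x) (extend g x) \<le> e / 2"
        by (simp add: extend_apply[OF g] dist_norm)
    qed
    note half = this
    have "dist (P (F (r n))) (extend g) < e" if "n \<ge> M" for n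
      using half[OF that] \<open>e > 0\<close> by linarith
    then show "\<exists>M. \<forall>n\<ge>M. dist (P (F (r n))) (extend g) < e" by blast
  qed
  then show ?thesis using r by blast
qed

definition B :: "(real \<Rightarrow>\<^sub>C complex) \<Rightarrow> real \<Rightarrow>\<^sub>C complex" where
  "B r = P (load q p (\<lambda>_. 0) r)"

definition NB :: real where
  "NB = l2norm (\<lambda>x. of_real (q x)) + l2norm (\<lambda>x. of_real (p x))"

lemma NB_nonneg: "0 \<le> NB" by (simp add: NB_def l2norm_nonneg)

lemma load_growth:
  assumes f: "sqrt_growth f N"
  shows "sqrt_growth (load q p f (apply_bcontfun r)) (NB * norm r + N)"
  using load_sqrt_growth[OF L2_sqrt_growth[OF q] L2_sqrt_growth[OF p] f bcontfun_meas, of r "norm r"]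
  by (simp add: norm_bounded NB_def algebra_simps)

lemma zero_growth: "sqrt_growth (\<lambda>_. 0) 0"
  by (intro bounded_sqrt_growth continuous_meas continuous_intros) auto

lemma load0_growth: "sqrt_growth (load q p (\<lambda>_. 0) (apply_bcontfun r)) (NB * norm r)"
  using load_growth[OF zero_growth] by simp

lemma P_load: "sqrt_growth f N \<Longrightarrow> P (load q p f (apply_bcontfun r)) = B r - P f"
  using P_diff[OF load0_growth, of f N r] by (simp add: B_def load_def[abs_def])

lemma B_add: "B (r + s) = B r + B s"
proof -
  have "load q p (\<lambda>_. 0) (apply_bcontfun (r + s)) = (\<lambda>x. load q p (\<lambda>_. 0) r x + load q p (\<lambda>_. 0) s x)"
    by (simp add: load_def fun_eq_iff algebra_simps)
  then show ?thesis unfolding B_def by (simp add: P_add[OF load0_growth load0_growth])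
qed

lemma B_cscale: "B (cscale c r) = cscale c (B r)"
proof -
  have "load q p (\<lambda>_. 0) (apply_bcontfun (cscale c r)) = (\<lambda>x. c * load q p (\<lambda>_. 0) r x)"
    by (simp add: load_def fun_eq_iff algebra_simps)
  then show ?thesis unfolding B_def by (simp add: P_cmult[OF load0_growth])
qed

lemma B_bounded_linear: "bounded_linear B"
proof (rule bounded_linear_intro)
  show "B (r + s) = B r + B s" for r s by (rule B_add)
  show "B (t *\<^sub>R r) = t *\<^sub>R B r" for t r
    using B_cscale[of "of_real t" r] by (simp add: cscale.cs_of_real)
  show "norm (B r) \<le> norm r * (bP * NB)" for r
    using P_bound[OF load0_growth[of r]] by (simp add: B_def algebra_simps)
qed

lemma B_compact: "compact_operator B"
  unfolding compact_operator_def
proof (intro conjI allI impI)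
  show "bounded_linear B" by (rule B_bounded_linear)
  fix x :: "nat \<Rightarrow> real \<Rightarrow>\<^sub>C complex" assume "bounded (range x)"
  then obtain M where M: "\<And>n. norm (x n) \<le> M" by (auto simp: bounded_iff)
  have "sqrt_growth (load q p (\<lambda>_. 0) (apply_bcontfun (x n))) (NB * M)" for n
  proof -
    have "NB * norm (x n) \<le> NB * M" using M NB_nonneg by (rule mult_left_mono)
    then show ?thesis using load0_growth[of "x n"]
      unfolding sqrt_growth_def by (smt (verit) mult_right_mono real_sqrt_ge_zero)
  qed
  from P_sequence_compact[OF this]
  show "\<exists>l r. strict_mono r \<and> (\<lambda>n. B (x (r n))) \<longlonglongrightarrow> l" by (simp add: B_def)
qed

lemma P_bcontfun_compact: "compact_operator (\<lambda>r. P (apply_bcontfun r))"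
  unfolding compact_operator_def
proof (intro conjI allI impI)
  show "bounded_linear (\<lambda>r. P (apply_bcontfun r))"
  proof (rule bounded_linear_intro)
    show "P (apply_bcontfun (r + s)) = P r + P s" for r s
      using P_add[OF bcontfun_sqrt_growth[of r] bcontfun_sqrt_growth[of s]]
      by (simp add: plus_bcontfun.rep_eq[abs_def])
    show "P (apply_bcontfun (t *\<^sub>R r)) = t *\<^sub>R P r" for t r
      using P_cmult[OF bcontfun_sqrt_growth[of r], of "of_real t"]
      by (simp add: cscale.cs_of_real scaleR_conv_of_real scaleR_bcontfun.rep_eq[abs_def])
    show "norm (P r) \<le> norm r * bP" for r :: "real \<Rightarrow>\<^sub>C complex"
      using P_bound[OF bcontfun_sqrt_growth[of r]] by (simp add: mult.commute)
  qed
  fix x :: "nat \<Rightarrow> real \<Rightarrow>\<^sub>C complex" assume "bounded (range x)"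
  then obtain M where M: "\<And>n. norm (x n) \<le> M" by (auto simp: bounded_iff)
  have "0 \<le> M" by (rule order_trans[OF norm_ge_zero M[of 0]])
  then have "sqrt_growth (apply_bcontfun (x n)) M" for n
    using order_trans[OF norm_bounded M] by (intro bounded_sqrt_growth bcontfun_meas) auto
  from P_sequence_compact[of "\<lambda>n. apply_bcontfun (x n)", OF this]
  show "\<exists>l r. strict_mono r \<and> (\<lambda>n. P (apply_bcontfun (x (r n)))) \<longlonglongrightarrow> l" .
qed

lemma P_bounded_linear: "bounded_linear (\<lambda>r. P (apply_bcontfun r))"
  using P_bcontfun_compact by (simp add: compact_operator_def)

text \<open>The variational problem is equivalent to a fixed point equation for the fractional
  derivative of the solution.\<close>

lemma variational_iff:
  assumes f: "L2 f" and w: "w \<in> W"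
  shows "(\<forall>\<phi>\<in>W. Aform \<alpha> q p w \<phi> = ip f \<phi>) \<longleftrightarrow> aeq (wd w) (dens (load q p f (rl \<alpha> (wd w))))"
proof -
  note V = Vspace_wd[OF W_Vspace[OF w]]
  define F where "F = load q p f (rl \<alpha> (wd w))"
  obtain M where M: "M \<ge> 0" "\<And>x. x \<in> {0..1} \<Longrightarrow> norm (rl \<alpha> (wd w) x) \<le> M"
    using rl_L2_bounded[OF V(1)] by blast
  have "\<exists>N. sqrt_growth F N"
    unfolding F_def using load_sqrt_growth[OF L2_sqrt_growth[OF q] L2_sqrt_growth[OF p] L2_sqrt_growth[OF f] rl_meas M(2,1)] V(1)
    by (auto simp: L2_def)
  then obtain N where F: "sqrt_growth F N" ..
  have c: "continuous_on {0..1} (primitive F)" by (rule continuous_on_primitive[OF F])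
  have cL: "L2 (primitive F)" by (rule L2_continuous[OF c])
  have PL: "L2 (Pr (primitive F))" by (intro G_L2 Pr_G c)
  have dL: "L2 (dens F)" by (rule dens_L2[OF F])
  have res: "Aform \<alpha> q p w \<phi> - ip f \<phi> = ip (\<lambda>t. wd w t - primitive F t) (wd \<phi>)" if "\<phi> \<in> W" for \<phi>
    unfolding F_def by (rule Aform_residual[OF q p f W_Vspace[OF w] W_Vspace[OF that]])
  \<comment> \<open>Against mean-zero elements of \<open>G\<close> neither the projection nor the
    subtraction of a constant is visible, so \<open>dens F\<close> may replace
    \<open>primitive F\<close>.\<close>
  have key: "ip (\<lambda>t. dens F t - primitive F t) g = 0" if g: "g \<in> G" "primitive g 1 = 0" for g
  proof -
    have gL: "L2 g" by (rule G_L2[OF g(1)])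
    have "ip (\<lambda>t. dens F t - primitive F t) g = ip (dens F) g - ip (primitive F) g"
      by (rule ip_diff_left[OF dL cL gL])
    also have "ip (dens F) g = ip (Pr (primitive F)) g - ip (\<lambda>_. primitive (primitive F) 1) g"
      unfolding dens_def[abs_def] by (rule ip_diff_left[OF PL _ gL]) (intro L2_continuous continuous_intros)
    also have "ip (\<lambda>_. primitive (primitive F) 1) g = 0" by (simp add: ip_const_left g(2))
    also have "ip (Pr (primitive F)) g = ip (primitive F) g"
      using Pr_orth[OF c g(1)] ip_diff_left[OF cL PL gL] by simp
    finally show ?thesis by simp
  qed
  show ?thesis unfolding F_def[symmetric]
  proof
    assume "aeq (wd w) (dens F)"
    then have ae: "aeq (\<lambda>t. wd w t - primitive F t) (\<lambda>t. dens F t - primitive F t)"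
      unfolding aeq_def by eventually_elim auto
    show "\<forall>\<phi>\<in>W. Aform \<alpha> q p w \<phi> = ip f \<phi>"
    proof
      fix \<phi> assume \<phi>: "\<phi> \<in> W"
      note V' = Vspace_wd[OF W_Vspace[OF \<phi>]]
      have "ip (\<lambda>t. wd w t - primitive F t) (wd \<phi>) = ip (\<lambda>t. dens F t - primitive F t) (wd \<phi>)"
        using L2_minus[OF V(1) cL] L2_minus[OF dL cL] V'(1) by (intro ip_aeq_left[OF ae]) (auto simp: L2_def)
      also have "\<dots> = 0" by (rule key[OF W_G[OF \<phi>] V'(3)])
      finally show "Aform \<alpha> q p w \<phi> = ip f \<phi>" using res[OF \<phi>] by simp
    qed
  next
    assume sol: "\<forall>\<phi>\<in>W. Aform \<alpha> q p w \<phi> = ip f \<phi>"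
    \<comment> \<open>The difference itself is a mean-zero element of \<open>G\<close>, so its
      primitive is an admissible test function, and testing with it shows that g has norm
      zero.\<close>
    define g where "g t = wd w t - dens F t" for t
    have g: "g \<in> G" unfolding g_def[abs_def] by (intro G_diff W_G w dens_G[OF F])
    have gL: "L2 g" by (rule G_L2[OF g])
    have g0: "primitive g 1 = 0"
      unfolding g_def[abs_def] using V(3) dens_mean[OF F]
      by (subst primitive_minus) (auto intro: L2_intg V dL)
    have \<phi>: "primitive g \<in> W" by (rule G_W[OF g g0])
    have wdg: "aeq (wd (primitive g)) g"
      by (rule VspaceI(2)[OF gL g0]) (auto intro: L2_continuous continuous_on_primitive[OF L2_sqrt_growth[OF gL]])
    have "0 = ip (\<lambda>t. wd w t - primitive F t) (wd (primitive g))" using res[OF \<phi>] sol \<phi> by simp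
    also have "\<dots> = ip (\<lambda>t. wd w t - primitive F t) g"
      using L2_minus[OF V(1) cL] gL Vspace_wd(1)[OF W_Vspace[OF \<phi>]]
      by (intro ip_aeq_right[OF wdg]) (auto simp: L2_def)
    finally have 1: "ip (\<lambda>t. wd w t - primitive F t) g = 0" by simp
    have "ip g g = ip (\<lambda>t. (wd w t - primitive F t) - (dens F t - primitive F t)) g"
      by (rule arg_cong[where f = "\<lambda>h. ip h g"]) (auto simp: g_def)
    also have "\<dots> = 0"
      using ip_diff_left[OF L2_minus[OF V(1) cL] L2_minus[OF dL cL] gL] 1 key[OF g g0] by simp
    finally have "aeq g (\<lambda>_. 0)" by (rule ip_self_zero[OF gL])
    then show "aeq (wd w) (dens F)" unfolding aeq_def by eventually_elim (auto simp: g_def)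
  qed
qed

lemma solution_fixpoint:
  assumes f: "L2 f" and w: "w \<in> W" "\<forall>\<phi>\<in>W. Aform \<alpha> q p w \<phi> = ip f \<phi>"
  obtains r where "r - B r = - P f" "\<And>x. x \<in> {0..1} \<Longrightarrow> RL \<alpha> w x = apply_bcontfun r x"
proof -
  note V = Vspace_wd[OF W_Vspace[OF w(1)]]
  define F where "F = load q p f (rl \<alpha> (wd w))"
  obtain M where M: "M \<ge> 0" "\<And>x. x \<in> {0..1} \<Longrightarrow> norm (rl \<alpha> (wd w) x) \<le> M"
    using rl_L2_bounded[OF V(1)] by blast
  have "\<exists>N. sqrt_growth F N"
    unfolding F_def using load_sqrt_growth[OF L2_sqrt_growth[OF q] L2_sqrt_growth[OF p] L2_sqrt_growth[OF f] rl_meas M(2,1)] V(1)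
    by (auto simp: L2_def)
  then obtain N where F: "sqrt_growth F N" ..
  have ae: "aeq (wd w) (dens F)" using variational_iff[OF f w(1)] w(2) by (simp add: F_def)
  define r where "r = P F"
  have eq: "rl \<alpha> (wd w) x = r x" if "x \<in> {0..1}" for x
    using rl_aeq[OF ae _ dens_meas[OF F] that] V(1) P_unit[OF F that] by (simp add: r_def L2_def)
  \<comment> \<open>F was formed with the fractional derivative of w, which agrees with r only on
    the unit interval.\<close>
  have "P F = P (load q p f r)"
  proof (rule P_cong)
    show "aeq F (load q p f r)" by (rule aeqI) (simp add: F_def load_def eq)
    show "meas F" by (rule set_integrable_imp_meas[OF sqrt_growth_intg[OF F]])
    show "meas (load q p f r)" by (rule set_integrable_imp_meas[OF sqrt_growth_intg[OF load_growth[OF L2_sqrt_growth[OF f]]]])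
  qed
  then have "r = B r - P f" using P_load[OF L2_sqrt_growth[OF f], of r] by (simp add: r_def)
  then have "r - B r = - P f" by (simp add: algebra_simps)
  moreover have "RL \<alpha> w x = r x" if "x \<in> {0..1}" for x using eq[OF that] by (simp add: RL_eq_rl)
  ultimately show ?thesis using that by blast
qed

text \<open>Integrating the density behind r recovers the solution. With
  \<open>solution_fixpoint\<close> this turns existence and uniqueness for the variational problem
  into bijectivity of 1 - B.\<close>

lemma fixpoint_solution:
  assumes f: "L2 f" and r: "r - B r = - P f"
  obtains w where "w \<in> W" "\<forall>\<phi>\<in>W. Aform \<alpha> q p w \<phi> = ip f \<phi>" "\<And>x. x \<in> {0..1} \<Longrightarrow> RL \<alpha> w x = apply_bcontfun r x"
proof -
  define F where "F = load q p f (apply_bcontfun r)"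
  have F: "sqrt_growth F (NB * norm r + l2norm f)" unfolding F_def by (rule load_growth[OF L2_sqrt_growth[OF f]])
  have "B r - P f = r" using r by (simp add: algebra_simps)
  then have rP: "r = P F" using P_load[OF L2_sqrt_growth[OF f], of r] by (simp add: F_def)
  define g where "g = dens F"
  have g: "g \<in> G" "L2 g" "primitive g 1 = 0"
    unfolding g_def by (rule dens_G[OF F] dens_L2[OF F] dens_mean[OF F])+
  define w where "w = primitive g"
  have w: "w \<in> W" unfolding w_def by (rule G_W[OF g(1,3)])
  have wdg: "aeq (wd w) g"
    unfolding w_def by (rule VspaceI(2)[OF g(2,3)]) (auto intro: L2_continuous continuous_on_primitive[OF L2_sqrt_growth[OF g(2)]])
  have wL: "meas (wd w)" using Vspace_wd(1)[OF W_Vspace[OF w]] by (simp add: L2_def)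
  have eq: "rl \<alpha> (wd w) x = r x" if "x \<in> {0..1}" for x
    using rl_aeq[OF wdg wL _ that] g(2) P_unit[OF F that] rP by (simp add: L2_def g_def)
  have ld: "load q p f (rl \<alpha> (wd w)) x = F x" if "x \<in> {0..1}" for x
    using eq[OF that] eq[of 1] by (simp add: load_def F_def)
  have "dens (load q p f (rl \<alpha> (wd w))) = dens F"
  proof -
    have pe: "primitive (load q p f (rl \<alpha> (wd w))) t = primitive F t" if "t \<in> {0..1}" for t
      unfolding primitive_def by (rule set_lebesgue_integral_cong) (use ld that in auto)
    have "primitive (primitive (load q p f (rl \<alpha> (wd w)))) 1 = primitive (primitive F) 1"
      unfolding primitive_def[of "primitive _"] by (rule set_lebesgue_integral_cong) (use pe in auto)
    then show ?thesis using Pr_cong[OF pe] by (simp add: dens_def fun_eq_iff)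
  qed
  then have "\<forall>\<phi>\<in>W. Aform \<alpha> q p w \<phi> = ip f \<phi>"
    using variational_iff[OF f w] wdg by (simp add: g_def)
  then show ?thesis using that w eq by (simp add: RL_eq_rl)
qed

end

subsection \<open>The solution operator and its generalized eigenvectors\<close>

lemma L2_cong:
  assumes eq: "\<And>x. x \<in> {0..1} \<Longrightarrow> f x = g x" and g: "L2 g" shows "L2 f"
proof -
  have "indicat_real {0..1} x *\<^sub>R f x = indicat_real {0..1} x *\<^sub>R g x" for x
    by (cases "x \<in> {0..1}") (simp_all add: eq)
  moreover have "indicat_real {0..1} x *\<^sub>R (norm (f x))^2 = indicat_real {0..1} x *\<^sub>R (norm (g x))^2" for x
    by (cases "x \<in> {0..1}") (simp_all add: eq)
  ultimately show ?thesis
    using g by (simp only: L2_def set_borel_measurable_def set_integrable_def)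
qed

lemma powr_lipschitz:
  fixes \<mu> x y :: real
  assumes \<mu>: "1 \<le> \<mu>" and xy: "0 \<le> x" "x \<le> y" "y \<le> 1"
  shows "\<bar>y powr \<mu> - x powr \<mu>\<bar> \<le> \<mu> * (y - x)"
proof (cases "x = y")
  case False
  then have lt: "x < y" using xy by simp
  have "continuous_on {x..y} (\<lambda>t. t powr \<mu>)"
    using xy \<mu> by (intro continuous_on_powr' continuous_intros) auto
  moreover have "((\<lambda>t. t powr \<mu>) has_derivative (\<lambda>h. h * (\<mu> * t powr (\<mu> - 1)))) (at t)" if "x < t" "t < y" for t
    using has_real_derivative_powr[of t \<mu>] that xy by (simp add: has_field_derivative_def mult_commute_abs)
  ultimately obtain t where t: "x < t" "t < y" "y powr \<mu> - x powr \<mu> = (y - x) * (\<mu> * t powr (\<mu> - 1))"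
    using mvt[OF lt, of "\<lambda>t. t powr \<mu>" "\<lambda>t h. h * (\<mu> * t powr (\<mu> - 1))"] by blast
  have "t powr (\<mu> - 1) \<le> 1 powr (\<mu> - 1)" using t xy \<mu> by (intro powr_mono2) auto
  then have "\<mu> * t powr (\<mu> - 1) \<le> \<mu>" using \<mu> by (simp add: mult_left_le)
  then have "(y - x) * (\<mu> * t powr (\<mu> - 1)) \<le> (y - x) * \<mu>" using lt by (intro mult_left_mono) auto
  moreover have "0 \<le> (y - x) * (\<mu> * t powr (\<mu> - 1))" using lt \<mu> by (intro mult_nonneg_nonneg) auto
  ultimately show ?thesis unfolding t(3) by (simp add: mult.commute)
qed simp

definition powr_fun :: "real \<Rightarrow> real \<Rightarrow>\<^sub>C complex" where
  "powr_fun \<mu> = extend (\<lambda>x. of_real (x powr \<mu>))"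

lemma powr_fun_unit:
  assumes "1 \<le> \<mu>" "x \<in> {0..1}" shows "apply_bcontfun (powr_fun \<mu>) x = of_real (x powr \<mu>)"
  unfolding powr_fun_def using assms
  by (intro extend_unit continuous_intros continuous_on_powr') auto

text \<open>\<open>Sop\<close> expressed through the fractional derivative r of w.\<close>

definition corrected :: "real \<Rightarrow> (real \<Rightarrow>\<^sub>C complex) \<Rightarrow> real \<Rightarrow>\<^sub>C complex" where
  "corrected \<mu> r = r - cscale (r 1) (powr_fun \<mu>)"

lemma corrected_norm: "norm (corrected \<mu> r) \<le> (1 + norm (powr_fun \<mu>)) * norm r"
proof -
  have "norm (corrected \<mu> r) \<le> norm r + norm (r 1) * norm (powr_fun \<mu>)"
    unfolding corrected_def by (rule order_trans[OF norm_triangle_ineq4]) (simp add: cscale.norm_cs)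
  also have "norm (r 1) * norm (powr_fun \<mu>) \<le> norm r * norm (powr_fun \<mu>)"
    by (intro mult_right_mono norm_bounded) auto
  finally show ?thesis by (simp add: algebra_simps)
qed

lemma corrected_bounded_linear: "bounded_linear (corrected \<mu>)"
proof (rule bounded_linear_intro)
  show "corrected \<mu> (r + s) = corrected \<mu> r + corrected \<mu> s" for r s
    by (rule bcontfun_eqI) (simp add: corrected_def algebra_simps)
  show "corrected \<mu> (t *\<^sub>R r) = t *\<^sub>R corrected \<mu> r" for t r
    by (rule bcontfun_eqI) (simp add: corrected_def scaleR_conv_of_real algebra_simps)
  show "norm (corrected \<mu> r) \<le> norm r * (1 + norm (powr_fun \<mu>))" for r
    using corrected_norm[of \<mu> r] by (simp add: mult.commute)
qed

lemma corrected_cscale: "corrected \<mu> (cscale c r) = cscale c (corrected \<mu> r)"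
  by (rule bcontfun_eqI) (simp add: corrected_def algebra_simps)

locale galerkin_solvable = galerkin \<alpha> q p W G Pr
  for \<alpha> q p W G Pr +
  fixes \<mu> :: real
  assumes inj: "r - B r = 0 \<Longrightarrow> r = 0" and \<mu>: "1 \<le> \<mu>"
begin

sublocale I_B: compact_perturbation B
  by unfold_locales (rule B_compact)

lemma lower_bound: "\<exists>c>0. \<forall>r. c * norm r \<le> norm (r - B r)"
  using I_B.bounded_below[of UNIV] inj by (auto simp: I_B.L_def)

text \<open>The Fredholm alternative for the compact operator B.\<close>

lemma surj_I_B: "\<exists>!r. r - B r = s"
proof -
  have "I_B.L ` UNIV = UNIV"
    by (rule I_B.injective_imp_surjective) (use inj in \<open>auto simp: I_B.L_def\<close>)
  then obtain r where r: "r - B r = s" by (metis I_B.L_def UNIV_I image_iff)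
  have "t = r" if "t - B t = s" for t
  proof -
    have "(t - r) - B (t - r) = (t - B t) - (r - B r)" by (simp add: I_B.H.diff)
    then have "(t - r) - B (t - r) = 0" using that r by simp
    then show ?thesis using inj by fastforce
  qed
  with r show ?thesis by blast
qed

definition A :: "(real \<Rightarrow>\<^sub>C complex) \<Rightarrow> real \<Rightarrow>\<^sub>C complex" where
  "A s = (THE r. r - B r = s)"

lemma A_eq: "A s - B (A s) = s"
  unfolding A_def by (rule theI') (rule surj_I_B)

lemma A_unique: "r - B r = s \<Longrightarrow> A s = r"
  using surj_I_B A_eq by blast

lemma A_bounded_linear: "bounded_linear A"
proof -
  obtain c where c: "c > 0" "\<And>r. c * norm r \<le> norm (r - B r)" using lower_bound by blast
  show ?thesis
  proof (rule bounded_linear_intro)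
    show "A (s + t) = A s + A t" for s t
    proof (rule A_unique)
      have "A s + A t - B (A s + A t) = (A s - B (A s)) + (A t - B (A t))" by (simp add: I_B.H.add)
      then show "A s + A t - B (A s + A t) = s + t" by (simp only: A_eq)
    qed
    show "A (x *\<^sub>R s) = x *\<^sub>R A s" for x s
      by (rule A_unique) (use A_eq[of s] in \<open>simp add: I_B.H.scaleR scaleR_diff_right[symmetric]\<close>)
    show "norm (A s) \<le> norm s * (1 / c)" for s
      using c(2)[of "A s"] c(1) by (simp add: A_eq field_simps)
  qed
qed

lemma A_cscale: "A (cscale c s) = cscale c (A s)"
proof (rule A_unique)
  have "cscale c (A s) - B (cscale c (A s)) = cscale c (A s - B (A s))"
    by (simp add: B_cscale linear_simps(2)[OF cscale.bl_cs])
  then show "cscale c (A s) - B (cscale c (A s)) = cscale c s" by (simp add: A_eq)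
qed

definition rsol :: "(real \<Rightarrow> complex) \<Rightarrow> real \<Rightarrow>\<^sub>C complex" where
  "rsol f = A (- P f)"

text \<open>ST with values in C[0,1]. Its argument is a plain function so that it accepts L2 data;
  \<open>K\<close> is its restriction to C[0,1].\<close>

definition Kop :: "(real \<Rightarrow> complex) \<Rightarrow> real \<Rightarrow>\<^sub>C complex" where
  "Kop f = corrected \<mu> (rsol f)"

abbreviation K :: "(real \<Rightarrow>\<^sub>C complex) \<Rightarrow> real \<Rightarrow>\<^sub>C complex" where
  "K r \<equiv> Kop (apply_bcontfun r)"

lemma rsol_eq: "rsol f - B (rsol f) = - P f"
  unfolding rsol_def by (rule A_eq)

lemma K_compact: "compact_operator (\<lambda>r. K r)"
proof -
  have "bounded_linear (\<lambda>s. corrected \<mu> (A (- s)))"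
    by (intro bounded_linear_compose[OF corrected_bounded_linear] bounded_linear_compose[OF A_bounded_linear]
      bounded_linear_minus bounded_linear_ident)
  from compact_operator_left[OF this P_bcontfun_compact]
  show ?thesis by (simp add: Kop_def rsol_def)
qed

lemma K_bounded_linear: "bounded_linear (\<lambda>r. K r)"
  using K_compact by (simp add: compact_operator_def)

lemma K_cscale: "K (cscale c r) = cscale c (K r)"
proof -
  have "apply_bcontfun (cscale c r) = (\<lambda>x. c * r x)" by auto
  then have "P (apply_bcontfun (cscale c r)) = cscale c (P r)"
    by (simp add: P_cmult[OF bcontfun_sqrt_growth])
  moreover have "- cscale c s = cscale c (- s)" for s by (rule bcontfun_eqI) simp
  ultimately show ?thesis by (simp add: Kop_def rsol_def A_cscale corrected_cscale)
qed

lemma Kop_bound: "\<exists>C>0. \<forall>f N. sqrt_growth f N \<longrightarrow> norm (rsol f) \<le> C * N \<and> norm (Kop f) \<le> C * N"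
proof -
  obtain a where a: "a > 0" "\<And>s. norm (A s) \<le> norm s * a"
    using bounded_linear.pos_bounded[OF A_bounded_linear] by blast
  obtain b where b: "b > 0" "\<And>s. norm (corrected \<mu> s) \<le> norm s * b"
    using bounded_linear.pos_bounded[OF corrected_bounded_linear] by blast
  have 1: "norm (rsol f) \<le> a * bP * N" if "sqrt_growth f N" for f N
  proof -
    have "norm (rsol f) \<le> norm (P f) * a" using a(2)[of "- P f"] by (simp add: rsol_def)
    also have "\<dots> \<le> bP * N * a" using P_bound[OF that] a(1) by (intro mult_right_mono) auto
    finally show ?thesis by (simp add: mult_ac)
  qed
  have 2: "norm (Kop f) \<le> b * (a * bP * N)" if "sqrt_growth f N" for f N
  proof -
    have "norm (Kop f) \<le> norm (rsol f) * b" unfolding Kop_def by (rule b(2))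
    also have "\<dots> \<le> (a * bP * N) * b" using 1[OF that] b(1) by (intro mult_right_mono) auto
    finally show ?thesis by (simp add: mult.commute)
  qed
  have "norm (rsol f) \<le> (a * bP + b * (a * bP)) * N \<and> norm (Kop f) \<le> (a * bP + b * (a * bP)) * N"
    if f: "sqrt_growth f N" for f N
  proof -
    have "0 \<le> a * bP * N" "0 \<le> b * (a * bP * N)"
      using sqrt_growth_nonneg[OF f] a b bP_pos by auto
    then show ?thesis using 1[OF f] 2[OF f] by (simp add: algebra_simps)
  qed
  moreover have "a * bP + b * (a * bP) > 0" using a(1) b(1) bP_pos by (simp add: add_pos_pos)
  ultimately show ?thesis by blast
qed

lemma Kop_cong: "aeq f g \<Longrightarrow> meas f \<Longrightarrow> meas g \<Longrightarrow> Kop f = Kop g"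
  unfolding Kop_def rsol_def using P_cong[of f g] by simp

definition STop :: "(real \<Rightarrow> complex) \<Rightarrow> real \<Rightarrow> complex" where
  "STop f = Sop \<alpha> \<mu> (Tsol \<alpha> q p W f)"

text \<open>\<open>Tsol\<close> picks a solution by choice, yet every solution has a fractional
  derivative satisfying the same uniquely solvable fixed point equation. Hence the choice does not
  affect the values on [0,1].\<close>

lemma STop_eq:
  assumes f: "L2 f" and x: "x \<in> {0..1}"
  shows "STop f x = Kop f x"
proof -
  define w where "w = Tsol \<alpha> q p W f"
  obtain w0 where "w0 \<in> W" "\<forall>\<phi>\<in>W. Aform \<alpha> q p w0 \<phi> = ip f \<phi>"
    by (rule fixpoint_solution[OF f rsol_eq])
  then have w: "w \<in> W \<and> (\<forall>\<phi>\<in>W. Aform \<alpha> q p w \<phi> = ip f \<phi>)"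
    unfolding w_def Tsol_def by (intro someI[of "\<lambda>w. w \<in> W \<and> (\<forall>\<phi>\<in>W. Aform \<alpha> q p w \<phi> = ip f \<phi>)"]) auto
  obtain r where r: "r - B r = - P f" "\<forall>x\<in>{0..1}. RL \<alpha> w x = apply_bcontfun r x"
    by (rule solution_fixpoint[OF f conjunct1[OF w] conjunct2[OF w]], rule that, assumption, simp)
  have "rsol f = r" unfolding rsol_def by (rule A_unique[OF r(1)])
  then show ?thesis
    using r(2) x powr_fun_unit[OF \<mu> x]
    by (simp add: STop_def Sop_def w_def[symmetric] Kop_def corrected_def)
qed

definition shift :: "complex \<Rightarrow> (real \<Rightarrow>\<^sub>C complex) \<Rightarrow> real \<Rightarrow>\<^sub>C complex" where
  "shift z r = cscale z r - K r"

lemma shifted_transfer: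
  assumes u: "L2 u" "aeq u (apply_bcontfun \<phi>)"
  shows "L2 (shifted STop z u)" "aeq (shifted STop z u) (apply_bcontfun (shift z \<phi>))"
proof -
  have eq: "shifted STop z u x = z * u x - Kop u x" if "x \<in> {0..1}" for x
    using STop_eq[OF u(1) that] by (simp add: shifted_def)
  have L: "L2 (\<lambda>x. z * u x - Kop u x)" by (intro L2_minus L2_cmult u bcontfun_L2)
  show "L2 (shifted STop z u)" by (rule L2_cong[OF eq L])
  have K: "Kop u = K \<phi>" using u by (intro Kop_cong bcontfun_meas) (auto simp: L2_def)
  show "aeq (shifted STop z u) (apply_bcontfun (shift z \<phi>))"
    using u(2) unfolding aeq_def by eventually_elim (auto simp: eq K shift_def)
qed

lemma shifted_power_transfer:
  assumes u: "L2 u" "aeq u (apply_bcontfun \<phi>)"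
  shows "L2 ((shifted STop z ^^ n) u) \<and> aeq ((shifted STop z ^^ n) u) (apply_bcontfun ((shift z ^^ n) \<phi>))"
proof (induction n)
  case (Suc n)
  then show ?case
    using shifted_transfer[of "(shifted STop z ^^ n) u" "(shift z ^^ n) \<phi>" z] by simp
qed (use u in simp)

text \<open>With v = z u - ST u one has u = (v + Kop u) / z almost everywhere. By induction v has a
  continuous representative, and \<open>Kop u\<close> is continuous, so u has one too; dividing by z
  is where z \<noteq> 0 matters.\<close>

lemma nullsp_representative:
  assumes z: "z \<noteq> 0"
  shows "u \<in> nullsp STop z n \<Longrightarrow> \<exists>\<phi>. aeq u (apply_bcontfun \<phi>) \<and> (shift z ^^ n) \<phi> = 0"
proof (induction n arbitrary: u)
  case 0
  then show ?case by (intro exI[of _ 0]) (auto simp: nullsp_def)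
next
  case (Suc n)
  let ?v = "shifted STop z u"
  have u: "L2 u" using Suc.prems by (simp add: nullsp_def)
  have eq: "?v x = z * u x - Kop u x" if "x \<in> {0..1}" for x
    using STop_eq[OF u that] by (simp add: shifted_def)
  have v: "L2 ?v"
  proof -
    have L: "L2 (\<lambda>x. z * u x - Kop u x)" by (intro L2_minus L2_cmult u bcontfun_L2)
    show ?thesis by (rule L2_cong[OF eq L])
  qed
  have "?v \<in> nullsp STop z n"
    using Suc.prems v by (simp add: nullsp_def funpow_swap1)
  then obtain \<psi> where \<psi>: "aeq ?v (apply_bcontfun \<psi>)" "(shift z ^^ n) \<psi> = 0" using Suc.IH by blast
  define \<phi> where "\<phi> = cscale (1 / z) (\<psi> + Kop u)"
  have ae: "aeq u (apply_bcontfun \<phi>)"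
    using \<psi>(1) unfolding aeq_def by eventually_elim (use z in \<open>auto simp: eq \<phi>_def field_simps\<close>)
  have "K \<phi> = Kop u" using ae u by (intro Kop_cong[symmetric] bcontfun_meas) (auto simp: L2_def)
  then have "shift z \<phi> = \<psi>" using z by (intro bcontfun_eqI) (simp add: shift_def \<phi>_def)
  then have "(shift z ^^ Suc n) \<phi> = 0" using \<psi>(2) by (simp add: funpow_swap1)
  with ae show ?case by blast
qed

lemma kernel_in_nullsp:
  assumes "(shift z ^^ n) \<phi> = 0" shows "apply_bcontfun \<phi> \<in> nullsp STop z n"
  using shifted_power_transfer[where u = "apply_bcontfun \<phi>" and \<phi> = \<phi> and z = z and n = n] assms
  by (auto simp: nullsp_def bcontfun_L2 aeqI)

lemma eigenvalue_representative:
  assumes z: "z \<noteq> 0" and ev: "is_eigenvalue STop z"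
  obtains \<phi> where "\<phi> \<noteq> 0" "shift z \<phi> = 0"
proof -
  obtain u where u: "L2 u" "\<not> aeq u (\<lambda>_. 0)" "aeq (STop u) (\<lambda>x. z * u x)"
    using ev by (auto simp: is_eigenvalue_def)
  have "u \<in> nullsp STop z 1"
    using u(1,3) unfolding nullsp_def aeq_def
    by (auto simp: shifted_def elim!: eventually_mono)
  then obtain \<phi> where \<phi>: "aeq u (apply_bcontfun \<phi>)" "(shift z ^^ 1) \<phi> = 0"
    using nullsp_representative[OF z] by blast
  have "\<phi> \<noteq> 0" using \<phi>(1) u(2) by auto
  then show ?thesis using \<phi>(2) that by auto
qed

text \<open>Ascent 0 would make the kernel of z - ST trivial. Positivity is what allows taking
  \<delta>-th roots.\<close>

lemma eigenvalue_imp_ascent_pos: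
  assumes z: "z \<noteq> 0" and ev: "is_eigenvalue STop z" and asc: "ascent STop z d"
  shows "0 < d"
proof (rule ccontr)
  assume "\<not> 0 < d"
  then have eq: "nullsp STop z 0 = nullsp STop z 1" using asc by (simp add: ascent_def)
  obtain \<phi> where \<phi>: "\<phi> \<noteq> 0" "shift z \<phi> = 0" using eigenvalue_representative[OF z ev] .
  have "apply_bcontfun \<phi> \<in> nullsp STop z 0" using kernel_in_nullsp[where z = z and n = 1 and \<phi> = \<phi>] \<phi>(2) eq by simp
  then have "aeq (apply_bcontfun \<phi>) (\<lambda>_. 0)" by (simp add: nullsp_def)
  then have "Kop (apply_bcontfun \<phi>) = Kop (\<lambda>_. 0)"
    by (intro Kop_cong bcontfun_meas continuous_meas continuous_intros)
  also have "\<dots> = 0"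
    using linear_0[OF bounded_linear.linear[OF K_bounded_linear]] by (simp add: zero_bcontfun.rep_eq[abs_def])
  finally have "cscale z \<phi> = 0" using \<phi>(2) by (simp add: shift_def)
  then have "cmod z * norm \<phi> = 0" by (metis cscale.norm_cs norm_zero)
  then show False using z \<phi>(1) by simp
qed

text \<open>Transports the ascent from the L2 null spaces, defined up to null sets, to exact kernels
  in C[0,1].\<close>

lemma ascent_kernel:
  assumes z: "z \<noteq> 0" and asc: "ascent STop z d" and \<phi>: "(shift z ^^ Suc d) \<phi> = 0"
  shows "(shift z ^^ d) \<phi> = 0"
proof -
  define \<psi> where "\<psi> = (shift z ^^ d) \<phi>"
  have "apply_bcontfun \<phi> \<in> nullsp STop z d"
    using kernel_in_nullsp[OF \<phi>] asc by (simp add: ascent_def)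
  then have "aeq ((shifted STop z ^^ d) (apply_bcontfun \<phi>)) (\<lambda>_. 0)" by (simp add: nullsp_def)
  moreover have "aeq ((shifted STop z ^^ d) (apply_bcontfun \<phi>)) (apply_bcontfun \<psi>)"
    using shifted_power_transfer[where u = "apply_bcontfun \<phi>" and \<phi> = \<phi> and z = z and n = d] by (auto simp: \<psi>_def bcontfun_L2 aeqI)
  ultimately have "aeq (apply_bcontfun \<psi>) (\<lambda>_. 0)" using aeq_sym aeq_trans by blast
  \<comment> \<open>Vanishing almost everywhere on [0,1] says nothing about \<psi> elsewhere on the
    line. But \<open>K\<close> sees only [0,1], so K \<psi> = 0, and z \<psi> = K \<psi> then gives
    \<psi> = 0 everywhere.\<close>
  then have "Kop (apply_bcontfun \<psi>) = Kop (\<lambda>_. 0)"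
    by (intro Kop_cong bcontfun_meas continuous_meas continuous_intros)
  also have "\<dots> = 0"
    using linear_0[OF bounded_linear.linear[OF K_bounded_linear]] by (simp add: zero_bcontfun.rep_eq[abs_def])
  finally have "cscale z \<psi> = 0" using \<phi> by (simp add: shift_def \<psi>_def)
  then have "cmod z * norm \<psi> = 0" by (metis cscale.norm_cs norm_zero)
  then show ?thesis using z by (simp add: \<psi>_def)
qed

end

subsection \<open>The continuous problem and its discretizations\<close>

definition half_hoelder :: "(real \<Rightarrow> complex) \<Rightarrow> real \<Rightarrow> bool" where
  "half_hoelder g C \<longleftrightarrow> (\<forall>x y. 0 \<le> x \<longrightarrow> x \<le> y \<longrightarrow> y \<le> 1 \<longrightarrow> norm (g y - g x) \<le> C * sqrt (y - x))"

lemma half_hoelder_add: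
  assumes "half_hoelder f C" "half_hoelder g D" shows "half_hoelder (\<lambda>x. f x + g x) (C + D)"
  unfolding half_hoelder_def
proof (intro allI impI)
  fix x y :: real assume xy: "0 \<le> x" "x \<le> y" "y \<le> 1"
  have "norm (f y + g y - (f x + g x)) \<le> norm (f y - f x) + norm (g y - g x)" by norm
  also have "\<dots> \<le> C * sqrt (y - x) + D * sqrt (y - x)"
    using assms xy by (intro add_mono) (auto simp: half_hoelder_def)
  finally show "norm (f y + g y - (f x + g x)) \<le> (C + D) * sqrt (y - x)" by (simp add: algebra_simps)
qed

lemma half_hoelder_mult:
  assumes f: "half_hoelder f C" "\<And>x. x \<in> {0..1} \<Longrightarrow> norm (f x) \<le> M"
    and g: "half_hoelder g D" "\<And>x. x \<in> {0..1} \<Longrightarrow> norm (g x) \<le> N"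
  shows "half_hoelder (\<lambda>x. f x * g x) (C * N + M * D)"
  unfolding half_hoelder_def
proof (intro allI impI)
  fix x y :: real assume xy: "0 \<le> x" "x \<le> y" "y \<le> 1"
  have 1: "norm (f y - f x) \<le> C * sqrt (y - x)" "norm (g y - g x) \<le> D * sqrt (y - x)"
    using f(1) g(1) xy by (auto simp: half_hoelder_def)
  have 2: "norm (g y) \<le> N" "norm (f x) \<le> M" using f(2) g(2) xy by auto
  have "f y * g y - f x * g x = (f y - f x) * g y + f x * (g y - g x)" by (simp add: algebra_simps)
  also have "norm \<dots> \<le> norm (f y - f x) * norm (g y) + norm (f x) * norm (g y - g x)"
    by (rule order_trans[OF norm_triangle_ineq]) (simp add: norm_mult)
  also have "\<dots> \<le> (C * sqrt (y - x)) * N + M * (D * sqrt (y - x))"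
    using 1 2 order_trans[OF norm_ge_zero 1(1)] order_trans[OF norm_ge_zero 2(2)]
    by (intro add_mono mult_mono) auto
  finally show "norm (f y * g y - f x * g x) \<le> (C * N + M * D) * sqrt (y - x)" by (simp add: algebra_simps)
qed

lemma half_hoelder_cmult: "half_hoelder f C \<Longrightarrow> half_hoelder (\<lambda>x. c * f x) (norm c * C)"
  unfolding half_hoelder_def by (simp add: right_diff_distrib[symmetric] norm_mult mult.assoc mult_left_mono)

lemma half_hoelder_diff:
  assumes "half_hoelder f C" "half_hoelder g D" shows "half_hoelder (\<lambda>x. f x - g x) (C + D)"
  using half_hoelder_add[OF assms(1) half_hoelder_cmult[OF assms(2), of "- 1"]] by simp

lemma half_hoelder_mono: "half_hoelder f C \<Longrightarrow> C \<le> D \<Longrightarrow> half_hoelder f D"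
  unfolding half_hoelder_def by (meson mult_right_mono order_trans real_sqrt_ge_zero diff_ge_0_iff_ge)

lemma half_hoelder_powr_fun: "1 \<le> \<mu> \<Longrightarrow> half_hoelder (apply_bcontfun (powr_fun \<mu>)) \<mu>"
  unfolding half_hoelder_def
proof (intro allI impI)
  fix x y :: real assume \<mu>: "1 \<le> \<mu>" and xy: "0 \<le> x" "x \<le> y" "y \<le> 1"
  have "norm (powr_fun \<mu> y - powr_fun \<mu> x) = \<bar>y powr \<mu> - x powr \<mu>\<bar>"
    using xy \<mu> by (simp add: powr_fun_unit flip: of_real_diff)
  also have "\<dots> \<le> \<mu> * (y - x)" by (rule powr_lipschitz[OF \<mu> xy])
  also have "\<dots> \<le> \<mu> * sqrt (y - x)" using xy \<mu> by (intro mult_left_mono le_sqrt_unit) auto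
  finally show "norm (powr_fun \<mu> y - powr_fun \<mu> x) \<le> \<mu> * sqrt (y - x)" .
qed

lemma H1_half_hoelder:
  assumes "H1 f"
  obtains g C M where "aeq f g" "continuous_on {0..1} g" "half_hoelder g C" "0 \<le> C"
    "\<And>x. x \<in> {0..1} \<Longrightarrow> norm (g x) \<le> M" "0 \<le> M"
proof -
  obtain d c where d: "L2 d" "aeq f (\<lambda>x. c + primitive d x)"
    using assms by (auto simp: H1_def has_wderiv_def aeq_def primitive_def)
  let ?g = "\<lambda>x. c + primitive d x"
  have cont: "continuous_on {0..1} ?g"
    by (intro continuous_intros continuous_on_primitive[OF L2_sqrt_growth[OF d(1)]])
  have "half_hoelder ?g (l2norm d)"
    unfolding half_hoelder_def using sqrt_growth_primitive[OF L2_sqrt_growth[OF d(1)]] by simp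
  moreover obtain M where "M \<ge> 0" "\<And>x. x \<in> {0..1} \<Longrightarrow> norm (?g x) \<le> M"
    using continuous_unit_bounded[OF cont] by metis
  ultimately show ?thesis using that d(2) cont l2norm_nonneg by blast
qed

locale sturm_liouville = frac_order \<alpha> for \<alpha> :: real +
  fixes q p :: "real \<Rightarrow> real" and \<mu> :: real
  assumes q_H1: "H1 (\<lambda>x. of_real (q x))" and p_H1: "H1 (\<lambda>x. of_real (p x))" and \<mu>_ge: "1 \<le> \<mu>"
    and uniq: "\<And>w. w \<in> Vspace \<Longrightarrow> \<forall>v\<in>Vspace. Aform \<alpha> q p w v = 0 \<Longrightarrow> aeq w (\<lambda>_. 0)"
begin

text \<open>Every L2 function of mean zero is the derivative of an element of V, up to null sets, so
  the projection is the identity on [0,1]. Clamping is there because \<open>Pr_cong\<close> asks for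
  equality on the whole line.\<close>

lemma V_galerkin: "galerkin \<alpha> q p Vspace {g. L2 g} (\<lambda>v t. v (unit_clamp t))"
proof
  show "L2 (\<lambda>x. complex_of_real (q x))" "L2 (\<lambda>x. complex_of_real (p x))"
    using q_H1 p_H1 by (auto simp: H1_def)
  show "wd \<phi> \<in> {g. L2 g}" if "\<phi> \<in> Vspace" for \<phi> using Vspace_wd(1)[OF that] by simp
  show "primitive g \<in> Vspace" if "g \<in> {g. L2 g}" "primitive g 1 = 0" for g
    using VspaceI(1)[of g "primitive g"] that
    by (auto intro: L2_continuous continuous_on_primitive[OF L2_sqrt_growth])
  show "(\<lambda>x. g x - g' x) \<in> {g. L2 g}" if "g \<in> {g. L2 g}" "g' \<in> {g. L2 g}" for g g' :: "real \<Rightarrow> complex"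
    using that L2_minus by auto
  show "(\<lambda>_. c) \<in> {g. L2 g}" for c by (simp add: L2_continuous)
  have L: "L2 (\<lambda>t. v (unit_clamp t))" if "continuous_on {0..1} v" for v :: "real \<Rightarrow> complex"
    by (rule L2_cong[OF _ L2_continuous[OF that]]) (simp add: unit_clamp_id)
  show "(\<lambda>t. v (unit_clamp t)) \<in> {g. L2 g}" if "continuous_on {0..1} v" for v using L[OF that] by simp
  show "ip (\<lambda>t. v t - v (unit_clamp t)) g = 0" for v g
  proof -
    have "ip (\<lambda>t. v t - v (unit_clamp t)) g = (LINT x:{0..1::real}|lborel. (0::complex))"
      unfolding ip_def by (rule set_lebesgue_integral_cong) (auto simp: unit_clamp_id)
    then show ?thesis by simp
  qed
  show "norm (v (unit_clamp t)) \<le> 6 * M" if "\<And>t. t \<in> {0..1} \<Longrightarrow> norm (v t) \<le> M" for v :: "real \<Rightarrow> complex" and M t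
    using that[OF unit_clamp_mem, of t] order_trans[OF norm_ge_zero that[OF unit_clamp_mem, of t]] by linarith
  show "(\<lambda>t. v (unit_clamp t)) = (\<lambda>t. v' (unit_clamp t))"
    if "\<And>t. t \<in> {0..1} \<Longrightarrow> v t = v' t" for v v' :: "real \<Rightarrow> complex"
    using that unit_clamp_mem by auto
qed auto

text \<open>A fixed point of B is, on [0,1], the fractional derivative of a solution with zero
  datum. Uniqueness makes that solution vanish, hence its derivative almost everywhere, hence r on
  [0,1].\<close>

lemma V_solvable: "galerkin_solvable \<alpha> q p Vspace {g. L2 g} (\<lambda>v t. v (unit_clamp t)) \<mu>"
proof -
  interpret V: galerkin \<alpha> q p Vspace "{g. L2 g}" "\<lambda>v t. v (unit_clamp t)" by (rule V_galerkin)
  show ?thesis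
  proof
    fix r assume r: "r - V.B r = 0"
    have P0: "V.P (\<lambda>_. 0) = 0"
      using linear_0[OF bounded_linear.linear[OF V.P_bounded_linear]] by (simp add: zero_bcontfun.rep_eq[abs_def])
    have z: "L2 (\<lambda>_. 0)" by (simp add: L2_continuous)
    have r': "r - V.B r = - V.P (\<lambda>_. 0)" using r P0 by simp
    obtain w where w: "w \<in> Vspace" "\<forall>\<phi>\<in>Vspace. Aform \<alpha> q p w \<phi> = ip (\<lambda>_. 0) \<phi>"
      "\<forall>x\<in>{0..1}. RL \<alpha> w x = apply_bcontfun r x"
      by (rule V.fixpoint_solution[OF z r'], rule that, assumption, assumption, simp)
    have "\<forall>\<phi>\<in>Vspace. Aform \<alpha> q p w \<phi> = 0" using w(2) by (simp add: ip_def)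
    then have w0: "aeq w (\<lambda>_. 0)" by (rule uniq[OF w(1)])
    note W = Vspace_wd[OF w(1)]
    have wd0: "aeq (wd w) (\<lambda>_. 0)"
    proof (rule primitive_eq_imp_aeq)
      show "primitive (wd w) x = primitive (\<lambda>_. 0) x" if "x \<in> {0..1}" for x
      proof -
        have "primitive (wd w) x = 0"
          by (rule continuous_aeq_imp_eq[OF continuous_on_primitive[OF L2_sqrt_growth[OF W(1)]] _ aeq_trans[OF aeq_sym[OF W(2)] w0] that]) simp
        then show ?thesis by (simp add: primitive_def)
      qed
    qed (auto intro: L2_intg W z)
    have r0: "r x = 0" if x: "x \<in> {0..1}" for x
    proof -
      have "r x = rl \<alpha> (wd w) x" using w(3) x by (simp add: RL_eq_rl)
      also have "\<dots> = rl \<alpha> (\<lambda>_. 0) x"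
        using W(1) z by (intro rl_aeq[OF wd0 _ _ x]) (auto simp: L2_def)
      finally show ?thesis by (simp add: rl_def)
    qed
    \<comment> \<open>Off the unit interval r is determined by r = B r, as values of B are extended
      by clamping.\<close>
    show "r = 0"
    proof (rule bcontfun_eqI)
      fix x
      have "r x = V.B r x" using r by simp
      also have "\<dots> = V.B r (unit_clamp x)"
        unfolding V.B_def V.P_apply[OF V.load0_growth] by (simp add: unit_clamp_id[OF unit_clamp_mem])
      also have "\<dots> = r (unit_clamp x)" using r by simp
      finally show "r x = (0 :: real \<Rightarrow>\<^sub>C complex) x" using r0[OF unit_clamp_mem] by simp
    qed
  qed (rule \<mu>_ge)
qed

sublocale V: galerkin_solvable \<alpha> q p Vspace "{g. L2 g}" "\<lambda>v t. v (unit_clamp t)" \<mu>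
  by (rule V_solvable)

text \<open>A stability constant of the exact problem, fixed once so that the condition on fine
  meshes and all error constants refer to the same number.\<close>

definition lower :: real where
  "lower = (SOME c. c > 0 \<and> (\<forall>r. c * norm r \<le> norm (r - V.B r)))"

lemma lower: "lower > 0" "lower * norm r \<le> norm (r - V.B r)"
  using someI_ex[OF V.lower_bound] unfolding lower_def by auto

text \<open>The 3 of \<open>rl_oscillation\<close> times the 5 of \<open>proj_error\<close>.\<close>

definition rate :: real where "rate = 15 * c\<alpha>"

lemma rate_pos: "rate > 0" using c\<alpha>_pos by (simp add: rate_def)

end

section \<open>Consistency and stability of the finite element problem\<close>

locale discretization = sturm_liouville \<alpha> q p \<mu> + M: mesh xs for \<alpha> q p \<mu> xs +
  fixes k :: nat
  assumes k: "k \<le> 1"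
begin

abbreviation h :: real where "h \<equiv> meshsize xs"

text \<open>The class of derivatives is closed under almost everywhere equality because
  \<open>wd\<close> of a finite element function is a chosen weak derivative and need not itself be
  piecewise polynomial.\<close>

lemma D_galerkin: "galerkin \<alpha> q p (Vh k xs) {g. L2 g \<and> (\<exists>s\<in>pwpoly k xs. aeq g s)} (proj k xs)"
proof
  show "L2 (\<lambda>x. complex_of_real (q x))" "L2 (\<lambda>x. complex_of_real (p x))"
    using q_H1 p_H1 by (auto simp: H1_def)
  show "\<phi> \<in> Vspace" if "\<phi> \<in> Vh k xs" for \<phi> using M.Vh_derivative[OF that] by blast
  show "wd \<phi> \<in> {g. L2 g \<and> (\<exists>s\<in>pwpoly k xs. aeq g s)}" if "\<phi> \<in> Vh k xs" for \<phi>
    using M.Vh_derivative[OF that] Vspace_wd(1) by blast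
  show "primitive g \<in> Vh k xs" if "g \<in> {g. L2 g \<and> (\<exists>s\<in>pwpoly k xs. aeq g s)}" "primitive g 1 = 0" for g
    using that M.primitive_in_Vh k by blast
  show "(\<lambda>x. g x - g' x) \<in> {g. L2 g \<and> (\<exists>s\<in>pwpoly k xs. aeq g s)}"
    if g: "g \<in> {g. L2 g \<and> (\<exists>s\<in>pwpoly k xs. aeq g s)}" "g' \<in> {g. L2 g \<and> (\<exists>s\<in>pwpoly k xs. aeq g s)}" for g g'
  proof -
    obtain Q Q' where Q: "aeq g (pw xs Q)" "\<And>i. degree (Q i) \<le> k" "aeq g' (pw xs Q')" "\<And>i. degree (Q' i) \<le> k"
      using g by (auto simp: pwpoly_def)
    have "aeq (\<lambda>x. g x - g' x) (pw xs (\<lambda>i. Q i - Q' i))"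
      using Q(1,3) unfolding aeq_def by eventually_elim (auto simp: M.pw_diff[symmetric])
    moreover have "pw xs (\<lambda>i. Q i - Q' i) \<in> pwpoly k xs"
      using Q(2,4) by (auto simp: pwpoly_def intro!: exI[of _ "\<lambda>i. Q i - Q' i"] degree_diff_le)
    ultimately show ?thesis using g L2_minus by auto
  qed
  show "(\<lambda>_. c) \<in> {g. L2 g \<and> (\<exists>s\<in>pwpoly k xs. aeq g s)}" for c
  proof -
    have "aeq (\<lambda>_. c) (pw xs (\<lambda>_. [:c:]))" by (rule aeqI) (simp add: M.pw_const)
    moreover have "pw xs (\<lambda>_. [:c:]) \<in> pwpoly k xs" by (auto simp: pwpoly_def intro!: exI[of _ "\<lambda>_. [:c:]"])
    ultimately show ?thesis by (auto simp: L2_continuous)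
  qed
  show "proj k xs v \<in> {g. L2 g \<and> (\<exists>s\<in>pwpoly k xs. aeq g s)}" for v
    using M.proj_pwpoly[of k v] M.pw_L2 by (auto simp: proj_def intro!: aeqI)
  show "ip (\<lambda>t. v t - proj k xs v t) g = 0"
    if v: "continuous_on {0..1} v" and g: "g \<in> {g. L2 g \<and> (\<exists>s\<in>pwpoly k xs. aeq g s)}" for v g
  proof -
    obtain s where s: "s \<in> pwpoly k xs" "aeq g s" "L2 g" using g by auto
    have sm: "meas s" using s(1) M.pw_meas by (auto simp: pwpoly_def)
    have "ip (\<lambda>t. v t - proj k xs v t) g = ip (\<lambda>t. v t - proj k xs v t) s"
      using s(3) by (intro ip_aeq_right[OF s(2) meas_minus[OF continuous_meas[OF v] M.proj_meas] _ sm]) (simp add: L2_def)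
    then show ?thesis using M.proj_orthogonal[OF v s(1) k] by simp
  qed
  show "proj k xs v = proj k xs v'" if "\<And>t. t \<in> {0..1} \<Longrightarrow> v t = v' t" for v v'
    using proj_cong[OF M.mesh that] by auto
qed (auto intro: M.proj_bound M.proj_diff M.proj_cmult)

sublocale D: galerkin \<alpha> q p "Vh k xs" "{g. L2 g \<and> (\<exists>s\<in>pwpoly k xs. aeq g s)}" "proj k xs"
  by (rule D_galerkin)

text \<open>Both densities subtract the same mean, so their difference is exactly the projection
  error, and its smallness together with that of its primitive is what \<open>rl_oscillation\<close>
  asks for.\<close>

lemma P_error:
  assumes F: "sqrt_growth F N"
  defines "d \<equiv> \<lambda>t. primitive F t - proj k xs (primitive F) t"
  assumes d: "\<And>t. t \<in> {0..1} \<Longrightarrow> norm (d t) \<le> M"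
    and pd: "\<And>t. t \<in> {0..1} \<Longrightarrow> norm (primitive d t) \<le> h * M"
  shows "norm (V.P F - D.P F) \<le> c\<alpha> * (3 * M * h powr (\<alpha> - 1))"
proof (rule norm_bound)
  fix x
  define y where "y = unit_clamp x"
  have y: "y \<in> {0..1}" unfolding y_def by (rule unit_clamp_mem)
  have md: "meas d"
    unfolding d_def by (intro meas_minus continuous_meas continuous_on_primitive[OF F] M.proj_meas)
  have "apply_bcontfun (V.P F - D.P F) x = rl \<alpha> (V.dens F) y - rl \<alpha> (D.dens F) y"
    by (simp add: V.P_apply[OF F] D.P_apply[OF F] y_def)
  also have "\<dots> = rl \<alpha> (\<lambda>t. V.dens F t - D.dens F t) y"
    using rl_diff[OF V.dens_meas[OF F] V.dens_bound[OF F] D.dens_meas[OF F] D.dens_bound[OF F] y] by simp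
  also have "\<dots> = rl \<alpha> d y"
    by (rule rl_aeq[OF aeqI meas_minus[OF V.dens_meas[OF F] D.dens_meas[OF F]] md y])
       (simp add: V.dens_def D.dens_def d_def unit_clamp_id)
  also have "norm \<dots> \<le> c\<alpha> * (3 * M * h powr (\<alpha> - 1))"
    by (rule rl_oscillation[OF md d M.meshsize_pos pd y])
  finally show "norm (apply_bcontfun (V.P F - D.P F) x) \<le> c\<alpha> * (3 * M * h powr (\<alpha> - 1))" .
qed

lemma h_powr_half: "h powr (\<alpha> - 1) * sqrt h = h powr (\<alpha> - 1/2)"
  "h powr (\<alpha> - 1) * (h * sqrt h) = h powr (\<alpha> + 1/2)"
proof -
  have s: "sqrt h = h powr (1/2)" using M.meshsize_pos by (simp add: powr_half_sqrt)
  show "h powr (\<alpha> - 1) * sqrt h = h powr (\<alpha> - 1/2)"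
    unfolding s powr_add[symmetric] by (simp add: field_simps)
  have "h powr (\<alpha> - 1) * (h powr 1 * h powr (1/2)) = h powr (\<alpha> + 1/2)"
    unfolding powr_add[symmetric] by (simp add: field_simps)
  then show "h powr (\<alpha> - 1) * (h * sqrt h) = h powr (\<alpha> + 1/2)"
    using M.meshsize_pos by (simp add: s)
qed

lemma P_error_growth:
  assumes F: "sqrt_growth F N"
  shows "norm (V.P F - D.P F) \<le> rate * N * h powr (\<alpha> - 1/2)"
proof -
  note e = M.proj_error_primitive[OF F k]
  have "norm (V.P F - D.P F) \<le> c\<alpha> * (3 * (5 * (N * sqrt h)) * h powr (\<alpha> - 1))"
    by (rule P_error[OF F e])
  also have "\<dots> = rate * N * (h powr (\<alpha> - 1) * sqrt h)" by (simp add: rate_def)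
  finally show ?thesis by (simp only: h_powr_half)
qed

lemma P_error_hoelder:
  assumes F: "sqrt_growth F N'" and k1: "k = 1" and FG: "aeq F g" and g: "continuous_on {0..1} g" "half_hoelder g N"
  shows "norm (V.P F - D.P F) \<le> rate * N * h powr (\<alpha> + 1/2)"
proof -
  have gh: "norm (g y - g x) \<le> N * sqrt (y - x)" if "0 \<le> x" "x \<le> y" "y \<le> 1" for x y
    using g(2) that by (auto simp: half_hoelder_def)
  note e = M.proj_error_primitive_hoelder[OF F FG g(1) gh, folded k1]
  have "norm (V.P F - D.P F) \<le> c\<alpha> * (3 * (5 * (N * (h * sqrt h))) * h powr (\<alpha> - 1))"
    by (rule P_error[OF F e])
  also have "\<dots> = rate * N * (h powr (\<alpha> - 1) * (h * sqrt h))" by (simp add: rate_def)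
  finally show ?thesis by (simp only: h_powr_half)
qed

lemma B_error: "norm (V.B r - D.B r) \<le> rate * (V.NB * norm r) * h powr (\<alpha> - 1/2)"
  unfolding V.B_def D.B_def by (rule P_error_growth[OF V.load0_growth])

end

text \<open>The mesh is so fine that exchanging the two operators B costs at most half of the
  stability constant; the discrete equation keeps the other half.\<close>

locale fine_discretization = discretization +
  assumes fine: "rate * V.NB * meshsize xs powr (\<alpha> - 1/2) \<le> lower / 2"
begin

lemma D_lower: "lower / 2 * norm r \<le> norm (r - D.B r)"
proof -
  have "norm (V.B r - D.B r) \<le> (rate * V.NB * h powr (\<alpha> - 1/2)) * norm r"
    using B_error[of r] by (simp add: algebra_simps)
  also have "\<dots> \<le> lower / 2 * norm r" using fine by (intro mult_right_mono) auto
  finally have "norm (V.B r - D.B r) \<le> lower / 2 * norm r" .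
  moreover have "lower * norm r \<le> norm (r - D.B r) + norm (V.B r - D.B r)"
    using lower(2)[of r] norm_triangle_ineq4[of "r - D.B r" "V.B r - D.B r"] by simp
  ultimately show ?thesis by simp
qed

sublocale S: galerkin_solvable \<alpha> q p "Vh k xs" "{g. L2 g \<and> (\<exists>s\<in>pwpoly k xs. aeq g s)}" "proj k xs" \<mu>
proof
  fix r assume "r - D.B r = 0"
  then have "lower / 2 * norm r \<le> 0" using D_lower[of r] by simp
  then show "r = 0" using lower(1) by (simp add: mult_le_0_iff)
qed (rule \<mu>_ge)

text \<open>For the exact r and the discrete s, applying 1 - D.B to r - s leaves the difference of
  the two operators P on the load of the exact r. Hence only the regularity of the exact solution
  enters the error.\<close>

lemma Kop_error:
  assumes f: "sqrt_growth f N" and e: "norm (V.P (load q p f (V.rsol f)) - D.P (load q p f (V.rsol f))) \<le> e"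
  shows "norm (V.Kop f - S.Kop f) \<le> (1 + norm (powr_fun \<mu>)) * (2 / lower) * e"
proof -
  define r where "r = V.rsol f"
  define s where "s = S.rsol f"
  have r: "r - V.B r = - V.P f" unfolding r_def by (rule V.rsol_eq)
  have s: "s - D.B s = - D.P f" unfolding s_def by (rule S.rsol_eq)
  have "(r - s) - D.B (r - s) = (r - D.B r) - (s - D.B s)" by (simp add: S.I_B.H.diff)
  also have "\<dots> = (r - V.B r) + (V.B r - D.B r) - (s - D.B s)" by simp
  also have "\<dots> = (V.B r - V.P f) - (D.B r - D.P f)" unfolding r s by simp
  also have "\<dots> = V.P (load q p f r) - D.P (load q p f r)"
    by (simp add: V.P_load[OF f] D.P_load[OF f])
  finally have "lower / 2 * norm (r - s) \<le> e" using D_lower[of "r - s"] e by (simp add: r_def)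
  then have rs: "norm (r - s) \<le> 2 / lower * e" using lower(1) by (simp add: field_simps)
  have "V.Kop f - S.Kop f = corrected \<mu> (r - s)"
    by (simp add: V.Kop_def S.Kop_def r_def s_def linear_simps(2)[OF corrected_bounded_linear])
  also have "norm \<dots> \<le> (1 + norm (powr_fun \<mu>)) * norm (r - s)" by (rule corrected_norm)
  also have "\<dots> \<le> (1 + norm (powr_fun \<mu>)) * (2 / lower * e)"
    using rs by (intro mult_left_mono) auto
  finally show ?thesis by (simp only: mult.assoc)
qed

end

section \<open>Powers of the mesh size, scaling, and L2 against supremum norms\<close>

lemma small_powr:
  fixes a e s :: real
  assumes "0 \<le> a" "0 < e" "0 < s"
  shows "\<exists>h0>0. \<forall>h. 0 < h \<longrightarrow> h \<le> h0 \<longrightarrow> a * h powr s \<le> e"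
proof (intro exI conjI allI impI)
  let ?h0 = "(e / (a + 1)) powr (1 / s)"
  show "?h0 > 0" using assms by simp
  fix h :: real assume h: "0 < h" "h \<le> ?h0"
  have "h powr s \<le> ?h0 powr s" using h assms by (intro powr_mono2) auto
  also have "\<dots> = e / (a + 1)" using assms by (simp add: powr_powr)
  finally have "a * h powr s \<le> a * (e / (a + 1))" using assms by (intro mult_left_mono) auto
  also have "\<dots> \<le> e" using assms by (simp add: field_simps)
  finally show "a * h powr s \<le> e" .
qed

lemma le_root_of_power_le:
  fixes x y :: real
  assumes "0 \<le> x" "0 < d" "x ^ d \<le> y"
  shows "x \<le> y powr (1 / real d)"
proof (cases "x = 0")
  case False
  then have x: "x > 0" using assms by simp
  have "x = (x ^ d) powr (1 / real d)"
    unfolding powr_realpow[OF x, symmetric] powr_powr using assms(2) x by simp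
  also have "\<dots> \<le> y powr (1 / real d)" using assms x by (intro powr_mono2) auto
  finally show ?thesis .
qed simp

lemma scaled_power:
  assumes "\<And>c x. T (cscale c x) = cscale c (T x)"
  shows "((\<lambda>x. cscale a (T x)) ^^ n) x = cscale (a ^ n) ((T ^^ n) x)"
proof (induction n)
  case 0 then show ?case by (simp add: cscale.cs_one)
next
  case (Suc n) then show ?case by (simp add: assms cscale.cs_mult)
qed

lemma scaled_power_zero_iff:
  assumes "\<And>c x. T (cscale c x) = cscale c (T x)" "a \<noteq> 0"
  shows "((\<lambda>x. cscale a (T x)) ^^ n) x = 0 \<longleftrightarrow> (T ^^ n) x = 0"
proof -
  have "cscale (a ^ n) y = 0 \<longleftrightarrow> y = 0" for y
    using cscale.norm_cs[of "a ^ n" y] assms(2) by (metis mult_eq_0_iff norm_eq_zero power_not_zero)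
  then show ?thesis by (simp add: scaled_power[OF assms(1)])
qed

lemma l2norm_le_sup:
  fixes v \<phi> :: "real \<Rightarrow>\<^sub>C complex"
  assumes u: "L2 u" and ae: "aeq u (apply_bcontfun \<phi>)"
  shows "l2norm (\<lambda>x. v x - u x) \<le> norm (v - \<phi>)"
proof -
  have L: "L2 (\<lambda>x. v x - u x)" by (intro L2_minus bcontfun_L2 u)
  have "(LINT x:{0..1}|lborel. (norm (v x - u x))^2) \<le> (LINT x:{0..1::real}|lborel. (norm (v - \<phi>))^2)"
  proof (rule set_integral_mono_AE)
    show "set_integrable lborel {0..1} (\<lambda>x. (norm (v x - u x))^2)" using L by (simp add: L2_def)
    show "set_integrable lborel {0..1::real} (\<lambda>x. (norm (v - \<phi>))^2)" by (rule set_integrable_const)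
    show "AE x\<in>{0..1} in lborel. (norm (v x - u x))^2 \<le> (norm (v - \<phi>))^2"
      using ae unfolding aeq_def
    proof eventually_elim
      case (elim x)
      then show ?case using norm_bounded[of "v - \<phi>" x] by (auto intro: power_mono)
    qed
  qed
  also have "\<dots> = (norm (v - \<phi>))^2" by (simp add: set_integral_Icc_const)
  finally show ?thesis using real_sqrt_le_mono by (fastforce simp: l2norm_def)
qed

lemma l2norm_cong_aeq:
  assumes "aeq f g" "meas f" "meas g" shows "l2norm f = l2norm g"
proof -
  have m: "(\<lambda>x. indicat_real {0..1} x *\<^sub>R (norm (f x))^2) \<in> borel_measurable lborel" if "meas f" for f
  proof -
    have "(\<lambda>x. (norm (indicat_real {0..1} x *\<^sub>R f x))^2) \<in> borel_measurable lborel"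
      using that unfolding set_borel_measurable_def by measurable
    then show ?thesis by (rule measurable_cong[THEN iffD1, rotated]) (auto simp: indicator_def)
  qed
  have "(LINT x:{0..1}|lborel. (norm (f x))^2) = (LINT x:{0..1}|lborel. (norm (g x))^2)"
    unfolding set_lebesgue_integral_def
  proof (rule integral_cong_AE)
    show "AE x in lborel. indicat_real {0..1} x *\<^sub>R (norm (f x))^2 = indicat_real {0..1} x *\<^sub>R (norm (g x))^2"
      using assms(1) unfolding aeq_def by eventually_elim (auto simp: indicator_def)
  qed (use m assms in auto)
  then show ?thesis by (simp add: l2norm_def)
qed

context galerkin_solvable
begin

lemma shift_linear: "shift z (cscale c r) = cscale c (shift z r)"
  by (simp add: shift_def K_cscale linear_simps(2)[OF cscale.bl_cs] cscale.cs_mult mult.commute)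

text \<open>From z \<phi> = shift z \<phi> + K \<phi> the supremum norm is controlled by the growth
  constant, one power of the shift at a time; the recursion is this step written out. The bound
  involves only n, a, b and C, so it is uniform in the mesh, and it converts a unit L2 norm into a
  supremum bound.\<close>

lemma kernel_sup_bound:
  assumes C: "0 \<le> C" "\<And>f N. sqrt_growth f N \<Longrightarrow> norm (Kop f) \<le> C * N" and z: "0 < a" "a \<le> cmod z" "cmod z \<le> b"
  shows "(shift z ^^ n) \<phi> = 0 \<Longrightarrow> sqrt_growth (apply_bcontfun \<phi>) N \<Longrightarrow>
    norm \<phi> \<le> rec_nat 0 (\<lambda>_ D. (D * (b + C) + C) / a) n * N"
proof (induction n arbitrary: \<phi> N)
  case 0 then show ?case by simp
next
  case (Suc n)
  define D where "D = rec_nat 0 (\<lambda>_ D. (D * (b + C) + C) / a) n"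
  have b: "0 \<le> b" using z by linarith
  have D: "0 \<le> D" unfolding D_def using C(1) z(1) b by (induction n) auto
  have N: "0 \<le> N" by (rule sqrt_growth_nonneg[OF Suc.prems(2)])
  have Kb: "norm (K \<phi>) \<le> C * N" by (rule C(2)[OF Suc.prems(2)])
  have "sqrt_growth (\<lambda>x. z * \<phi> x - K \<phi> x) (cmod z * N + C * N)"
    using sqrt_growth_minus[OF sqrt_growth_cmult[OF Suc.prems(2), of z]
      bounded_sqrt_growth[OF bcontfun_meas[of "K \<phi>"] order_trans[OF norm_bounded Kb]]] C(1) N by simp
  moreover have "apply_bcontfun (shift z \<phi>) = (\<lambda>x. z * \<phi> x - K \<phi> x)" by (auto simp: shift_def)
  ultimately have g: "sqrt_growth (apply_bcontfun (shift z \<phi>)) (cmod z * N + C * N)" by simp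
  have "norm (shift z \<phi>) \<le> D * (cmod z * N + C * N)"
    unfolding D_def by (rule Suc.IH[OF _ g]) (use Suc.prems(1) in \<open>simp add: funpow_swap1\<close>)
  also have "\<dots> \<le> D * (b * N + C * N)" using D z N by (intro mult_left_mono add_right_mono mult_right_mono) auto
  finally have s: "norm (shift z \<phi>) \<le> D * (b + C) * N" by (simp add: algebra_simps)
  have "cmod z * norm \<phi> = norm (shift z \<phi> + K \<phi>)" by (simp add: shift_def cscale.norm_cs)
  also have "\<dots> \<le> D * (b + C) * N + C * N" using s Kb by (intro order_trans[OF norm_triangle_ineq] add_mono)
  finally have "a * norm \<phi> \<le> D * (b + C) * N + C * N"
    using mult_right_mono[OF z(2) norm_ge_zero[of \<phi>]] by linarith
  then have "norm \<phi> \<le> ((D * (b + C) + C) / a) * N" using z(1) by (simp add: field_simps)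
  then show ?case by (simp add: D_def)
qed

end

section \<open>Error of the discrete operators with constants uniform in the mesh\<close>

context sturm_liouville
begin

text \<open>The fixed point operator depends on the projection alone, not on the spaces, which enter
  through \<open>STop\<close>. The exported constants allow quantification over meshes.\<close>

abbreviation Kh :: "nat \<Rightarrow> real list \<Rightarrow> (real \<Rightarrow> complex) \<Rightarrow> real \<Rightarrow>\<^sub>C complex" where
  "Kh k xs \<equiv> galerkin_solvable.Kop \<alpha> q p (proj k xs) \<mu>"

abbreviation shift_h :: "nat \<Rightarrow> real list \<Rightarrow> complex \<Rightarrow> (real \<Rightarrow>\<^sub>C complex) \<Rightarrow> real \<Rightarrow>\<^sub>C complex" where
  "shift_h k xs \<equiv> galerkin_solvable.shift \<alpha> q p (proj k xs) \<mu>"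

lemma fine_mesh:
  "\<exists>h0>0. \<forall>xs k. is_mesh xs \<longrightarrow> meshsize xs \<le> h0 \<longrightarrow> k \<le> 1 \<longrightarrow> fine_discretization \<alpha> q p \<mu> xs k"
proof -
  obtain h0 where h0: "h0 > 0" "\<And>h. 0 < h \<Longrightarrow> h \<le> h0 \<Longrightarrow> rate * V.NB * h powr (\<alpha> - 1/2) \<le> lower / 2"
    using small_powr[of "rate * V.NB" "lower / 2" "\<alpha> - 1/2"] rate_pos V.NB_nonneg lower(1) \<alpha>_gt by auto
  have "fine_discretization \<alpha> q p \<mu> xs k" if "is_mesh xs" "meshsize xs \<le> h0" "k \<le> 1" for xs k
  proof -
    interpret discretization \<alpha> q p \<mu> xs k by unfold_locales (use that in auto)
    show ?thesis by unfold_locales (rule h0(2)[OF M.meshsize_pos that(2)])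
  qed
  then show ?thesis using h0(1) by blast
qed

lemma V_bound:
  obtains C where "C > 0" "\<And>f N. sqrt_growth f N \<Longrightarrow> norm (V.rsol f) \<le> C * N"
    "\<And>f N. sqrt_growth f N \<Longrightarrow> norm (V.Kop f) \<le> C * N"
  using V.Kop_bound by metis

text \<open>For general data the load has only square root growth, so the exponent is \<alpha> - 1/2
  for both degrees.\<close>

lemma Kh_error:
  "\<exists>C>0. \<forall>xs k. fine_discretization \<alpha> q p \<mu> xs k \<longrightarrow> (\<forall>f N. sqrt_growth f N \<longrightarrow>
      norm (V.Kop f - Kh k xs f) \<le> C * N * meshsize xs powr (\<alpha> - 1/2))"
proof -
  obtain C where C: "C > 0" "\<And>f N. sqrt_growth f N \<Longrightarrow> norm (V.rsol f) \<le> C * N"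
    using V_bound by metis
  define c where "c = (1 + norm (powr_fun \<mu>)) * (2 / lower)"
  have c: "c > 0" using lower(1) by (simp add: c_def add_pos_nonneg)
  have "norm (V.Kop f - Kh k xs f) \<le> (c * rate * (V.NB * C + 1)) * N * meshsize xs powr (\<alpha> - 1/2)"
    if fd: "fine_discretization \<alpha> q p \<mu> xs k" and f: "sqrt_growth f N" for xs k f N
  proof -
    interpret fine_discretization \<alpha> q p \<mu> xs k by (rule fd)
    have "V.NB * norm (V.rsol f) + N \<le> V.NB * (C * N) + N"
      using C(2)[OF f] V.NB_nonneg by (intro add_right_mono mult_left_mono)
    then have "rate * (V.NB * norm (V.rsol f) + N) * h powr (\<alpha> - 1/2) \<le> rate * ((V.NB * C + 1) * N) * h powr (\<alpha> - 1/2)"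
      using rate_pos by (intro mult_right_mono mult_left_mono) (auto simp: algebra_simps)
    then have "norm (V.P (load q p f (V.rsol f)) - D.P (load q p f (V.rsol f))) \<le> rate * ((V.NB * C + 1) * N) * h powr (\<alpha> - 1/2)"
      using P_error_growth[OF V.load_growth[OF f, of "V.rsol f"]] by linarith
    from Kop_error[OF f this] show ?thesis unfolding c_def[symmetric] by (simp only: mult.assoc)
  qed
  moreover have "c * rate * (V.NB * C + 1) > 0"
    using c rate_pos C(1) V.NB_nonneg by (auto intro!: mult_pos_pos add_nonneg_pos)
  ultimately show ?thesis by blast
qed

text \<open>The solution satisfies r = P (load r), and values of P are Hoelder continuous of order
  \<alpha> - 1 > 1/2; on the unit interval this implies order one half.\<close>

lemma rsol_hoelder:
  "\<exists>C\<ge>0. \<forall>\<phi>. half_hoelder (apply_bcontfun (V.rsol (apply_bcontfun \<phi>))) (C * norm \<phi>)"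
proof -
  obtain C where C: "C > 0" "\<And>f N. sqrt_growth f N \<Longrightarrow> norm (V.rsol f) \<le> C * N"
    using V_bound by metis
  define D where "D = c\<alpha> * (14 * (V.NB * C + 1))"
  have D0: "D \<ge> 0" using c\<alpha>_pos V.NB_nonneg C(1) by (simp add: D_def)
  have "half_hoelder (V.rsol (apply_bcontfun \<phi>)) (D * norm \<phi>)" for \<phi>
    unfolding half_hoelder_def
  proof (intro allI impI)
    fix x y :: real assume xy: "0 \<le> x" "x \<le> y" "y \<le> 1"
    define r where "r = V.rsol (apply_bcontfun \<phi>)"
    have f: "sqrt_growth (apply_bcontfun \<phi>) (norm \<phi>)" by (rule bcontfun_sqrt_growth)
    have "r - V.B r = - V.P \<phi>" unfolding r_def by (rule V.rsol_eq)
    then have "V.B r - V.P \<phi> = r" by (simp add: algebra_simps)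
    then have r: "r = V.P (load q p \<phi> r)" using V.P_load[OF f, of r] by simp
    have g: "sqrt_growth (load q p \<phi> r) (V.NB * norm r + norm \<phi>)" by (rule V.load_growth[OF f])
    have "norm (r y - r x) \<le> c\<alpha> * (14 * (V.NB * norm r + norm \<phi>) * (y - x) powr (\<alpha> - 1))"
      using V.P_hoelder[OF g xy] r by simp
    also have "(y - x) powr (\<alpha> - 1) \<le> sqrt (y - x)"
    proof -
      have "(y - x) powr (\<alpha> - 1) \<le> (y - x) powr (1/2)"
        using xy \<alpha>_gt by (intro powr_mono') auto
      then show ?thesis using xy by (simp add: powr_half_sqrt)
    qed
    then have "c\<alpha> * (14 * (V.NB * norm r + norm \<phi>) * (y - x) powr (\<alpha> - 1)) \<le> c\<alpha> * (14 * (V.NB * norm r + norm \<phi>) * sqrt (y - x))"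
      using c\<alpha>_pos V.NB_nonneg by (intro mult_left_mono) auto
    also have "\<dots> \<le> c\<alpha> * (14 * (V.NB * (C * norm \<phi>) + norm \<phi>) * sqrt (y - x))"
      using c\<alpha>_pos V.NB_nonneg C(2)[OF f] xy unfolding r_def[symmetric]
      by (intro mult_left_mono mult_right_mono add_right_mono) auto
    also have "\<dots> = D * norm \<phi> * sqrt (y - x)" by (simp add: D_def algebra_simps)
    finally show "norm (V.rsol (apply_bcontfun \<phi>) y - V.rsol (apply_bcontfun \<phi>) x) \<le> D * norm \<phi> * sqrt (y - x)"
      by (simp add: r_def)
  qed
  then show ?thesis using D0 by blast
qed

lemma K_hoelder: "\<exists>C\<ge>0. \<forall>\<phi>. half_hoelder (apply_bcontfun (V.K \<phi>)) (C * norm \<phi>)"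
proof -
  obtain C where C: "C > 0" "\<And>f N. sqrt_growth f N \<Longrightarrow> norm (V.rsol f) \<le> C * N"
    using V_bound by metis
  obtain D where D: "D \<ge> 0" "\<And>\<phi>. half_hoelder (V.rsol (apply_bcontfun \<phi>)) (D * norm \<phi>)"
    using rsol_hoelder by blast
  have "half_hoelder (V.K \<phi>) ((D + C * \<mu>) * norm \<phi>)" for \<phi>
  proof -
    define r where "r = V.rsol (apply_bcontfun \<phi>)"
    have hh: "half_hoelder (\<lambda>x. r x - r 1 * powr_fun \<mu> x) (D * norm \<phi> + norm (r 1) * \<mu>)"
      unfolding r_def by (intro half_hoelder_diff D(2) half_hoelder_cmult half_hoelder_powr_fun \<mu>_ge)
    have eq: "apply_bcontfun (V.K \<phi>) = (\<lambda>x. r x - r 1 * powr_fun \<mu> x)"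
      by (auto simp: V.Kop_def corrected_def r_def)
    have "norm (r 1) \<le> C * norm \<phi>"
      using norm_bounded[of r 1] C(2)[OF bcontfun_sqrt_growth[of \<phi>]] by (simp add: r_def)
    then have le: "D * norm \<phi> + norm (r 1) * \<mu> \<le> (D + C * \<mu>) * norm \<phi>"
      using \<mu>_ge mult_right_mono[of "norm (r 1)" "C * norm \<phi>" \<mu>] by (simp add: algebra_simps)
    show ?thesis unfolding eq by (rule half_hoelder_mono[OF hh le])
  qed
  moreover have "D + C * \<mu> \<ge> 0" using D(1) C(1) \<mu>_ge by simp
  ultimately show ?thesis by blast
qed

lemma shift_bounded: "bounded_linear (V.shift z)"
  unfolding V.shift_def[abs_def] by (intro bounded_linear_sub cscale.bl_cs V.K_bounded_linear)

text \<open>Bootstrapping: \<phi> = (shift z \<phi> + K \<phi>) / z, where the first summand lies in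
  the kernel of a lower power and the second is Hoelder continuous by
  \<open>K_hoelder\<close>.\<close>

lemma kernel_hoelder:
  assumes z: "z \<noteq> 0"
  shows "\<exists>C\<ge>0. \<forall>\<phi>. (V.shift z ^^ n) \<phi> = 0 \<longrightarrow> half_hoelder (apply_bcontfun \<phi>) (C * norm \<phi>)"
proof (induction n)
  case 0
  show ?case by (intro exI[of _ 0]) (auto simp: half_hoelder_def)
next
  case (Suc n)
  then obtain C where C: "C \<ge> 0" "\<And>\<phi>. (V.shift z ^^ n) \<phi> = 0 \<Longrightarrow> half_hoelder (apply_bcontfun \<phi>) (C * norm \<phi>)" by blast
  obtain D where D: "D \<ge> 0" "\<And>\<phi>. half_hoelder (apply_bcontfun (V.K \<phi>)) (D * norm \<phi>)" using K_hoelder by blast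
  obtain b where b: "b > 0" "\<And>x. norm (V.shift z x) \<le> norm x * b"
    using bounded_linear.pos_bounded[OF shift_bounded] by blast
  have "half_hoelder (apply_bcontfun \<phi>) ((cmod (1 / z) * (C * b + D)) * norm \<phi>)" if \<phi>: "(V.shift z ^^ Suc n) \<phi> = 0" for \<phi>
  proof -
    define \<psi> where "\<psi> = V.shift z \<phi>"
    have "(V.shift z ^^ n) \<psi> = 0" using \<phi> by (simp add: \<psi>_def funpow_swap1)
    from C(2)[OF this] have 1: "half_hoelder (apply_bcontfun \<psi>) (C * (norm \<phi> * b))"
      by (rule half_hoelder_mono) (use b(2) C(1) in \<open>auto simp: \<psi>_def intro: mult_left_mono\<close>)
    have "half_hoelder (\<lambda>x. (1 / z) * (\<psi> x + V.K \<phi> x)) (cmod (1 / z) * (C * (norm \<phi> * b) + D * norm \<phi>))"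
      by (intro half_hoelder_cmult half_hoelder_add 1 D)
    moreover have "apply_bcontfun \<phi> = (\<lambda>x. (1 / z) * (\<psi> x + V.K \<phi> x))"
      using z by (auto simp: \<psi>_def V.shift_def)
    ultimately have "half_hoelder (apply_bcontfun \<phi>) (cmod (1 / z) * (C * (norm \<phi> * b) + D * norm \<phi>))" by metis
    then show ?thesis by (rule half_hoelder_mono) (simp add: algebra_simps)
  qed
  moreover have "cmod (1 / z) * (C * b + D) \<ge> 0" using C(1) b(1) D(1) by simp
  ultimately show ?case by blast
qed

text \<open>On the generalized eigenspace all ingredients of the load are Hoelder continuous of
  order one half: the continuous representatives of q and p, the solution r, and \<phi> itself. For
  k = 1 this gains a further factor h; for k = 0 the general estimate already has the right
  exponent.\<close>

lemma Kh_error_kernel: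
  assumes z: "z \<noteq> 0"
  shows "\<exists>C>0. \<forall>xs k. fine_discretization \<alpha> q p \<mu> xs k \<longrightarrow> (\<forall>\<phi>. (V.shift z ^^ n) \<phi> = 0 \<longrightarrow>
      norm (V.K \<phi> - Kh k xs (apply_bcontfun \<phi>)) \<le> C * norm \<phi> * meshsize xs powr (\<alpha> + real k - 1/2))"
proof -
  obtain C0 where C0: "C0 > 0" "\<And>xs k f N. fine_discretization \<alpha> q p \<mu> xs k \<Longrightarrow> sqrt_growth f N \<Longrightarrow>
      norm (V.Kop f - Kh k xs f) \<le> C0 * N * meshsize xs powr (\<alpha> - 1/2)"
    using Kh_error by blast
  obtain C where C: "C > 0" "\<And>f N. sqrt_growth f N \<Longrightarrow> norm (V.rsol f) \<le> C * N"
    using V_bound by metis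
  obtain D where D: "D \<ge> 0" "\<And>\<phi>. half_hoelder (V.rsol (apply_bcontfun \<phi>)) (D * norm \<phi>)"
    using rsol_hoelder by blast
  obtain E where E: "E \<ge> 0" "\<And>\<phi>. (V.shift z ^^ n) \<phi> = 0 \<Longrightarrow> half_hoelder (apply_bcontfun \<phi>) (E * norm \<phi>)"
    using kernel_hoelder[OF z] by blast
  obtain q' Hq Mq where q': "aeq (\<lambda>x. complex_of_real (q x)) q'" "continuous_on {0..1} q'" "half_hoelder q' Hq" "0 \<le> Hq"
    "\<And>x. x \<in> {0..1} \<Longrightarrow> norm (q' x) \<le> Mq" "0 \<le> Mq" using H1_half_hoelder[OF q_H1] by metis
  obtain p' Hp Mp where p': "aeq (\<lambda>x. complex_of_real (p x)) p'" "continuous_on {0..1} p'" "half_hoelder p' Hp" "0 \<le> Hp"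
    using H1_half_hoelder[OF p_H1] by metis
  define c where "c = (1 + norm (powr_fun \<mu>)) * (2 / lower)"
  have c: "c > 0" using lower(1) by (simp add: c_def add_pos_nonneg)
  define Q where "Q = Hq * C + Mq * D + C * Hp + E"
  have Q0: "Q \<ge> 0" using q' p' C D E by (simp add: Q_def)
  have k1: "norm (V.K \<phi> - Kh 1 xs (apply_bcontfun \<phi>)) \<le> (c * rate * Q) * norm \<phi> * meshsize xs powr (\<alpha> + 1/2)"
    if fd: "fine_discretization \<alpha> q p \<mu> xs 1" and \<phi>: "(V.shift z ^^ n) \<phi> = 0" for xs \<phi>
  proof -
    interpret fine_discretization \<alpha> q p \<mu> xs 1 by (rule fd)
    define r where "r = V.rsol (apply_bcontfun \<phi>)"
    have f: "sqrt_growth (apply_bcontfun \<phi>) (norm \<phi>)" by (rule bcontfun_sqrt_growth)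
    have nr: "norm r \<le> C * norm \<phi>" unfolding r_def by (rule C(2)[OF f])
    \<comment> \<open>The continuous representative of the load, with q and p replaced by their
      representatives.\<close>
    define g where "g x = q' x * r x + r 1 * p' x - \<phi> x" for x
    have ae: "aeq (load q p \<phi> r) g"
      using q'(1) p'(1) unfolding aeq_def by eventually_elim (auto simp: load_def g_def)
    have cont: "continuous_on {0..1} g" unfolding g_def by (intro continuous_intros q' p') auto
    have rb: "norm (r x) \<le> C * norm \<phi>" for x using norm_bounded[of r x] nr by simp
    have "half_hoelder g ((Hq * (C * norm \<phi>) + Mq * (D * norm \<phi>)) + norm (r 1) * Hp + E * norm \<phi>)"
      unfolding g_def[abs_def]
      by (intro half_hoelder_diff half_hoelder_add half_hoelder_mult half_hoelder_cmult q' p' E(2)[OF \<phi>] rb)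
         (auto simp: r_def D(2))
    then have hg: "half_hoelder g (Q * norm \<phi>)"
    proof (rule half_hoelder_mono)
      have "norm (r 1) * Hp \<le> C * norm \<phi> * Hp" using rb[of 1] p'(4) by (rule mult_right_mono)
      then show "(Hq * (C * norm \<phi>) + Mq * (D * norm \<phi>)) + norm (r 1) * Hp + E * norm \<phi> \<le> Q * norm \<phi>"
        by (simp add: Q_def algebra_simps)
    qed
    have "norm (V.P (load q p \<phi> r) - D.P (load q p \<phi> r)) \<le> rate * (Q * norm \<phi>) * h powr (\<alpha> + 1/2)"
      by (rule P_error_hoelder[OF V.load_growth[OF f] refl ae cont hg])
    from Kop_error[OF f this[unfolded r_def]] show ?thesis unfolding c_def[symmetric] by (simp only: mult.assoc)
  qed
  have "norm (V.K \<phi> - Kh k xs (apply_bcontfun \<phi>)) \<le> (C0 + c * rate * Q) * norm \<phi> * meshsize xs powr (\<alpha> + real k - 1/2)"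
    if fd: "fine_discretization \<alpha> q p \<mu> xs k" and \<phi>: "(V.shift z ^^ n) \<phi> = 0" for xs k \<phi>
  proof -
    interpret fine_discretization \<alpha> q p \<mu> xs k by (rule fd)
    have cQ: "0 \<le> c * rate * Q" using c rate_pos Q0 by simp
    consider "k = 0" | "k = 1" using k by linarith
    then show ?thesis
    proof cases
      case 1
      have "norm (V.K \<phi> - Kh k xs (apply_bcontfun \<phi>)) \<le> C0 * norm \<phi> * h powr (\<alpha> - 1/2)"
        by (rule C0(2)[OF fd bcontfun_sqrt_growth])
      also have "\<dots> \<le> (C0 + c * rate * Q) * norm \<phi> * h powr (\<alpha> - 1/2)"
        using cQ by (intro mult_right_mono) auto
      finally show ?thesis using 1 by simp
    next
      case 2
      have "norm (V.K \<phi> - Kh 1 xs (apply_bcontfun \<phi>)) \<le> (c * rate * Q) * norm \<phi> * h powr (\<alpha> + 1/2)"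
        using k1[OF _ \<phi>] fd 2 by simp
      also have "\<dots> \<le> (C0 + c * rate * Q) * norm \<phi> * h powr (\<alpha> + 1/2)"
        using C0(1) by (intro mult_right_mono) auto
      finally show ?thesis using 2 by (simp add: algebra_simps)
    qed
  qed
  moreover have "C0 + c * rate * Q > 0" using C0(1) c rate_pos Q0 by (intro add_pos_nonneg) auto
  ultimately show ?thesis by blast
qed

end

section \<open>The abstract perturbation theory applied to the normalized operator\<close>

locale eigenvalue_problem = sturm_liouville +
  fixes \<zeta> :: complex and \<delta> :: nat
  assumes \<zeta>: "\<zeta> \<noteq> 0" and \<zeta>_ascent: "\<And>\<phi>. (V.shift \<zeta> ^^ Suc \<delta>) \<phi> = 0 \<Longrightarrow> (V.shift \<zeta> ^^ \<delta>) \<phi> = 0"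
begin

text \<open>Dividing by \<zeta> moves the eigenvalue to 1, so that \<zeta> - K becomes a multiple of
  the identity minus a compact operator.\<close>

definition H :: "(real \<Rightarrow>\<^sub>C complex) \<Rightarrow> real \<Rightarrow>\<^sub>C complex" where
  "H r = cscale (1 / \<zeta>) (V.K r)"

lemma H_compact: "compact_operator H"
  unfolding H_def[abs_def] by (rule compact_operator_left[OF cscale.bl_cs V.K_compact])

lemma L_eq: "x - H x = cscale (1 / \<zeta>) (V.shift \<zeta> x)"
  using \<zeta> by (intro bcontfun_eqI) (simp add: H_def V.shift_def field_simps)

sublocale pe: compact_perturbation H
  by unfold_locales (rule H_compact)

lemma L_power_iff: "(pe.L ^^ n) x = 0 \<longleftrightarrow> (V.shift \<zeta> ^^ n) x = 0"
proof -
  have "pe.L = (\<lambda>x. cscale (1 / \<zeta>) (V.shift \<zeta> x))" by (simp add: fun_eq_iff pe.L_def L_eq)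
  then show ?thesis using scaled_power_zero_iff[where T = "V.shift \<zeta>" and a = "1 / \<zeta>", OF V.shift_linear] \<zeta> by simp
qed

sublocale pe: perturbed_eigenvalue H \<delta> cscale
proof
  show "(pe.L ^^ \<delta>) x = 0" if "(pe.L ^^ Suc \<delta>) x = 0" for x
    using that \<zeta>_ascent unfolding L_power_iff by blast
  show "H (cscale z x) = cscale z (H x)" for z x
    by (simp add: H_def V.K_cscale cscale.cs_mult mult.commute)
qed

definition Hh :: "nat \<Rightarrow> real list \<Rightarrow> (real \<Rightarrow>\<^sub>C complex) \<Rightarrow> real \<Rightarrow>\<^sub>C complex" where
  "Hh k xs r = cscale (1 / \<zeta>) (Kh k xs (apply_bcontfun r))"

text \<open>The smallness \<epsilon> is prescribed by the abstract theory and met by refining the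
  mesh through the general estimate. The rate \<eta> comes from the estimate on the generalized
  eigenspace. The last clause identifies the discrete shift with a multiple of
  \<open>pe.L'\<close>.\<close>

lemma Hh_admissible:
  assumes \<epsilon>: "\<epsilon> > 0"
  shows "\<exists>C>0. \<exists>h0>0. \<forall>xs k z. is_mesh xs \<longrightarrow> meshsize xs \<le> h0 \<longrightarrow> k \<le> 1 \<longrightarrow> cmod (z / \<zeta> - 1) \<le> \<epsilon> \<longrightarrow>
     fine_discretization \<alpha> q p \<mu> xs k \<and>
     pe.admissible \<epsilon> (C * meshsize xs powr (\<alpha> + real k - 1/2)) (z / \<zeta> - 1) (Hh k xs) \<and>
     (\<forall>n u. (pe.L' (z / \<zeta> - 1) (Hh k xs) ^^ n) u = 0 \<longleftrightarrow> (shift_h k xs z ^^ n) u = 0)"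
proof -
  obtain C0 where C0: "C0 > 0" "\<And>xs k f N. fine_discretization \<alpha> q p \<mu> xs k \<Longrightarrow> sqrt_growth f N \<Longrightarrow>
      norm (V.Kop f - Kh k xs f) \<le> C0 * N * meshsize xs powr (\<alpha> - 1/2)"
    using Kh_error by blast
  obtain C1 where C1: "C1 > 0" "\<And>xs k \<phi>. fine_discretization \<alpha> q p \<mu> xs k \<Longrightarrow> (V.shift \<zeta> ^^ \<delta>) \<phi> = 0 \<Longrightarrow>
      norm (V.K \<phi> - Kh k xs (apply_bcontfun \<phi>)) \<le> C1 * norm \<phi> * meshsize xs powr (\<alpha> + real k - 1/2)"
    using Kh_error_kernel[OF \<zeta>] by blast
  define a where "a = cmod (1 / \<zeta>)"
  have a: "a > 0" using \<zeta> by (simp add: a_def)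
  obtain h1 where h1: "h1 > 0" "\<And>xs k. is_mesh xs \<Longrightarrow> meshsize xs \<le> h1 \<Longrightarrow> k \<le> 1 \<Longrightarrow> fine_discretization \<alpha> q p \<mu> xs k"
    using fine_mesh by blast
  obtain h2 where h2: "h2 > 0" "\<And>h. 0 < h \<Longrightarrow> h \<le> h2 \<Longrightarrow> (a * C0) * h powr (\<alpha> - 1/2) \<le> \<epsilon>"
    using small_powr[of "a * C0" \<epsilon> "\<alpha> - 1/2"] a C0(1) \<epsilon> \<alpha>_gt by auto
  obtain h3 where h3: "h3 > 0" "\<And>h. 0 < h \<Longrightarrow> h \<le> h3 \<Longrightarrow> (a * C1) * h powr (\<alpha> - 1/2) \<le> 1"
    using small_powr[of "a * C1" 1 "\<alpha> - 1/2"] a C1(1) \<alpha>_gt by auto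
  \<comment> \<open>The thresholds ensure in turn discrete solvability, a perturbation below
    \<epsilon>, and \<eta> \<le> 1; the bound by 1 makes the larger exponent the smaller
    power.\<close>
  define h0 where "h0 = min (min h1 h2) (min h3 1)"
  have h0: "h0 > 0" "h0 \<le> h1" "h0 \<le> h2" "h0 \<le> h3" "h0 \<le> 1" using h1 h2 h3 by (auto simp: h0_def)
  have main: "fine_discretization \<alpha> q p \<mu> xs k \<and>
     pe.admissible \<epsilon> ((a * C1) * meshsize xs powr (\<alpha> + real k - 1/2)) (z / \<zeta> - 1) (Hh k xs) \<and>
     (\<forall>n u. (pe.L' (z / \<zeta> - 1) (Hh k xs) ^^ n) u = 0 \<longleftrightarrow> (shift_h k xs z ^^ n) u = 0)"
    if m: "is_mesh xs" "meshsize xs \<le> h0" "k \<le> 1" and z: "cmod (z / \<zeta> - 1) \<le> \<epsilon>" for xs k z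
  proof -
    have fd: "fine_discretization \<alpha> q p \<mu> xs k" using h1(2)[OF m(1) _ m(3)] m(2) h0 by simp
    interpret fine_discretization \<alpha> q p \<mu> xs k by (rule fd)
    have hp: "0 < h" "h \<le> h2" "h \<le> h3" "h \<le> 1" using M.meshsize_pos m(2) h0 by auto
    have diff: "norm (Hh k xs x - H x) = a * norm (V.K x - Kh k xs (apply_bcontfun x))" for x
    proof -
      have "Hh k xs x - H x = cscale (1 / \<zeta>) (Kh k xs (apply_bcontfun x) - V.K x)"
        by (simp add: Hh_def H_def linear_simps(2)[OF cscale.bl_cs])
      then show ?thesis by (simp only: cscale.norm_cs a_def norm_minus_commute)
    qed
    have "linear (Hh k xs)"
      unfolding Hh_def[abs_def]
      by (rule bounded_linear.linear[OF bounded_linear_compose[OF cscale.bl_cs S.K_bounded_linear]])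
    moreover have "norm (Hh k xs x - H x) \<le> \<epsilon> * norm x" for x
    proof -
      have "norm (Hh k xs x - H x) \<le> a * (C0 * norm x * h powr (\<alpha> - 1/2))"
        unfolding diff using a C0(2)[OF fd bcontfun_sqrt_growth[of x]] by (intro mult_left_mono) auto
      also have "\<dots> = ((a * C0) * h powr (\<alpha> - 1/2)) * norm x" by (simp add: algebra_simps)
      also have "\<dots> \<le> \<epsilon> * norm x" using h2(2)[OF hp(1,2)] by (intro mult_right_mono) auto
      finally show ?thesis .
    qed
    moreover have "norm (Hh k xs x - H x) \<le> (a * C1) * h powr (\<alpha> + real k - 1/2) * norm x" if "x \<in> pe.E" for x
    proof -
      have "(V.shift \<zeta> ^^ \<delta>) x = 0" using that by (simp add: pe.E_def L_power_iff)
      from C1(2)[OF fd this] have "norm (Hh k xs x - H x) \<le> a * (C1 * norm x * h powr (\<alpha> + real k - 1/2))"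
        unfolding diff using a by (intro mult_left_mono) auto
      then show ?thesis by (simp add: algebra_simps)
    qed
    moreover have "(a * C1) * h powr (\<alpha> + real k - 1/2) \<le> 1"
    proof -
      have "h powr (\<alpha> + real k - 1/2) \<le> h powr (\<alpha> - 1/2)" using hp by (intro powr_mono') auto
      then have "(a * C1) * h powr (\<alpha> + real k - 1/2) \<le> (a * C1) * h powr (\<alpha> - 1/2)"
        using a C1(1) by (intro mult_left_mono) auto
      with h3(2)[OF hp(1,3)] show ?thesis by linarith
    qed
    ultimately have adm: "pe.admissible \<epsilon> ((a * C1) * h powr (\<alpha> + real k - 1/2)) (z / \<zeta> - 1) (Hh k xs)"
      using z a C1(1) by (auto simp: pe.admissible_def)
    have "pe.L' (z / \<zeta> - 1) (Hh k xs) = (\<lambda>x. cscale (1 / \<zeta>) (S.shift z x))"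
      using \<zeta> by (intro ext bcontfun_eqI) (simp add: pe.L'_def Hh_def S.shift_def field_simps)
    then have "(pe.L' (z / \<zeta> - 1) (Hh k xs) ^^ n) u = 0 \<longleftrightarrow> (S.shift z ^^ n) u = 0" for n u
      using scaled_power_zero_iff[where T = "S.shift z" and a = "1 / \<zeta>", OF S.shift_linear] \<zeta> by simp
    with adm fd show ?thesis by blast
  qed
  have "a * C1 > 0" using a C1(1) by simp
  with main h0(1) show ?thesis by blast
qed

lemma eigenvalue_error:
  "\<exists>C>0. \<exists>\<epsilon>>0. \<exists>h0>0. \<forall>xs k z \<phi>. is_mesh xs \<longrightarrow> meshsize xs \<le> h0 \<longrightarrow> k \<le> 1 \<longrightarrow> cmod (z / \<zeta> - 1) \<le> \<epsilon> \<longrightarrow>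
     \<phi> \<noteq> 0 \<longrightarrow> shift_h k xs z \<phi> = 0 \<longrightarrow> cmod (z / \<zeta> - 1) ^ \<delta> \<le> C * meshsize xs powr (\<alpha> + real k - 1/2)"
proof -
  obtain C \<epsilon> where C: "C > 0" "\<epsilon> > 0" "\<And>H' \<eta> \<sigma> u. pe.admissible \<epsilon> \<eta> \<sigma> H' \<Longrightarrow> u \<noteq> 0 \<Longrightarrow> pe.L' \<sigma> H' u = 0 \<Longrightarrow> cmod \<sigma> ^ \<delta> \<le> C * \<eta>"
    using pe.eigenvalue_perturbation by blast
  obtain D h0 where D: "D > 0" "h0 > 0" and adm: "\<And>xs k z. is_mesh xs \<Longrightarrow> meshsize xs \<le> h0 \<Longrightarrow> k \<le> 1 \<Longrightarrow> cmod (z / \<zeta> - 1) \<le> \<epsilon> \<Longrightarrow>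
     fine_discretization \<alpha> q p \<mu> xs k \<and>
     pe.admissible \<epsilon> (D * meshsize xs powr (\<alpha> + real k - 1/2)) (z / \<zeta> - 1) (Hh k xs) \<and>
     (\<forall>n u. (pe.L' (z / \<zeta> - 1) (Hh k xs) ^^ n) u = 0 \<longleftrightarrow> (shift_h k xs z ^^ n) u = 0)"
    using Hh_admissible[OF C(2)] by blast
  have "cmod (z / \<zeta> - 1) ^ \<delta> \<le> (C * D) * meshsize xs powr (\<alpha> + real k - 1/2)"
    if a: "is_mesh xs" "meshsize xs \<le> h0" "k \<le> 1" "cmod (z / \<zeta> - 1) \<le> \<epsilon>" and \<phi>: "\<phi> \<noteq> 0" "shift_h k xs z \<phi> = 0" for xs k z \<phi>
  proof -
    note A = adm[OF a]
    have "(pe.L' (z / \<zeta> - 1) (Hh k xs) ^^ 1) \<phi> = 0 \<longleftrightarrow> (shift_h k xs z ^^ 1) \<phi> = 0" using A by blast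
    then have 0: "pe.L' (z / \<zeta> - 1) (Hh k xs) \<phi> = 0" using \<phi>(2) by simp
    have "pe.admissible \<epsilon> (D * meshsize xs powr (\<alpha> + real k - 1/2)) (z / \<zeta> - 1) (Hh k xs)" using A by blast
    from C(3)[OF this \<phi>(1) 0] show ?thesis by (simp only: mult.assoc)
  qed
  moreover have "C * D > 0" using C D by simp
  ultimately show ?thesis using C(2) D(2) by blast
qed

text \<open>The eigenvalue deviation enters to the first power. It is known to be small only like a
  \<delta>-th root, and this term yields the exponent divided by \<delta> in the final
  estimate.\<close>

lemma eigenvector_error:
  "\<exists>C>0. \<exists>\<epsilon>>0. \<exists>h0>0. \<forall>xs k z \<phi>. is_mesh xs \<longrightarrow> meshsize xs \<le> h0 \<longrightarrow> k \<le> 1 \<longrightarrow> cmod (z / \<zeta> - 1) \<le> \<epsilon> \<longrightarrow>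
     (shift_h k xs z ^^ n) \<phi> = 0 \<longrightarrow>
     (\<exists>v. (V.shift \<zeta> ^^ n) v = 0 \<and> norm (v - \<phi>) \<le> C * (meshsize xs powr (\<alpha> + real k - 1/2) + cmod (z / \<zeta> - 1)) * norm \<phi>)"
proof -
  obtain C \<epsilon> where C: "C > 0" "\<epsilon> > 0" "\<And>H' \<eta> \<sigma> u. pe.admissible \<epsilon> \<eta> \<sigma> H' \<Longrightarrow> (pe.L' \<sigma> H' ^^ n) u = 0 \<Longrightarrow>
      \<exists>v. (pe.L ^^ n) v = 0 \<and> norm (u - v) \<le> C * (\<eta> + cmod \<sigma>) * norm u"
    using pe.eigenvector_perturbation[of n] by blast
  obtain D h0 where D: "D > 0" "h0 > 0" and adm: "\<And>xs k z. is_mesh xs \<Longrightarrow> meshsize xs \<le> h0 \<Longrightarrow> k \<le> 1 \<Longrightarrow> cmod (z / \<zeta> - 1) \<le> \<epsilon> \<Longrightarrow>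
     fine_discretization \<alpha> q p \<mu> xs k \<and>
     pe.admissible \<epsilon> (D * meshsize xs powr (\<alpha> + real k - 1/2)) (z / \<zeta> - 1) (Hh k xs) \<and>
     (\<forall>n u. (pe.L' (z / \<zeta> - 1) (Hh k xs) ^^ n) u = 0 \<longleftrightarrow> (shift_h k xs z ^^ n) u = 0)"
    using Hh_admissible[OF C(2)] by blast
  have "\<exists>v. (V.shift \<zeta> ^^ n) v = 0 \<and> norm (v - \<phi>) \<le> (C * (D + 1)) * (meshsize xs powr (\<alpha> + real k - 1/2) + cmod (z / \<zeta> - 1)) * norm \<phi>"
    if a: "is_mesh xs" "meshsize xs \<le> h0" "k \<le> 1" "cmod (z / \<zeta> - 1) \<le> \<epsilon>" and \<phi>: "(shift_h k xs z ^^ n) \<phi> = 0" for xs k z \<phi>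
  proof -
    note A = adm[OF a]
    define t where "t = meshsize xs powr (\<alpha> + real k - 1/2)"
    define \<sigma> where "\<sigma> = cmod (z / \<zeta> - 1)"
    have "(pe.L' (z / \<zeta> - 1) (Hh k xs) ^^ n) \<phi> = 0" using A \<phi> by blast
    then obtain v where v: "(pe.L ^^ n) v = 0" "norm (\<phi> - v) \<le> C * (D * t + \<sigma>) * norm \<phi>"
      using C(3) A unfolding t_def \<sigma>_def by blast
    have "D * t + \<sigma> \<le> (D + 1) * (t + \<sigma>)"
      using D(1) by (simp add: algebra_simps t_def \<sigma>_def)
    then have "C * (D * t + \<sigma>) * norm \<phi> \<le> C * ((D + 1) * (t + \<sigma>)) * norm \<phi>"
      using C(1) by (intro mult_right_mono mult_left_mono) auto
    with v show ?thesis
      unfolding L_power_iff t_def[symmetric] \<sigma>_def[symmetric]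
      by (intro exI[of _ v]) (simp add: norm_minus_commute mult.assoc)
  qed
  moreover have "C * (D + 1) > 0" using C D by simp
  ultimately show ?thesis using C(2) D(2) by blast
qed

end

section \<open>Taking roots and returning to L2\<close>

lemma root_rate:
  fixes x C h s \<gamma> :: real
  assumes "0 \<le> x" "0 < d" "x ^ d \<le> C * h powr s" "0 \<le> C" "0 < h" "h \<le> 1" "\<gamma> \<le> s"
  shows "x \<le> C powr (1 / real d) * h powr (\<gamma> / real d)"
proof -
  have "x \<le> (C * h powr s) powr (1 / real d)"
    by (rule le_root_of_power_le[OF assms(1-3)])
  also have "\<dots> = C powr (1 / real d) * h powr (s / real d)"
    using assms by (simp add: powr_mult powr_powr)
  also have "\<dots> \<le> C powr (1 / real d) * h powr (\<gamma> / real d)"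
    using assms by (intro mult_left_mono powr_mono') (auto simp: divide_right_mono)
  finally show ?thesis .
qed

context sturm_liouville
begin

text \<open>Supplies the mesh-independent constant for \<open>kernel_sup_bound\<close>.\<close>

lemma Kh_bound:
  "\<exists>C\<ge>0. \<forall>xs k. fine_discretization \<alpha> q p \<mu> xs k \<longrightarrow> meshsize xs \<le> 1 \<longrightarrow>
     (\<forall>f N. sqrt_growth f N \<longrightarrow> norm (Kh k xs f) \<le> C * N)"
proof -
  obtain C where C: "C > 0" "\<And>f N. sqrt_growth f N \<Longrightarrow> norm (V.Kop f) \<le> C * N"
    using V_bound by metis
  obtain D where D: "D > 0" "\<And>xs k f N. fine_discretization \<alpha> q p \<mu> xs k \<Longrightarrow> sqrt_growth f N \<Longrightarrow>
      norm (V.Kop f - Kh k xs f) \<le> D * N * meshsize xs powr (\<alpha> - 1/2)"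
    using Kh_error by blast
  have "norm (Kh k xs f) \<le> (C + D) * N"
    if fd: "fine_discretization \<alpha> q p \<mu> xs k" and h: "meshsize xs \<le> 1" and f: "sqrt_growth f N" for xs k f N
  proof -
    interpret fine_discretization \<alpha> q p \<mu> xs k by (rule fd)
    have "h powr (\<alpha> - 1/2) \<le> 1 powr (\<alpha> - 1/2)"
      using M.meshsize_pos h \<alpha>_gt by (intro powr_mono2) auto
    then have "D * N * h powr (\<alpha> - 1/2) \<le> D * N * 1"
      using D(1) sqrt_growth_nonneg[OF f] by (intro mult_left_mono) auto
    then have "norm (V.Kop f - Kh k xs f) \<le> D * N" using D(2)[OF fd f] by linarith
    moreover have "norm (Kh k xs f) \<le> norm (V.Kop f) + norm (V.Kop f - Kh k xs f)" by norm
    ultimately show ?thesis using C(2)[OF f] by (simp add: algebra_simps)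
  qed
  moreover have "C + D \<ge> 0" using C D by simp
  ultimately show ?thesis by blast
qed

lemma shift_kernel_mono:
  assumes "n \<le> l" "(V.shift z ^^ n) \<phi> = 0" shows "(V.shift z ^^ l) \<phi> = 0"
proof -
  have "(V.shift z ^^ m) 0 = 0" for m
    by (induction m) (simp_all add: linear_0[OF bounded_linear.linear[OF shift_bounded]])
  moreover have "(V.shift z ^^ l) \<phi> = (V.shift z ^^ (l - n)) ((V.shift z ^^ n) \<phi>)"
    using assms(1) by (simp flip: funpow_add[THEN fun_cong, unfolded o_apply])
  ultimately show ?thesis using assms(2) by simp
qed

end

theorem theorem5p2:
  fixes \<alpha> \<mu> :: real and q :: "real \<Rightarrow> real" and k :: nat
    and Hs :: "real set" and mesh :: "real \<Rightarrow> real list"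
    and lam :: complex and m \<delta> :: nat
    and M :: "real \<Rightarrow> complex multiset"
  defines "c0 \<equiv> Gamma (\<mu> + 1) / Gamma (1 + \<mu> - \<alpha>)"
  defines "p \<equiv> (\<lambda>x. c0 * x powr (\<mu> - \<alpha>) - q x * x powr \<mu>)"
  defines "ST \<equiv> (\<lambda>f. Sop \<alpha> \<mu> (Tsol \<alpha> q p Vspace f))"
  defines "STh \<equiv> (\<lambda>h f. Sop \<alpha> \<mu> (Tsol \<alpha> q p (Vh k (mesh h)) f))"
  defines "F \<equiv> at 0 within Hs"
  assumes \<alpha>: "3/2 < \<alpha>" "\<alpha> < 2"
    and \<mu>: "\<mu> \<ge> \<alpha>"
    and q: "H1 (\<lambda>x. of_real (q x))"
    and p: "H1 (\<lambda>x. of_real (p x))"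
    and uniq1: "\<forall>w\<in>Vspace. (\<forall>v\<in>Vspace. Aform \<alpha> q p w v = 0) \<longrightarrow> aeq w (\<lambda>_. 0)"
    and uniq2: "\<forall>v\<in>Vspace. (\<forall>w\<in>Vspace. Aform \<alpha> q p w v = 0) \<longrightarrow> aeq v (\<lambda>_. 0)"
    and k: "k \<le> 1"
    and Hs: "Hs \<subseteq> {0<..}" "0 islimpt Hs"
    and mesh: "\<forall>h\<in>Hs. is_mesh (mesh h) \<and> meshsize (mesh h) = h"
    and quasi_uniform: "\<exists>\<kappa>>0. \<forall>h\<in>Hs. meshmin (mesh h) \<ge> \<kappa> * meshsize (mesh h)"
    and lam: "lam \<noteq> 0" "is_eigenvalue ST (1 / lam)"
    and mult: "alg_mult ST (1 / lam) m"
    and asc: "ascent ST (1 / lam) \<delta>"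
    and M_eig: "eventually (\<lambda>h. size (M h) = m \<and>
                 (\<forall>z\<in>#M h. is_eigenvalue (STh h) z \<and> alg_mult (STh h) z (count (M h) z))) F"
    and M_conv: "\<forall>\<epsilon>>0. eventually (\<lambda>h. \<forall>z\<in>#M h. cmod (z - 1 / lam) < \<epsilon>) F"
  shows
    "(\<forall>\<gamma>. \<gamma> < \<alpha> + real k - 1/2 \<longrightarrow>
        (\<exists>C. eventually (\<lambda>h. \<forall>z\<in>#M h. cmod (lam - 1 / z) \<le> C * h powr (\<gamma> / real \<delta>)) F))
     \<and>
     (\<forall>(lamh :: real \<Rightarrow> complex) (uh :: real \<Rightarrow> real \<Rightarrow> complex) (n :: nat).
        eventually (\<lambda>h. is_eigenvalue (STh h) (1 / lamh h)) F \<longrightarrow>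
        (lamh \<longlongrightarrow> lam) F \<longrightarrow>
        0 < n \<longrightarrow> n \<le> \<delta> \<longrightarrow>
        eventually (\<lambda>h. L2 (uh h) \<and> l2norm (uh h) = 1 \<and>
                         uh h \<in> nullsp (STh h) (1 / lamh h) n) F \<longrightarrow>
        (\<forall>l. n \<le> l \<longrightarrow> l \<le> \<delta> \<longrightarrow>
          (\<exists>u :: real \<Rightarrow> real \<Rightarrow> complex.
             eventually (\<lambda>h. u h \<in> nullsp ST (1 / lam) l) F \<and>
             (\<forall>\<gamma>. \<gamma> < \<alpha> + real k - 1/2 \<longrightarrow>
                (\<exists>C. eventually (\<lambda>h. l2norm (\<lambda>x. u h x - uh h x)
                                       \<le> C * h powr (\<gamma> / real \<delta>)) F)))))"
proof -
  have frac: "frac_order \<alpha>" using \<alpha> by unfold_locales auto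
  interpret sturm_liouville \<alpha> q p \<mu>
    by (intro sturm_liouville.intro sturm_liouville_axioms.intro frac q p) (use \<mu> \<alpha> uniq1 in auto)
  define \<zeta> where "\<zeta> = 1 / lam"
  have \<zeta>0: "\<zeta> \<noteq> 0" using lam(1) by (simp add: \<zeta>_def)
  have ST: "ST = V.STop" by (simp add: fun_eq_iff ST_def V.STop_def)
  \<comment> \<open>The ascent given for ST on L2 is carried over to C[0,1] by
    \<open>V.ascent_kernel\<close>.\<close>
  interpret eigenvalue_problem \<alpha> q p \<mu> \<zeta> \<delta>
    by unfold_locales (use \<zeta>0 V.ascent_kernel[OF \<zeta>0] asc in \<open>auto simp: ST \<zeta>_def\<close>)
  have \<delta>: "0 < \<delta>"
    using V.eigenvalue_imp_ascent_pos[OF \<zeta>0] lam(2) asc by (simp add: ST \<zeta>_def)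
  define s where "s = \<alpha> + real k - 1/2"
  have s0: "s > 0" using \<alpha> by (simp add: s_def)
  have small: "\<forall>\<^sub>F h in F. h \<in> Hs \<and> 0 < h \<and> h \<le> h0" if "h0 > 0" for h0 :: real
    unfolding F_def eventually_at
    by (rule exI[of _ h0]) (use that Hs(1) in \<open>auto simp: dist_real_def\<close>)
  obtain hf where hf: "hf > 0" "\<And>xs k. is_mesh xs \<Longrightarrow> meshsize xs \<le> hf \<Longrightarrow> k \<le> 1 \<Longrightarrow> fine_discretization \<alpha> q p \<mu> xs k"
    using fine_mesh by blast
  have fd: "fine_discretization \<alpha> q p \<mu> (mesh h) k" if "h \<in> Hs" "h \<le> hf" for h
    using hf(2)[of "mesh h" k] mesh that k by auto
  have STh: "STh h = galerkin_solvable.STop \<alpha> q p (Vh k (mesh h)) \<mu>" if "h \<in> Hs" "h \<le> hf" for h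
  proof -
    interpret fine_discretization \<alpha> q p \<mu> "mesh h" k by (rule fd[OF that])
    show ?thesis by (simp add: fun_eq_iff STh_def S.STop_def)
  qed
  have ms: "is_mesh (mesh h)" "meshsize (mesh h) = h" if "h \<in> Hs" for h using mesh that by auto
  obtain C1 \<epsilon>1 h1 where C1: "C1 > 0" "\<epsilon>1 > 0" "h1 > 0" and ev: "\<forall>xs k z \<phi>. is_mesh xs \<longrightarrow> meshsize xs \<le> h1 \<longrightarrow> k \<le> 1 \<longrightarrow>
      cmod (z / \<zeta> - 1) \<le> \<epsilon>1 \<longrightarrow> \<phi> \<noteq> 0 \<longrightarrow> shift_h k xs z \<phi> = 0 \<longrightarrow>
      cmod (z / \<zeta> - 1) ^ \<delta> \<le> C1 * meshsize xs powr (\<alpha> + real k - 1/2)"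
    using eigenvalue_error by (elim exE conjE)
  have eig: "cmod (z / \<zeta> - 1) ^ \<delta> \<le> C1 * h powr s"
    if h: "h \<in> Hs" "h \<le> hf" "h \<le> h1" and z: "cmod (z / \<zeta> - 1) \<le> \<epsilon>1" "z \<noteq> 0" "is_eigenvalue (STh h) z" for h z
  proof -
    interpret fd: fine_discretization \<alpha> q p \<mu> "mesh h" k by (rule fd[OF h(1,2)])
    obtain \<phi> where \<phi>: "\<phi> \<noteq> 0" "fd.S.shift z \<phi> = 0"
      by (rule fd.S.eigenvalue_representative[OF z(2) z(3)[unfolded STh[OF h(1,2)]]])
    show ?thesis using ev[rule_format, OF ms(1)[OF h(1)] _ k z(1) \<phi>] ms(2)[OF h(1)] h(3) by (simp add: s_def)
  qed
  have zz: "cmod (z / \<zeta> - 1) = cmod (z - \<zeta>) / cmod \<zeta>" for z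
  proof -
    have "z / \<zeta> - 1 = (z - \<zeta>) / \<zeta>" using \<zeta>0 by (simp add: field_simps)
    then show ?thesis by (simp add: norm_divide)
  qed
  \<comment> \<open>The first bound brings z into the range of the perturbation theorem; the second
    keeps z comparable to \<zeta> and away from 0, so that its reciprocal is controlled.\<close>
  define \<rho> where "\<rho> = min (\<epsilon>1 * cmod \<zeta>) (cmod \<zeta> / 2)"
  have \<rho>: "\<rho> > 0" using C1(2) \<zeta>0 by (simp add: \<rho>_def)
  have near: "cmod (z / \<zeta> - 1) \<le> \<epsilon>1" "cmod \<zeta> / 2 \<le> cmod z" "cmod z \<le> 2 * cmod \<zeta>" "z \<noteq> 0" if "cmod (z - \<zeta>) < \<rho>" for z
  proof -
    have 1: "cmod (z - \<zeta>) < \<epsilon>1 * cmod \<zeta>" "cmod (z - \<zeta>) < cmod \<zeta> / 2" using that by (auto simp: \<rho>_def)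
    show "cmod (z / \<zeta> - 1) \<le> \<epsilon>1" unfolding zz using 1(1) \<zeta>0 by (simp add: field_simps)
    have "cmod \<zeta> \<le> cmod z + cmod (z - \<zeta>)" "cmod z \<le> cmod \<zeta> + cmod (z - \<zeta>)"
      using norm_triangle_ineq4[of z "z - \<zeta>"] norm_triangle_ineq[of \<zeta> "z - \<zeta>"] by auto
    then show "cmod \<zeta> / 2 \<le> cmod z" "cmod z \<le> 2 * cmod \<zeta>" using 1(2) by auto
    then show "z \<noteq> 0" using \<zeta>0 by auto
  qed
  show ?thesis
  proof (intro conjI allI impI)
    fix \<gamma> assume \<gamma>: "\<gamma> < \<alpha> + real k - 1/2"
    define C where "C = 2 / cmod \<zeta> * C1 powr (1 / real \<delta>)"
    have "\<forall>\<^sub>F h in F. \<forall>z\<in>#M h. cmod (z - \<zeta>) < \<rho>" using M_conv \<rho> by (simp add: \<zeta>_def)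
    moreover have "\<forall>\<^sub>F h in F. h \<in> Hs \<and> 0 < h \<and> h \<le> min 1 (min hf h1)"
      by (rule small) (use hf(1) C1(3) in auto)
    ultimately have "\<forall>\<^sub>F h in F. \<forall>z\<in>#M h. cmod (lam - 1 / z) \<le> C * h powr (\<gamma> / real \<delta>)"
      using M_eig
    proof eventually_elim
      case (elim h)
      show ?case
      proof
        fix z assume z: "z \<in># M h"
        note nz = near[OF elim(1)[rule_format, OF z]]
        have h: "h \<in> Hs" "h \<le> hf" "h \<le> h1" "0 < h" "h \<le> 1" using elim(2) by auto
        have "cmod (z / \<zeta> - 1) ^ \<delta> \<le> C1 * h powr s"
          using eig[OF h(1-3) nz(1,4)] elim(3) z by blast
        then have e: "cmod (z / \<zeta> - 1) \<le> C1 powr (1 / real \<delta>) * h powr (\<gamma> / real \<delta>)"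
          by (rule root_rate[OF norm_ge_zero \<delta>]) (use C1(1) h \<gamma> in \<open>auto simp: s_def\<close>)
        \<comment> \<open>The absolute deviation of the reciprocals is the relative deviation
          divided by z, and |z| \<ge> |\<zeta>| / 2 explains the factor in C.\<close>
        have "lam - 1 / z = (z / \<zeta> - 1) / z" using nz(4) by (simp add: \<zeta>_def field_simps)
        then have "cmod (lam - 1 / z) = cmod (z / \<zeta> - 1) / cmod z" by (simp add: norm_divide)
        also have "\<dots> \<le> cmod (z / \<zeta> - 1) / (cmod \<zeta> / 2)"
          using nz(2,4) \<zeta>0 by (intro divide_left_mono) auto
        also have "\<dots> = 2 / cmod \<zeta> * cmod (z / \<zeta> - 1)" by simp
        also have "\<dots> \<le> 2 / cmod \<zeta> * (C1 powr (1 / real \<delta>) * h powr (\<gamma> / real \<delta>))"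
          using e by (intro mult_left_mono) auto
        finally show "cmod (lam - 1 / z) \<le> C * h powr (\<gamma> / real \<delta>)" by (simp add: C_def)
      qed
    qed
    then show "\<exists>C. \<forall>\<^sub>F h in F. \<forall>z\<in>#M h. cmod (lam - 1 / z) \<le> C * h powr (\<gamma> / real \<delta>)" by blast
  next
    fix lamh :: "real \<Rightarrow> complex" and uh :: "real \<Rightarrow> real \<Rightarrow> complex" and n l :: nat
    assume eigh: "\<forall>\<^sub>F h in F. is_eigenvalue (STh h) (1 / lamh h)" and conv: "(lamh \<longlongrightarrow> lam) F"
      and n: "0 < n" "n \<le> \<delta>"
      and uh: "\<forall>\<^sub>F h in F. L2 (uh h) \<and> l2norm (uh h) = 1 \<and> uh h \<in> nullsp (STh h) (1 / lamh h) n"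
      and l: "n \<le> l" "l \<le> \<delta>"
    obtain C2 \<epsilon>2 h2 where C2: "C2 > 0" "\<epsilon>2 > 0" "h2 > 0" and evec: "\<forall>xs k z \<phi>. is_mesh xs \<longrightarrow> meshsize xs \<le> h2 \<longrightarrow> k \<le> 1 \<longrightarrow>
        cmod (z / \<zeta> - 1) \<le> \<epsilon>2 \<longrightarrow> (shift_h k xs z ^^ n) \<phi> = 0 \<longrightarrow>
        (\<exists>v. (V.shift \<zeta> ^^ n) v = 0 \<and> norm (v - \<phi>) \<le> C2 * (meshsize xs powr (\<alpha> + real k - 1/2) + cmod (z / \<zeta> - 1)) * norm \<phi>)"
      using eigenvector_error[of n] by (elim exE conjE)
    obtain C0 where C0: "C0 \<ge> 0" "\<And>xs k f N. fine_discretization \<alpha> q p \<mu> xs k \<Longrightarrow> meshsize xs \<le> 1 \<Longrightarrow>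
        sqrt_growth f N \<Longrightarrow> norm (Kh k xs f) \<le> C0 * N"
      using Kh_bound by blast
    \<comment> \<open>The constant of \<open>kernel_sup_bound\<close> for |\<zeta>| / 2 \<le> |z|
      \<le> 2 |\<zeta>|; it is the same for all meshes.\<close>
    define D where "D = rec_nat 0 (\<lambda>_ D. (D * (2 * cmod \<zeta> + C0) + C0) / (cmod \<zeta> / 2)) n"
    define \<sigma> where "\<sigma> h = cmod ((1 / lamh h) / \<zeta> - 1)" for h
    \<comment> \<open>The vector u has to be chosen before \<gamma>. The bounds recorded here
      therefore keep the full exponent s and the deviation \<sigma> h, from which each \<gamma> is
      derived afterwards.\<close>
    define good where "good h v \<longleftrightarrow> (V.shift \<zeta> ^^ l) v = 0 \<and>
        l2norm (\<lambda>x. apply_bcontfun v x - uh h x) \<le> C2 * D * (h powr s + \<sigma> h) \<and> \<sigma> h ^ \<delta> \<le> C1 * h powr s \<and>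
        h \<in> Hs \<and> 0 < h \<and> h \<le> 1" for h v
    have "((\<lambda>h. 1 / lamh h) \<longlongrightarrow> \<zeta>) F"
      unfolding \<zeta>_def by (intro tendsto_intros conv lam)
    then have "\<forall>\<^sub>F h in F. dist (1 / lamh h) \<zeta> < min \<rho> (\<epsilon>2 * cmod \<zeta>)"
      by (rule tendstoD) (use \<rho> C2(2) \<zeta>0 in auto)
    moreover have "\<forall>\<^sub>F h in F. h \<in> Hs \<and> 0 < h \<and> h \<le> min 1 (min (min hf h1) h2)"
      by (rule small) (use hf(1) C1(3) C2(3) in auto)
    ultimately have ex: "\<forall>\<^sub>F h in F. \<exists>v. good h v"
      using eigh uh
    proof eventually_elim
      case (elim h)
      define z where "z = 1 / lamh h"
      have zd: "cmod (z - \<zeta>) < \<rho>" "cmod (z - \<zeta>) < \<epsilon>2 * cmod \<zeta>"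
        using elim(1) by (auto simp: dist_norm z_def)
      note nz = near[OF zd(1)]
      have z2: "cmod (z / \<zeta> - 1) \<le> \<epsilon>2" unfolding zz using zd(2) \<zeta>0 by (simp add: field_simps)
      have h: "h \<in> Hs" "h \<le> hf" "h \<le> h1" "0 < h" "h \<le> 1" "h \<le> h2" using elim(2) by auto
      have u: "L2 (uh h)" "l2norm (uh h) = 1" "uh h \<in> nullsp (STh h) z n" using elim(4) by (auto simp: z_def)
      have e: "\<sigma> h ^ \<delta> \<le> C1 * h powr s"
        using eig[OF h(1-3) nz(1,4)] elim(3) by (simp add: \<sigma>_def z_def)
      interpret fd: fine_discretization \<alpha> q p \<mu> "mesh h" k by (rule fd[OF h(1,2)])
      from fd.S.nullsp_representative[OF nz(4) u(3)[unfolded STh[OF h(1,2)]]]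
      obtain \<phi> where \<phi>: "aeq (uh h) (apply_bcontfun \<phi>)" "(fd.S.shift z ^^ n) \<phi> = 0" by blast
      \<comment> \<open>The unit L2 norm passes to the continuous representative, gives it growth
        constant 1, and so bounds its supremum norm by D.\<close>
      have "l2norm (apply_bcontfun \<phi>) = 1"
        using l2norm_cong_aeq[OF \<phi>(1) _ bcontfun_meas] u(1,2) by (simp add: L2_def)
      then have g: "sqrt_growth (apply_bcontfun \<phi>) 1" using L2_sqrt_growth[OF bcontfun_L2[of \<phi>]] by simp
      have "norm \<phi> \<le> D * 1"
        unfolding D_def
      proof (rule fd.S.kernel_sup_bound[OF C0(1) _ _ nz(2,3) \<phi>(2) g])
        show "norm (fd.S.Kop f) \<le> C0 * N" if "sqrt_growth f N" for f N
          using C0(2)[OF fd[OF h(1,2)] _ that] ms(2)[OF h(1)] h(5) by simp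
      qed (use \<zeta>0 in auto)
      then have nD: "norm \<phi> \<le> D" by simp
      obtain v where v: "(V.shift \<zeta> ^^ n) v = 0" "norm (v - \<phi>) \<le> C2 * (h powr s + cmod (z / \<zeta> - 1)) * norm \<phi>"
        using evec[rule_format, OF ms(1)[OF h(1)] _ k z2 \<phi>(2)] ms(2)[OF h(1)] h(6) by (auto simp: s_def)
      have "l2norm (\<lambda>x. apply_bcontfun v x - uh h x) \<le> norm (v - \<phi>)" by (rule l2norm_le_sup[OF u(1) \<phi>(1)])
      also note v(2)
      also have "C2 * (h powr s + cmod (z / \<zeta> - 1)) * norm \<phi> \<le> C2 * (h powr s + cmod (z / \<zeta> - 1)) * D"
        using nD C2(1) by (intro mult_left_mono) auto
      finally have "l2norm (\<lambda>x. apply_bcontfun v x - uh h x) \<le> C2 * D * (h powr s + \<sigma> h)"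
        by (simp add: \<sigma>_def z_def mult_ac)
      \<comment> \<open>The approximating vector is found for the power n; it serves for every l
        \<ge> n because kernels of powers increase.\<close>
      then have "good h v"
        using shift_kernel_mono[OF l(1) v(1)] e h by (simp add: good_def)
      then show ?case ..
    qed
    \<comment> \<open>Existence for each small h is turned into a family indexed by h.\<close>
    define w where "w h = (SOME v. good h v)" for h
    have good: "\<forall>\<^sub>F h in F. good h (w h)"
      using ex unfolding w_def by (rule eventually_mono) (rule someI_ex)
    have goodD: "(V.shift \<zeta> ^^ l) v = 0" "l2norm (\<lambda>x. apply_bcontfun v x - uh h x) \<le> C2 * D * (h powr s + \<sigma> h)"
      "\<sigma> h ^ \<delta> \<le> C1 * h powr s" "0 < h" "h \<le> 1" if "good h v" for h v
      using that by (auto simp: good_def)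
    define u where "u h = apply_bcontfun (w h)" for h
    show "\<exists>u. (\<forall>\<^sub>F h in F. u h \<in> nullsp ST (1 / lam) l) \<and>
        (\<forall>\<gamma><\<alpha> + real k - 1 / 2. \<exists>C. \<forall>\<^sub>F h in F. l2norm (\<lambda>x. u h x - uh h x) \<le> C * h powr (\<gamma> / real \<delta>))"
    proof (intro exI[of _ u] conjI allI impI)
      show "\<forall>\<^sub>F h in F. u h \<in> nullsp ST (1 / lam) l"
        using good
      proof eventually_elim
        case (elim h)
        then show ?case using V.kernel_in_nullsp[OF goodD(1)] by (simp add: u_def ST \<zeta>_def)
      qed
      fix \<gamma> assume \<gamma>: "\<gamma> < \<alpha> + real k - 1/2"
      have D0: "0 \<le> D" unfolding D_def using C0(1) by (induction n) auto
      \<comment> \<open>Since \<delta> \<ge> 1, dividing by it does not increase a positive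
        \<gamma>; a nonpositive \<gamma> gives a nonpositive quotient, while s is positive.\<close>
      have \<gamma>s: "\<gamma> / real \<delta> \<le> s"
      proof (cases "\<gamma> \<le> 0")
        case True
        then have "\<gamma> / real \<delta> \<le> 0" by (simp add: divide_nonpos_nonneg)
        then show ?thesis using s0 by simp
      next
        case False
        then have "\<gamma> / real \<delta> \<le> \<gamma> / 1" using \<delta> by (intro divide_left_mono) auto
        then show ?thesis using \<gamma> by (simp add: s_def)
      qed
      have "\<forall>\<^sub>F h in F. l2norm (\<lambda>x. u h x - uh h x) \<le> (C2 * D * (1 + C1 powr (1 / real \<delta>))) * h powr (\<gamma> / real \<delta>)"
        using good
      proof eventually_elim
        case (elim h)
        note h = goodD(4,5)[OF elim] and e = goodD(3)[OF elim]
        have b: "l2norm (\<lambda>x. u h x - uh h x) \<le> C2 * D * (h powr s + \<sigma> h)"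
          using goodD(2)[OF elim] by (simp add: u_def)
        have "\<sigma> h \<le> C1 powr (1 / real \<delta>) * h powr (\<gamma> / real \<delta>)"
          by (rule root_rate[OF _ \<delta> e]) (use C1(1) h \<gamma> in \<open>auto simp: s_def \<sigma>_def\<close>)
        moreover have "h powr s \<le> h powr (\<gamma> / real \<delta>)" using h \<gamma>s by (intro powr_mono') auto
        ultimately have "h powr s + \<sigma> h \<le> (1 + C1 powr (1 / real \<delta>)) * h powr (\<gamma> / real \<delta>)"
          by (simp add: algebra_simps)
        then have "C2 * D * (h powr s + \<sigma> h) \<le> C2 * D * ((1 + C1 powr (1 / real \<delta>)) * h powr (\<gamma> / real \<delta>))"
          using C2(1) D0 by (intro mult_left_mono) auto
        with b show ?case by (simp add: mult.assoc)
      qed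
      then show "\<exists>C. \<forall>\<^sub>F h in F. l2norm (\<lambda>x. u h x - uh h x) \<le> C * h powr (\<gamma> / real \<delta>)" by blast
    qed
  qed
qed

end
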